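(* Let $k\ge 3$, $a>0$ and $D\ge 1$, and suppose that for each $n$, $\mathcal{H}=\mathcal{H}_n$ is a $k$-uniform hypergraph satisfying $v(\mathcal{H})\le Dn$, $e(\mathcal{H})\ge an^2$ and $\Delta_2(\mathcal{H})\le D$. Let $X=e(\mathcal{H}_p)$, $\mu=\mathbb{E}X$, $\Lambda=\mu(1+np^{k-1})$ and $\varphi(x)=(1+x)\log(1+x)-x$. Given $\gamma\in(0,1)$, there are $n_0>0$ (depending only on $k,a,D$) as well as $c,C,d>0$ and $\lambda\ge 1$ (depending only on $\gamma,k,a,D$) such that for all $n\ge n_0$, $p\in(0,1]$ and $t>0$ the following holds. If one of (a) $p\notin\bigl(n^{-1/(k-1)-\gamma},\ \gamma n^{-1/(k-1)}(\log n)^{1/(k-1)}\bigr)$, or (b) $t\ge \gamma\min\{(\mathrm{Var}\,X)^{2/3},\mu^{2/3}\}(\log n)^{4/3}$, or (c) $t\ge \mu p^{(k-2)/3-\gamma}$ holds, then \[ \Pr(X\ge \mu+t)\le (1+n^{-1})\exp\Bigl(-c\min\bigl\{\varphi(t/\mu)\mu^2/\Lambda,\ \sqrt{t}\log(e/p)\bigr\}\Bigr). \] Furthermore, if one of (i) $p\le n^{-2/(k+1/3)}$, or (ii) $t\ge \min\{(\mathrm{Var}\,X)^{2/3},\mu^{2/3}\}(\log n)^{2/3}$ and $p\le n^{-1/(k-1)}\log n$, or (iii) $t\ge\min\{\sqrt{\mathrm{Var}\,X},\sqrt{\Lambda}\}$ and $\gamma n^{-1/(k-1)}\le p\le 1-\gamma$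 holds, then $\mathfrak{X}(\mathcal{H},D,\min\{\lambda t,\mu+t\})$ and $\mu+t\ge 1$ imply \[ \Pr(X\ge\mu+t)\ge d\exp\Bigl(-C\min\bigl\{\varphi(t/\mu)\mu^2/\Lambda,\ \sqrt{t}\log(1/p)\bigr\}\Bigr). \]
   Context: For a hypergraph $\mathcal{H}$, $V_p(\mathcal{H})$ is the random subset of $V(\mathcal{H})$ containing each vertex independently with probability $p$, and $\mathcal{H}_p=\mathcal{H}[V_p(\mathcal{H})]$ is the induced subhypergraph; $e(\cdot)$ and $v(\cdot)$ denote the numbers of edges and vertices. $\Delta_j(\mathcal{H})=\max_{S\subseteq V(\mathcal{H}),|S|=j}|\{f\in\mathcal{H}: S\subseteq f\}|$. The property $\mathfrak{X}(\mathcal{H},D,x)$ means: there exists $W\subseteq V(\mathcal{H})$ with $|W|\le D\max\{\sqrt{x},1\}$ and $e(\mathcal{H}[W])\ge x$. $\log$ is the natural logarithm. *)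

theory Defs
  imports "HOL-Probability.Probability"
begin

record 'a hypergraph =
  verts :: "'a set"
  edges :: "'a set set"

definition uniform_hypergraph :: "nat \<Rightarrow> 'a hypergraph \<Rightarrow> bool" where
  "uniform_hypergraph k H \<longleftrightarrow>
     finite (verts H) \<and> (\<forall>f\<in>edges H. f \<subseteq> verts H \<and> card f = k)"

definition num_verts :: "'a hypergraph \<Rightarrow> nat" where
  "num_verts H = card (verts H)"

definition num_edges :: "'a hypergraph \<Rightarrow> nat" where
  "num_edges H = card (edges H)"

definition induced :: "'a hypergraph \<Rightarrow> 'a set \<Rightarrow> 'a hypergraph" where
  "induced H W = \<lparr>verts = W, edges = {f \<in> edges H. f \<subseteq> W}\<rparr>"

text \<open>Meaningful only when \<open>H\<close> has at least \<open>j\<close> vertices; otherwise the maximum ranges over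
  the empty set and is unspecified.\<close>

definition max_codegree :: "nat \<Rightarrow> 'a hypergraph \<Rightarrow> nat" where
  "max_codegree j H =
     Max ((\<lambda>S. card {f \<in> edges H. S \<subseteq> f}) ` {S. S \<subseteq> verts H \<and> card S = j})"

definition random_verts :: "'a hypergraph \<Rightarrow> real \<Rightarrow> 'a set pmf" where
  "random_verts H p =
     map_pmf (\<lambda>\<omega>. {v \<in> verts H. \<omega> v}) (Pi_pmf (verts H) False (\<lambda>_. bernoulli_pmf p))"

definition random_induced :: "'a hypergraph \<Rightarrow> real \<Rightarrow> 'a hypergraph pmf" where
  "random_induced H p = map_pmf (induced H) (random_verts H p)"

definition small_dense_set :: "'a hypergraph \<Rightarrow> real \<Rightarrow> real \<Rightarrow> bool" where
  "small_dense_set H D x \<longleftrightarrow>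
     (\<exists>W \<subseteq> verts H. real (card W) \<le> D * max (sqrt x) 1 \<and> real (num_edges (induced H W)) \<ge> x)"

definition phi :: "real \<Rightarrow> real" where
  "phi x = (1 + x) * ln (1 + x) - x"

end

theory Submission
  imports Defs
begin

text \<open>
  Upper tail. Let \<open>M\<close> be the target exponent, \<open>R = \<phi>(t/\<mu>) \<mu> / M\<close>, and \<open>s\<close> a large multiple of \<open>R\<close>.
  A subfamily of maximum degree \<open>s\<close> reaches \<open>\<mu> + t/2\<close> edges with probability at most
  \<open>exp (- c \<phi>(t/\<mu>) \<mu> / s)\<close>: compare the number of ordered tuples of disjoint edges it contains
  with their expected number. The remaining edges are controlled by sunflowers centred at a vertex. At
  each dyadic scale \<open>2^j s\<close>, delete the vertex set \<open>U\<^sub>j\<close> of a maximal disjoint family of sunflowers of that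
  size; afterwards all degrees are \<open>O(2^j s)\<close>, and a union bound over disjoint families shows that
  \<open>U\<^sub>j\<close> has size \<open>O(M / ln (2^j s / n p^(k-1)))\<close> up to probability \<open>exp (- c M) / n\<close>. The edges lost
  between consecutive scales add up to at most \<open>t/2\<close>. The three conditions on \<open>p\<close> and \<open>t\<close> serve only
  to make \<open>s ln (s / n p^(k-1))\<close> exceed a multiple of \<open>ln n\<close>, which pays for the choice of sunflower centres.

  Lower tail bounds. Planting the dense set costs \<open>p^|W|\<close>, and Chebyshev's inequality controls the rest.
  The other exponent comes from raising \<open>p\<close> slightly if \<open>n p^(k-1)\<close> is bounded below, and from planting
  \<open>O(t)\<close> disjoint edges in the very sparse case, where the change of measure is the number of
  such tuples present.
\<close>

section \<open>Random vertex subsets\<close>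

text \<open>The size \<open>s\<close> is a multiple of \<open>R\<close> because the bounded-degree
  count has exponent about phi(t/mu) mu / s, which must be of order \<open>M\<close>. As M \<le>
  phi(t/mu) mu^2 / Lambda, R is at least 1 + n p^(k-1), so s lies above the order of a typical
  degree. The obstacle is the factor of about n for the centre of each sunflower. It is harmless if
  n p^(k-1) is polynomially small, since then ln (s / n p^(k-1)) has order ln n, or if R itself has
  order ln n. Between these two regimes lies the window of p in condition (a); there (b) or (c)
  makes t so large that M, being at most sqrt t ln (e/p), forces R to be large. The same bound on M
  controls the coarsest scale, with L the logarithm there: about M / L vertices of degree about M /
  L carry (M / L)^2 edges, which is O(t) once L is comparable with ln (e/p). In the lower bounds the
  two exponents need separate constructions only where neither dominates; elsewhere planting the
  dense set already gives the minimum up to a constant.\<close>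

definition rexp :: "'a set \<Rightarrow> real \<Rightarrow> ('a set \<Rightarrow> real) \<Rightarrow> real" where
  "rexp V p g = (\<Sum>A\<in>Pow V. p ^ card A * (1 - p) ^ card (V - A) * g A)"

definition rprob :: "'a set \<Rightarrow> real \<Rightarrow> ('a set \<Rightarrow> bool) \<Rightarrow> real" where
  "rprob V p Q = rexp V p (\<lambda>A. of_bool (Q A))"

lemma rexp_empty [simp]: "rexp {} p g = g {}"
  by (simp add: rexp_def)

lemma rexp_cong: "(\<And>A. A \<subseteq> V \<Longrightarrow> g A = h A) \<Longrightarrow> rexp V p g = rexp V p h"
  by (simp add: rexp_def)

text \<open>Conditioning on whether \<open>v\<close> is chosen. Independence of the vertices enters
  only through this recursion, by induction on \<open>V\<close>.\<close>

lemma rexp_insert: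
  assumes "finite V" "v \<notin> V"
  shows "rexp (insert v V) p g = p * rexp V p (\<lambda>A. g (insert v A)) + (1 - p) * rexp V p g"
proof -
  let ?w = "\<lambda>U A. p ^ card A * (1 - p) ^ card (U - A)"
  have inj: "inj_on (insert v) (Pow V)"
    using assms(2) by (auto simp: inj_on_def)
  have disj: "Pow V \<inter> insert v ` Pow V = {}" using assms(2) by auto
  have 1: "?w (insert v V) A = (1 - p) * ?w V A" if "A \<in> Pow V" for A
  proof -
    have "insert v V - A = insert v (V - A)" using that assms by auto
    then show ?thesis using that assms by (simp add: finite_subset)
  qed
  have 2: "?w (insert v V) (insert v A) = p * ?w V A" if "A \<in> Pow V" for A
  proof -
    have "insert v V - insert v A = V - A" using that assms by auto
    moreover have "card (insert v A) = Suc (card A)"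
      using that assms by (meson PowD card_insert_disjoint finite_subset subsetD)
    ultimately show ?thesis by simp
  qed
  have "rexp (insert v V) p g = (\<Sum>A\<in>Pow V. ?w (insert v V) A * g A)
      + (\<Sum>A\<in>Pow V. ?w (insert v V) (insert v A) * g (insert v A))"
    unfolding rexp_def Pow_insert using assms(1) disj inj
    by (subst sum.union_disjoint) (auto simp: sum.reindex)
  also have "\<dots> = (\<Sum>A\<in>Pow V. (1 - p) * ?w V A * g A)
      + (\<Sum>A\<in>Pow V. p * ?w V A * g (insert v A))"
    using 1 2 by (intro arg_cong2[where f="(+)"] sum.cong) simp_all
  finally show ?thesis by (simp add: rexp_def sum_distrib_left mult.assoc add.commute)
qed

lemma rexp_add: "rexp V p (\<lambda>A. g A + h A) = rexp V p g + rexp V p h"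
  by (simp add: rexp_def ring_distribs sum.distrib)

lemma rexp_diff: "rexp V p (\<lambda>A. g A - h A) = rexp V p g - rexp V p h"
  by (simp add: rexp_def right_diff_distrib sum_subtractf)

lemma rexp_cmult: "rexp V p (\<lambda>A. c * g A) = c * rexp V p g"
  by (simp add: rexp_def sum_distrib_left mult_ac)

lemma rexp_sum: "rexp V p (\<lambda>A. \<Sum>i\<in>I. g i A) = (\<Sum>i\<in>I. rexp V p (g i))"
  unfolding rexp_def sum_distrib_left by (rule sum.swap)

lemma rexp_const: "finite V \<Longrightarrow> rexp V p (\<lambda>A. c) = c"
  by (induction V rule: finite_induct) (simp_all add: rexp_insert algebra_simps)

lemma rexp_mono:
  assumes "0 \<le> p" "p \<le> 1" "\<And>A. A \<subseteq> V \<Longrightarrow> g A \<le> h A"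
  shows "rexp V p g \<le> rexp V p h"
  unfolding rexp_def using assms by (intro sum_mono mult_left_mono) auto

lemma rexp_nonneg:
  assumes "0 \<le> p" "p \<le> 1" "\<And>A. A \<subseteq> V \<Longrightarrow> 0 \<le> g A"
  shows "0 \<le> rexp V p g"
  unfolding rexp_def using assms by (intro sum_nonneg mult_nonneg_nonneg) auto

lemma rprob_mono:
  assumes "0 \<le> p" "p \<le> 1" "\<And>A. A \<subseteq> V \<Longrightarrow> P A \<Longrightarrow> Q A"
  shows "rprob V p P \<le> rprob V p Q"
  unfolding rprob_def using assms by (intro rexp_mono) auto

lemma rprob_nonneg: "0 \<le> p \<Longrightarrow> p \<le> 1 \<Longrightarrow> 0 \<le> rprob V p P"
  unfolding rprob_def by (intro rexp_nonneg) auto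

lemma rprob_union:
  assumes "0 \<le> p" "p \<le> 1"
  shows "rprob V p (\<lambda>A. P A \<or> Q A) \<le> rprob V p P + rprob V p Q"
  unfolding rprob_def rexp_add[symmetric] using assms by (intro rexp_mono) auto

lemma rprob_UN:
  assumes "0 \<le> p" "p \<le> 1" "finite I"
  shows "rprob V p (\<lambda>A. \<exists>i\<in>I. P i A) \<le> (\<Sum>i\<in>I. rprob V p (P i))"
  unfolding rprob_def rexp_sum[symmetric]
proof (rule rexp_mono)
  fix A
  show "of_bool (\<exists>i\<in>I. P i A) \<le> (\<Sum>i\<in>I. of_bool (P i A) :: real)"
  proof (cases "\<exists>i\<in>I. P i A")
    case True
    then obtain i where "i \<in> I" "P i A" by blast
    then have "(1::real) = of_bool (P i A)" by simp
    also have "\<dots> \<le> (\<Sum>i\<in>I. of_bool (P i A))"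
      using \<open>i \<in> I\<close> assms(3) by (intro member_le_sum) auto
    finally show ?thesis using True by simp
  qed (simp add: sum_nonneg)
qed (use assms in auto)

lemma rprob_compl: "finite V \<Longrightarrow> rprob V p (\<lambda>A. \<not> P A) = 1 - rprob V p P"
  using rexp_diff[of V p "\<lambda>_. 1" "\<lambda>A. of_bool (P A)"]
  by (simp add: rprob_def of_bool_not_iff rexp_const)

lemma rprob_inter_ge:
  assumes "finite V" "0 \<le> p" "p \<le> 1"
  shows "rprob V p P + rprob V p Q - 1 \<le> rprob V p (\<lambda>A. P A \<and> Q A)"
proof -
  have "rprob V p P + rprob V p Q - 1
      = rexp V p (\<lambda>A. (of_bool (P A) + of_bool (Q A)) - 1)"
    using assms by (simp add: rprob_def rexp_add rexp_diff rexp_const)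
  also have "\<dots> \<le> rprob V p (\<lambda>A. P A \<and> Q A)"
    unfolding rprob_def by (rule rexp_mono) (use assms in auto)
  finally show ?thesis .
qed

lemma rprob_markov:
  assumes "0 \<le> p" "p \<le> 1" "\<And>A. A \<subseteq> V \<Longrightarrow> 0 \<le> g A" "0 < c"
  shows "rprob V p (\<lambda>A. c \<le> g A) \<le> rexp V p g / c"
proof -
  have "rprob V p (\<lambda>A. c \<le> g A) \<le> rexp V p (\<lambda>A. (1/c) * g A)"
    unfolding rprob_def using assms by (intro rexp_mono) (auto simp: field_simps)
  then show ?thesis using rexp_cmult[of V p "1/c" g] by simp
qed

text \<open>Conditioning on \<open>S\<close> being present amounts to adding \<open>S\<close> to the random set.\<close>

lemma rexp_plant:
  assumes "finite V" "S \<subseteq> V"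
  shows "rexp V p (\<lambda>A. of_bool (S \<subseteq> A) * g A) = p ^ card S * rexp V p (\<lambda>A. g (A \<union> S))"
proof -
  have single: "rexp V p (\<lambda>A. of_bool (v \<in> A) * g A) = p * rexp V p (\<lambda>A. g (insert v A))"
    if "v \<in> V" for v and g :: "'a set \<Rightarrow> real"
  proof -
    define U where "U = V - {v}"
    have U: "V = insert v U" "v \<notin> U" "finite U" using that assms by (auto simp: U_def)
    have "rexp U p (\<lambda>A. of_bool (v \<in> A) * g A) = rexp U p (\<lambda>A. 0)"
      using U by (intro rexp_cong) auto
    then have "rexp V p (\<lambda>A. of_bool (v \<in> A) * g A) = p * rexp U p (\<lambda>A. g (insert v A))"
      unfolding U(1) using U by (simp add: rexp_insert rexp_const)
    moreover have "rexp V p (\<lambda>A. g (insert v A)) = rexp U p (\<lambda>A. g (insert v A))"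
      unfolding U(1) using U by (simp add: rexp_insert algebra_simps)
    ultimately show ?thesis by simp
  qed
  have "finite S" using assms finite_subset by blast
  then show ?thesis using assms(2)
  proof (induction S arbitrary: g rule: finite_induct)
    case empty
    then show ?case by simp
  next
    case (insert v S)
    have "rexp V p (\<lambda>A. of_bool (insert v S \<subseteq> A) * g A)
        = rexp V p (\<lambda>A. of_bool (S \<subseteq> A) * (of_bool (v \<in> A) * g A))"
      by (rule rexp_cong) auto
    also have "\<dots> = p ^ card S * rexp V p (\<lambda>A. of_bool (v \<in> A \<union> S) * g (A \<union> S))"
      using insert by (subst insert.IH) auto
    also have "rexp V p (\<lambda>A. of_bool (v \<in> A \<union> S) * g (A \<union> S))
        = rexp V p (\<lambda>A. of_bool (v \<in> A) * g (A \<union> S))"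
      using insert by (intro rexp_cong) auto
    also have "\<dots> = p * rexp V p (\<lambda>A. g (insert v A \<union> S))"
      using insert by (subst single) auto
    finally show ?case using insert by simp
  qed
qed

lemma rexp_subset: "finite V \<Longrightarrow> S \<subseteq> V \<Longrightarrow> rexp V p (\<lambda>A. of_bool (S \<subseteq> A)) = p ^ card S"
  using rexp_plant[of V S p "\<lambda>_. 1"] by (simp add: rexp_const)

text \<open>Links the finite weighted sum \<open>rexp\<close>, in which all estimates are made, to
  the expectation over the product distribution. The induction peels off one coordinate of
  \<open>Pi_pmf\<close>, matching \<open>rexp_insert\<close>.\<close>

lemma expectation_random_verts:
  assumes "finite (verts H)" "0 \<le> p" "p \<le> 1"
  shows "measure_pmf.expectation (random_verts H p) g = rexp (verts H) p g"
proof -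
  have "measure_pmf.expectation (Pi_pmf V False (\<lambda>_. bernoulli_pmf p)) (\<lambda>\<omega>. g {v\<in>V. \<omega> v})
      = rexp V p g" if "finite V" for V :: "'a set" and g :: "'a set \<Rightarrow> real"
    using that
  proof (induction V arbitrary: g rule: finite_induct)
    case empty
    then show ?case by simp
  next
    case (insert v V)
    let ?P = "Pi_pmf V False (\<lambda>_. bernoulli_pmf p)"
    have fin: "finite (set_pmf ?P)"
      using insert by (subst set_Pi_pmf) (auto intro!: finite_PiE_dflt)
    have *: "measure_pmf.expectation (?P \<bind> (\<lambda>f. return_pmf (f(v := b)))) (\<lambda>\<omega>. g {u \<in> insert v V. \<omega> u})
        = rexp V p (\<lambda>A. g (if b then insert v A else A))" for b
    proof -
      have "measure_pmf.expectation (?P \<bind> (\<lambda>f. return_pmf (f(v := b)))) (\<lambda>\<omega>. g {u \<in> insert v V. \<omega> u})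
         = measure_pmf.expectation ?P (\<lambda>\<omega>. g {u \<in> insert v V. (fun_upd \<omega> v b) u})"
        by (simp add: map_pmf_def[symmetric])
      also have "(\<lambda>\<omega>. g {u \<in> insert v V. (fun_upd \<omega> v b) u})
          = (\<lambda>\<omega>. (\<lambda>A. g (if b then insert v A else A)) {u \<in> V. \<omega> u})"
        using insert(2) by (intro ext arg_cong[where f=g]) auto
      finally show ?thesis using insert.IH[of "\<lambda>A. g (if b then insert v A else A)"] by (rule trans)
    qed
    have "measure_pmf.expectation (Pi_pmf (insert v V) False (\<lambda>_. bernoulli_pmf p))
            (\<lambda>\<omega>. g {u \<in> insert v V. \<omega> u})
        = (\<Sum>b\<in>UNIV. pmf (bernoulli_pmf p) b *\<^sub>R
            measure_pmf.expectation (?P \<bind> (\<lambda>f. return_pmf (f(v := b)))) (\<lambda>\<omega>. g {u \<in> insert v V. \<omega> u}))"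
      unfolding Pi_pmf_insert'[OF insert(1,2)]
      by (rule pmf_expectation_bind) (use fin in auto)
    also have "\<dots> = rexp (insert v V) p g"
      using insert assms by (simp only: *) (simp add: UNIV_bool rexp_insert)
    finally show ?case .
  qed
  from this[OF assms(1)] show ?thesis by (simp add: random_verts_def)
qed

text \<open>Cauchy--Schwarz change of measure; the factor is the chi-square divergence plus one.\<close>

lemma rexp_change_measure:
  assumes "finite V" "0 < p" "p < 1" "0 \<le> q" "q \<le> 1"
  shows "(rexp V q g)\<^sup>2 \<le> (1 + (q - p)\<^sup>2 / (p * (1 - p))) ^ card V * rexp V p (\<lambda>A. (g A)\<^sup>2)"
  using assms(1)
proof (induction V arbitrary: g rule: finite_induct)
  case empty
  then show ?case by simp
next
  case (insert v V)
  define x where "x = 1 + (q - p)\<^sup>2 / (p * (1 - p))"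
  have x: "x = q\<^sup>2 / p + (1 - q)\<^sup>2 / (1 - p)"
    using assms unfolding x_def by (simp add: divide_simps power2_eq_square) algebra
  have x0: "0 \<le> x" using assms unfolding x_def by simp
  define a1 a0 where "a1 = rexp V q (\<lambda>A. g (insert v A))" and "a0 = rexp V q g"
  define b1 b0 where "b1 = rexp V p (\<lambda>A. (g (insert v A))\<^sup>2)" and "b0 = rexp V p (\<lambda>A. (g A)\<^sup>2)"
  have 1: "a1\<^sup>2 \<le> x ^ card V * b1" "a0\<^sup>2 \<le> x ^ card V * b0"
    using insert.IH unfolding a1_def a0_def b1_def b0_def x_def by blast+
  \<comment> \<open>Cauchy-Schwarz on two points: the defect is a perfect square, because
    \<open>x\<close> is the second moment under \<open>p\<close> of the one-coordinate density of
    \<open>q\<close> against \<open>p\<close>.\<close>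
  have "x * (p * a1\<^sup>2 + (1 - p) * a0\<^sup>2) - (q * a1 + (1 - q) * a0)\<^sup>2
      = (q * (1 - p) * a0 - (1 - q) * p * a1)\<^sup>2 / (p * (1 - p))"
    unfolding x using assms by (simp add: divide_simps power2_eq_square) algebra
  moreover have "0 \<le> (q * (1 - p) * a0 - (1 - q) * p * a1)\<^sup>2 / (p * (1 - p))"
    using assms by simp
  ultimately have "(q * a1 + (1 - q) * a0)\<^sup>2 \<le> x * (p * a1\<^sup>2 + (1 - p) * a0\<^sup>2)" by linarith
  also have "\<dots> \<le> x * (p * (x ^ card V * b1) + (1 - p) * (x ^ card V * b0))"
    using 1 x0 assms by (intro mult_left_mono add_mono) auto
  also have "\<dots> = x ^ card (insert v V) * (p * b1 + (1 - p) * b0)"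
    using insert by (simp add: algebra_simps)
  finally show ?case using insert unfolding a1_def a0_def b1_def b0_def x_def
    by (simp add: rexp_insert)
qed

section \<open>Counting disjoint tuples\<close>

text \<open>Counts ordered \<open>m\<close>-tuples of pairwise disjoint members of \<open>F\<close> that lie in \<open>A\<close> and avoid \<open>U\<close>,
  each choice being subject to the side condition \<open>ok\<close>.\<close>

fun dcount :: "('a set \<Rightarrow> 'a set \<Rightarrow> bool) \<Rightarrow> 'a set set \<Rightarrow> nat \<Rightarrow> 'a set \<Rightarrow> 'a set \<Rightarrow> real" where
  "dcount ok F 0 U A = 1"
| "dcount ok F (Suc m) U A =
     (\<Sum>S | S \<in> F \<and> S \<inter> U = {} \<and> ok U S. of_bool (S \<subseteq> A) * dcount ok F m (U \<union> S) A)"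

lemma dcount_nonneg: "0 \<le> dcount ok F m U A"
  by (induction m arbitrary: U) (auto intro!: sum_nonneg)

text \<open>All sets counted here avoid \<open>U\<close>, so points of \<open>U\<close> added to
  \<open>A\<close> cannot help to contain them. This is why planting a chosen set leaves the count
  of the later choices unchanged.\<close>

lemma dcount_absorb: "T \<subseteq> U \<Longrightarrow> dcount ok F m U (A \<union> T) = dcount ok F m U A"
proof (induction m arbitrary: U)
  case (Suc m)
  have "S \<subseteq> A \<union> T \<longleftrightarrow> S \<subseteq> A" if "S \<inter> U = {}" for S
    using that Suc.prems by blast
  moreover have "dcount ok F m (U \<union> S) (A \<union> T) = dcount ok F m (U \<union> S) A" for S
    using Suc.prems by (intro Suc.IH) auto
  ultimately show ?case by (auto intro!: sum.cong)
qed simp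

text \<open>The first chosen set \<open>S\<close> is planted at cost \<open>p ^ w\<close>; by
  \<open>dcount_absorb\<close> it then survives only in the weight \<open>g\<close>. Iterated,
  \<open>g\<close> is evaluated on \<open>A\<close> together with all chosen sets.\<close>

lemma rexp_dcount_Suc:
  assumes "finite V" "\<And>S. S \<in> F \<Longrightarrow> S \<subseteq> V \<and> card S = w"
  shows "rexp V p (\<lambda>A. g A * dcount ok F (Suc m) U A)
    = (\<Sum>S | S \<in> F \<and> S \<inter> U = {} \<and> ok U S.
         p ^ w * rexp V p (\<lambda>A. g (A \<union> S) * dcount ok F m (U \<union> S) A))"
proof -
  have "rexp V p (\<lambda>A. g A * dcount ok F (Suc m) U A)
      = (\<Sum>S | S \<in> F \<and> S \<inter> U = {} \<and> ok U S.
          rexp V p (\<lambda>A. of_bool (S \<subseteq> A) * (g A * dcount ok F m (U \<union> S) A)))"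
    unfolding rexp_sum[symmetric] dcount.simps sum_distrib_left
    by (intro rexp_cong sum.cong refl) (simp add: mult_ac)
  also have "\<dots> = (\<Sum>S | S \<in> F \<and> S \<inter> U = {} \<and> ok U S.
         p ^ w * rexp V p (\<lambda>A. g (A \<union> S) * dcount ok F m (U \<union> S) A))"
  proof (rule sum.cong[OF refl])
    fix S assume S: "S \<in> {S. S \<in> F \<and> S \<inter> U = {} \<and> ok U S}"
    then have "S \<subseteq> V" "card S = w" using assms by auto
    then show "rexp V p (\<lambda>A. of_bool (S \<subseteq> A) * (g A * dcount ok F m (U \<union> S) A))
        = p ^ w * rexp V p (\<lambda>A. g (A \<union> S) * dcount ok F m (U \<union> S) A)"
      using assms(1) by (subst rexp_plant) (auto simp: dcount_absorb)
  qed
  finally show ?thesis .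
qed

lemma rexp_dcount_le:
  assumes "finite V" "finite F" "\<And>S. S \<in> F \<Longrightarrow> S \<subseteq> V \<and> card S = w" "0 \<le> p" "p \<le> 1"
  shows "rexp V p (dcount ok F m U) \<le> (real (card F) * p ^ w) ^ m"
proof (induction m arbitrary: U)
  case 0
  then show ?case using assms by (simp add: rexp_const)
next
  case (Suc m)
  have "rexp V p (dcount ok F (Suc m) U)
      = (\<Sum>S | S \<in> F \<and> S \<inter> U = {} \<and> ok U S. p ^ w * rexp V p (dcount ok F m (U \<union> S)))"
    using rexp_dcount_Suc[where V=V and F=F and w=w and g="\<lambda>_. 1" and p=p, OF assms(1,3)]
    by (simp del: dcount.simps)
  also have "\<dots> \<le> (\<Sum>S | S \<in> F \<and> S \<inter> U = {} \<and> ok U S. p ^ w * (real (card F) * p ^ w) ^ m)"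
    using Suc.IH assms by (intro sum_mono mult_left_mono) auto
  also have "\<dots> \<le> (\<Sum>S\<in>F. p ^ w * (real (card F) * p ^ w) ^ m)"
    using assms by (intro sum_mono2) auto
  finally show ?case by (simp del: dcount.simps add: mult_ac)
qed

text \<open>Greedy choice inside \<open>J\<close>: each chosen set rules out at most
  \<open>r\<close> members, so at least \<open>z\<close> candidates remain at every one of the
  \<open>m\<close> choices. The last choice needs no reserve after it, hence \<open>m - 1\<close> in
  the budget.\<close>

lemma dcount_ge:
  assumes "finite F" "J \<subseteq> F" "\<And>S. S \<in> J \<Longrightarrow> S \<subseteq> A"
    and "\<And>S. S \<in> J \<Longrightarrow> real (card {S'\<in>J. S' \<inter> S \<noteq> {}}) \<le> r"
    and "0 \<le> z" "0 \<le> r"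
    and "real (card {S\<in>J. S \<inter> U \<noteq> {}}) + (real m - 1) * r + z \<le> real (card J)"
  shows "z ^ m \<le> dcount (\<lambda>_ _. True) F m U A"
  using assms(7)
proof (induction m arbitrary: U)
  case (Suc m)
  have finJ: "finite J" using assms finite_subset by blast
  let ?G = "{S\<in>J. S \<inter> U = {}}"
  have "card J = card {S\<in>J. S \<inter> U \<noteq> {}} + card ?G"
    using finJ by (subst card_Un_disjoint[symmetric]) (auto intro!: arg_cong[where f=card])
  moreover have "0 \<le> real m * r" using assms by simp
  ultimately have G: "z \<le> real (card ?G)" using Suc.prems by simp
  have IH: "z ^ m \<le> dcount (\<lambda>_ _. True) F m (U \<union> S) A" if "S \<in> ?G" for S
  proof (rule Suc.IH)
    have "card {S'\<in>J. S' \<inter> (U \<union> S) \<noteq> {}} \<le> card ({S'\<in>J. S' \<inter> U \<noteq> {}} \<union> {S'\<in>J. S' \<inter> S \<noteq> {}})"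
      using finJ by (intro card_mono) auto
    also have "\<dots> \<le> card {S'\<in>J. S' \<inter> U \<noteq> {}} + card {S'\<in>J. S' \<inter> S \<noteq> {}}"
      by (rule card_Un_le)
    finally have "real (card {S'\<in>J. S' \<inter> (U \<union> S) \<noteq> {}}) \<le> real (card {S'\<in>J. S' \<inter> U \<noteq> {}}) + r"
      using assms(4)[of S] that by auto
    then show "real (card {S'\<in>J. S' \<inter> (U \<union> S) \<noteq> {}}) + (real m - 1) * r + z \<le> real (card J)"
      using Suc.prems by (simp add: algebra_simps)
  qed
  have "z ^ Suc m = z * z ^ m" by simp
  also have "\<dots> \<le> real (card ?G) * z ^ m" using G assms by (intro mult_right_mono) auto
  also have "\<dots> = (\<Sum>S\<in>?G. z ^ m)" by simp
  also have "\<dots> \<le> (\<Sum>S\<in>?G. of_bool (S \<subseteq> A) * dcount (\<lambda>_ _. True) F m (U \<union> S) A)"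
    using IH assms(3) by (intro sum_mono) auto
  also have "\<dots> \<le> dcount (\<lambda>_ _. True) F (Suc m) U A"
    unfolding dcount.simps using assms(1,2)
    by (intro sum_mono2) (auto simp: dcount_nonneg)
  finally show ?case .
qed simp

lemma dcount_le_power:
  assumes "finite F"
  shows "dcount ok F m U A \<le> real (card {S\<in>F. S \<subseteq> A}) ^ m"
proof (induction m arbitrary: U)
  case (Suc m)
  have "dcount ok F (Suc m) U A \<le> (\<Sum>S\<in>F. of_bool (S \<subseteq> A) * dcount ok F m (U \<union> S) A)"
    unfolding dcount.simps using assms by (intro sum_mono2) (auto simp: dcount_nonneg)
  also have "\<dots> \<le> (\<Sum>S\<in>F. of_bool (S \<subseteq> A) * real (card {S\<in>F. S \<subseteq> A}) ^ m)"
    using Suc.IH by (intro sum_mono mult_left_mono) auto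
  also have "\<dots> = real (card {S\<in>F. S \<subseteq> A}) ^ Suc m"
    using assms by (simp add: sum_distrib_right[symmetric] Int_def)
  finally show ?case .
qed simp

text \<open>Lower bound by exploration: \<open>R i U\<close> describes the sets \<open>U\<close> reachable after \<open>i\<close> choices.\<close>

lemma rexp_dcount_ge:
  assumes "finite V" "finite F" "\<And>S. S \<in> F \<Longrightarrow> S \<subseteq> V \<and> card S = w" "0 \<le> p" "0 \<le> z" "0 \<le> b"
    and step: "\<And>i U S. R i U \<Longrightarrow> i < j \<Longrightarrow> S \<in> F \<Longrightarrow> S \<inter> U = {} \<Longrightarrow> ok U S \<Longrightarrow> R (Suc i) (U \<union> S)"
    and many: "\<And>i U. R i U \<Longrightarrow> i < j \<Longrightarrow> z \<le> real (card {S. S \<in> F \<and> S \<inter> U = {} \<and> ok U S})"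
    and fin: "\<And>U. R j U \<Longrightarrow> b \<le> rexp V p (\<lambda>A. g (A \<union> U))"
  shows "R i U \<Longrightarrow> i + m = j \<Longrightarrow> (z * p ^ w) ^ m * b \<le> rexp V p (\<lambda>A. g (A \<union> U) * dcount ok F m U A)"
proof (induction m arbitrary: i U)
  case 0
  then show ?case using fin by simp
next
  case (Suc m)
  let ?G = "{S. S \<in> F \<and> S \<inter> U = {} \<and> ok U S}"
  let ?x = "p ^ w * ((z * p ^ w) ^ m * b)"
  have x: "0 \<le> ?x" using assms by simp
  have "(z * p ^ w) ^ Suc m * b = z * ?x" by (simp add: mult_ac)
  also have "\<dots> \<le> real (card ?G) * ?x"
    using many[of i U] Suc.prems x by (intro mult_right_mono) auto
  also have "\<dots> = (\<Sum>S\<in>?G. ?x)" by simp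
  also have "\<dots> \<le> (\<Sum>S\<in>?G. p ^ w * rexp V p (\<lambda>A. g (A \<union> S \<union> U) * dcount ok F m (U \<union> S) A))"
  proof (intro sum_mono mult_left_mono)
    fix S assume "S \<in> ?G"
    then have "R (Suc i) (U \<union> S)" using step[of i U S] Suc.prems by auto
    from Suc.IH[OF this] Suc.prems
    show "(z * p ^ w) ^ m * b \<le> rexp V p (\<lambda>A. g (A \<union> S \<union> U) * dcount ok F m (U \<union> S) A)"
      by (simp add: Un_ac)
  qed (use assms in auto)
  also have "\<dots> = rexp V p (\<lambda>A. g (A \<union> U) * dcount ok F (Suc m) U A)"
    using rexp_dcount_Suc[where V=V and F=F and w=w and g="\<lambda>A. g (A \<union> U)" and p=p, OF assms(1,3)]
    by (simp del: dcount.simps)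
  finally show ?case .
qed

lemma rprob_many_disjoint_le:
  assumes "finite V" "finite F" "\<And>S. S \<in> F \<Longrightarrow> S \<subseteq> V \<and> card S = w" "0 \<le> p" "p \<le> 1" "0 < w"
  shows "rprob V p (\<lambda>A. \<exists>C\<subseteq>F. card C = m \<and> pairwise disjnt C \<and> (\<forall>S\<in>C. S \<subseteq> A))
    \<le> (real (card F) * p ^ w) ^ m"
proof -
  have "rprob V p (\<lambda>A. \<exists>C\<subseteq>F. card C = m \<and> pairwise disjnt C \<and> (\<forall>S\<in>C. S \<subseteq> A))
      \<le> rexp V p (dcount (\<lambda>_ _. True) F m {})"
    unfolding rprob_def
  proof (rule rexp_mono)
    fix A
    show "of_bool (\<exists>C\<subseteq>F. card C = m \<and> pairwise disjnt C \<and> (\<forall>S\<in>C. S \<subseteq> A))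
        \<le> dcount (\<lambda>_ _. True) F m {} A"
    proof (cases "\<exists>C\<subseteq>F. card C = m \<and> pairwise disjnt C \<and> (\<forall>S\<in>C. S \<subseteq> A)")
      case True
      then obtain C where C: "C \<subseteq> F" "card C = m" "pairwise disjnt C" "\<forall>S\<in>C. S \<subseteq> A" by blast
      have "{S'\<in>C. S' \<inter> S \<noteq> {}} \<subseteq> {S}" if "S \<in> C" for S
        using C(3) that by (auto simp: pairwise_def disjnt_def)
      then have "card {S'\<in>C. S' \<inter> S \<noteq> {}} \<le> 1" if "S \<in> C" for S
        using that card_mono[of "{S}" "{S'\<in>C. S' \<inter> S \<noteq> {}}"] by simp
      \<comment> \<open>Each member of \<open>C\<close> meets only itself, so \<open>r = 1\<close>;
        with \<open>z = 1\<close> the budget condition reads m \<le> card C.\<close>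
      then have "1 ^ m \<le> dcount (\<lambda>_ _. True) F m {} A"
        using C assms(2) by (intro dcount_ge[where J=C and r=1]) auto
      then have "1 \<le> dcount (\<lambda>_ _. True) F m {} A" by simp
      then show ?thesis by (simp add: of_bool_def)
    next
      case False
      then show ?thesis by (simp only: of_bool_eq(1) dcount_nonneg)
    qed
  qed (use assms in auto)
  also have "\<dots> \<le> (real (card F) * p ^ w) ^ m"
    using assms by (intro rexp_dcount_le) auto
  finally show ?thesis .
qed

text \<open>A subfamily of bounded degree: the number of disjoint \<open>m\<close>-tuples it contains is at least
  \<open>(\<mu> + t / 2) ^ m\<close>, whereas the expected number of tuples is at most \<open>\<mu> ^ m\<close>.\<close>

lemma rprob_bounded_overlap_le:
  assumes "finite V" "finite F" "\<And>S. S \<in> F \<Longrightarrow> S \<subseteq> V \<and> card S = w" "0 \<le> p" "p \<le> 1"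
    and \<mu>: "\<mu> = real (card F) * p ^ w" "0 < \<mu>" and "0 < t" "0 < r"
  shows "rprob V p (\<lambda>A. \<exists>J\<subseteq>F. (\<forall>S\<in>J. S \<subseteq> A \<and> real (card {S'\<in>J. S' \<inter> S \<noteq> {}}) \<le> r)
            \<and> \<mu> + t \<le> real (card J))
    \<le> exp (- (t / (2 * r)) * ln (1 + t / (2 * \<mu>)))"
proof -
  \<comment> \<open>Choosing \<open>m - 1\<close> sets blocks at most \<open>t / 2\<close> members
    of \<open>J\<close>, so \<open>\<mu> + t / 2\<close> candidates remain at every choice. Since
    the last choice is not charged, rounding up is affordable.\<close>
  define m where "m = nat \<lceil>t / (2 * r)\<rceil>"
  have m: "t / (2 * r) \<le> real m" "(real m - 1) * r \<le> t / 2"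
  proof -
    show "t / (2 * r) \<le> real m" unfolding m_def by linarith
    have "real m - 1 \<le> t / (2 * r)" using assms unfolding m_def
      by (simp add: of_nat_nat ceiling_correct le_of_int_ceiling)
    then show "(real m - 1) * r \<le> t / 2" using assms by (simp add: field_simps)
  qed
  let ?z = "\<mu> + t / 2"
  let ?P = "\<lambda>A. \<exists>J\<subseteq>F. (\<forall>S\<in>J. S \<subseteq> A \<and> real (card {S'\<in>J. S' \<inter> S \<noteq> {}}) \<le> r) \<and> \<mu> + t \<le> real (card J)"
  have z: "0 < ?z" using assms by simp
  have "rprob V p ?P \<le> rprob V p (\<lambda>A. ?z ^ m \<le> dcount (\<lambda>_ _. True) F m {} A)"
  proof (rule rprob_mono)
    fix A assume "?P A"
    then obtain J where "J \<subseteq> F" "\<forall>S\<in>J. S \<subseteq> A \<and> real (card {S'\<in>J. S' \<inter> S \<noteq> {}}) \<le> r" "\<mu> + t \<le> real (card J)"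
      by blast
    then show "?z ^ m \<le> dcount (\<lambda>_ _. True) F m {} A"
      using assms m by (intro dcount_ge[where J=J and r=r]) auto
  qed (use assms in auto)
  also have "\<dots> \<le> rexp V p (dcount (\<lambda>_ _. True) F m {}) / ?z ^ m"
    using assms z by (intro rprob_markov) (auto simp: dcount_nonneg)
  also have "\<dots> \<le> \<mu> ^ m / ?z ^ m"
    using z rexp_dcount_le[OF assms(1-5)] unfolding \<mu> by (intro divide_right_mono) auto
  also have "\<dots> = exp (- (real m * ln (1 + t / (2 * \<mu>))))"
  proof -
    have "?z = \<mu> * (1 + t / (2 * \<mu>))" using \<mu>(2) by (simp add: distrib_left)
    then have "\<mu> / ?z = inverse (1 + t / (2 * \<mu>))" using \<mu>(2) by (simp add: inverse_eq_divide)
    also have "\<dots> = exp (- ln (1 + t / (2 * \<mu>)))"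
      using \<mu>(2) assms by (simp add: exp_minus add_pos_pos)
    finally have "(\<mu> / ?z) ^ m = exp (- ln (1 + t / (2 * \<mu>))) ^ m" by simp
    then show ?thesis by (simp add: power_divide exp_of_nat_mult[symmetric])
  qed
  also have "\<dots> \<le> exp (- (t / (2 * r)) * ln (1 + t / (2 * \<mu>)))"
  proof -
    have "0 \<le> ln (1 + t / (2 * \<mu>))" using assms(8) \<mu>(2) by simp
    from mult_right_mono[OF m(1) this] show ?thesis by simp
  qed
  finally show ?thesis .
qed

section \<open>Sunflowers and degree scales\<close>

text \<open>One term of the exponential series at \<open>s\<close>. It replaces Stirling's formula
  in bounding binomial coefficients.\<close>

lemma power_le_exp_fact: "real s ^ s \<le> exp (real s) * fact s"
proof -
  have "(\<Sum>n\<in>{s}. real s ^ n /\<^sub>R fact n) \<le> (\<Sum>n. real s ^ n /\<^sub>R fact n)"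
    using summable_exp_generic[of "real s"] by (intro sum_le_suminf) auto
  then show ?thesis by (simp add: exp_def field_simps)
qed

lemma of_nat_le_sum: "(m::nat) \<le> (\<Sum>i\<in>I. f i) \<Longrightarrow> real m \<le> (\<Sum>i\<in>I. real (f i))"
  by (simp flip: of_nat_sum)

text \<open>The codegree bound is asked of all pairs of distinct points of the type, so that no
  membership in \<open>V\<close> has to be checked; a pair not inside \<open>V\<close> lies in no
  edge.\<close>

locale codegree_hypergraph =
  fixes V :: "'a set" and E :: "'a set set" and k :: nat and D :: real
  assumes finV: "finite V" and edge: "\<And>f. f \<in> E \<Longrightarrow> f \<subseteq> V \<and> card f = k" and k3: "3 \<le> k"
    and codeg: "\<And>u v. u \<noteq> v \<Longrightarrow> real (card {f\<in>E. u \<in> f \<and> v \<in> f}) \<le> D" and D1: "1 \<le> D"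
begin

lemma finE: "finite E"
  using finV edge by (auto intro: finite_subset[of E "Pow V"])

lemma fin_edge: "f \<in> E \<Longrightarrow> finite f"
  using edge finV by (auto intro: finite_subset)

lemma edge_ne: "f \<in> E \<Longrightarrow> \<exists>u\<in>f. u \<noteq> v"
proof (rule ccontr)
  assume f: "f \<in> E" and "\<not> (\<exists>u\<in>f. u \<noteq> v)"
  then have "f \<subseteq> {v}" by auto
  then have "card f \<le> 1" using card_mono[of "{v}" f] by simp
  then show False using edge[OF f] k3 by simp
qed

lemma card_meeting_le:
  assumes "finite T" "v \<notin> T"
  shows "real (card {f\<in>E. v \<in> f \<and> f \<inter> T \<noteq> {}}) \<le> real (card T) * D"
proof -
  have "card {f\<in>E. v \<in> f \<and> f \<inter> T \<noteq> {}} \<le> card (\<Union>u\<in>T. {f\<in>E. u \<in> f \<and> v \<in> f})"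
    using assms finE by (intro card_mono) auto
  also have "\<dots> \<le> (\<Sum>u\<in>T. card {f\<in>E. u \<in> f \<and> v \<in> f})"
    by (rule card_UN_le[OF assms(1)])
  finally have "real (card {f\<in>E. v \<in> f \<and> f \<inter> T \<noteq> {}}) \<le> (\<Sum>u\<in>T. real (card {f\<in>E. u \<in> f \<and> v \<in> f}))"
    by (rule of_nat_le_sum)
  also have "\<dots> \<le> (\<Sum>u\<in>T. D)" using assms by (intro sum_mono codeg) auto
  finally show ?thesis by simp
qed

lemma degree_le: "real (card {f\<in>E. v \<in> f}) \<le> D * real (card V)"
proof -
  have "{f\<in>E. v \<in> f} = {f\<in>E. v \<in> f \<and> f \<inter> (V - {v}) \<noteq> {}}"
    using edge_ne[of _ v] edge by blast
  then have "real (card {f\<in>E. v \<in> f}) \<le> real (card (V - {v})) * D"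
    using card_meeting_le[of "V - {v}" v] finV by simp
  also have "\<dots> \<le> real (card V) * D"
    using D1 finV by (intro mult_right_mono) (auto intro: card_mono)
  finally show ?thesis by (simp add: mult.commute)
qed

text \<open>Greedy choice of petals: \<open>s\<close> petals use at most \<open>s * k\<close>
  vertices other than \<open>v\<close>, and each of these shares at most \<open>D\<close> edges with
  \<open>v\<close>. Hence an edge of \<open>G\<close> remains that meets the earlier petals only in
  \<open>v\<close>.\<close>

lemma sunflower_exists:
  assumes "G \<subseteq> E" "\<And>f. f \<in> G \<Longrightarrow> v \<in> f"
  shows "real s * real k * D \<le> real (card G) \<Longrightarrow>
    \<exists>Q\<subseteq>G. card Q = s \<and> (\<forall>f\<in>Q. \<forall>g\<in>Q. f \<noteq> g \<longrightarrow> f \<inter> g = {v})"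
proof (induction s)
  case 0
  then show ?case by (intro exI[of _ "{}"]) auto
next
  case (Suc s)
  have "0 \<le> real k * D" using D1 by simp
  then have "real s * real k * D \<le> real (card G)" using Suc.prems by (simp add: algebra_simps)
  then obtain Q where Q: "Q \<subseteq> G" "card Q = s" "\<forall>f\<in>Q. \<forall>g\<in>Q. f \<noteq> g \<longrightarrow> f \<inter> g = {v}"
    using Suc.IH by blast
  have QE: "Q \<subseteq> E" by (rule subset_trans[OF Q(1) assms(1)])
  have finQ: "finite Q" by (rule finite_subset[OF QE finE])
  have finG: "finite G" by (rule finite_subset[OF assms(1) finE])
  have fin: "finite (\<Union>Q)" by (rule finite_Union[OF finQ]) (use QE fin_edge in auto)
  let ?T = "\<Union>Q - {v}"
  have "card (\<Union>Q) \<le> (\<Sum>f\<in>Q. card f)" using card_UN_le[OF finQ, of "\<lambda>f. f"] by simp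
  also have "\<dots> = s * k" using Q assms edge by (subst sum.cong[OF refl, of _ _ "\<lambda>_. k"]) auto
  finally have "card ?T \<le> s * k" using card_mono[OF fin, of ?T] by auto
  then have "real (card ?T) * D \<le> real (s * k) * D"
    using D1 by (intro mult_right_mono of_nat_mono) auto
  then have "real (card {f\<in>E. v \<in> f \<and> f \<inter> ?T \<noteq> {}}) \<le> real (s * k) * D"
    using card_meeting_le[of ?T v] fin by simp
  also have "\<dots> < real (Suc s) * real k * D" using D1 k3 by (simp add: algebra_simps)
  also have "\<dots> \<le> real (card G)" by (rule Suc.prems)
  finally have "card {f\<in>E. v \<in> f \<and> f \<inter> ?T \<noteq> {}} < card G" by simp
  then have "\<not> G \<subseteq> {f\<in>E. v \<in> f \<and> f \<inter> ?T \<noteq> {}}"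
    using card_mono[of "{f\<in>E. v \<in> f \<and> f \<inter> ?T \<noteq> {}}" G] finE by auto
  then obtain f where f: "f \<in> G" "f \<inter> ?T = {}" using assms by blast
  \<comment> \<open>An edge has a vertex besides \<open>v\<close>, and for a member of
    \<open>Q\<close> that vertex would lie in \<open>?T\<close>.\<close>
  have "f \<notin> Q" using f assms edge_ne[of f v] by blast
  moreover have "f \<inter> g = {v}" if "g \<in> Q" for g
    using f that Q assms by blast
  ultimately show ?case using Q f finQ
    by (intro exI[of _ "insert f Q"]) (auto simp: Int_commute)
qed

text \<open>A flower is stored as its vertex set, not as its family of petals: containment in the
  random set and disjointness of flowers depend on nothing else.\<close>

definition flowers :: "nat \<Rightarrow> 'a set set" where
  "flowers s = {\<Union>Q |Q. Q \<subseteq> E \<and> card Q = s \<and>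
     (\<exists>v. (\<forall>f\<in>Q. v \<in> f) \<and> (\<forall>f\<in>Q. \<forall>g\<in>Q. f \<noteq> g \<longrightarrow> f \<inter> g = {v}))}"

lemma flower_props:
  assumes "B \<in> flowers s" "1 \<le> s"
  shows "B \<subseteq> V" "card B = 1 + s * (k - 1)"
proof -
  obtain Q v where Q: "B = \<Union>Q" "Q \<subseteq> E" "card Q = s" "\<forall>f\<in>Q. v \<in> f"
      "\<forall>f\<in>Q. \<forall>g\<in>Q. f \<noteq> g \<longrightarrow> f \<inter> g = {v}"
    using assms unfolding flowers_def by blast
  show "B \<subseteq> V" using Q edge by blast
  have finQ: "finite Q" by (rule finite_subset[OF Q(2) finE])
  have ne: "Q \<noteq> {}" using Q assms by auto
  have B: "B = insert v (\<Union>f\<in>Q. f - {v})" using Q ne by auto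
  have disj: "(f - {v}) \<inter> (g - {v}) = {}" if "f \<in> Q" "g \<in> Q" "f \<noteq> g" for f g
    using Q(5)[rule_format, OF that] by blast
  have "card (\<Union>f\<in>Q. f - {v}) = (\<Sum>f\<in>Q. card (f - {v}))"
    using Q(2) finQ fin_edge disj by (intro card_UN_disjoint) auto
  also have "\<dots> = (\<Sum>f\<in>Q. k - 1)"
    using Q edge fin_edge by (intro sum.cong refl) (auto simp: card_Diff_singleton_if)
  finally have "card (\<Union>f\<in>Q. f - {v}) = s * (k - 1)" using Q by simp
  moreover have "finite (\<Union>f\<in>Q. f - {v})"
    by (rule finite_UN_I[OF finQ]) (use Q(2) fin_edge in auto)
  moreover have "v \<notin> (\<Union>f\<in>Q. f - {v})" by simp
  ultimately show "card B = 1 + s * (k - 1)" unfolding B by (subst card_insert_disjoint) auto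
qed

lemma finite_flowers: "1 \<le> s \<Longrightarrow> finite (flowers s)"
  by (rule finite_subset[of _ "Pow V"]) (use flower_props(1) finV in auto)

text \<open>Choose the centre in \<open>V\<close>, then \<open>s\<close> of the at most
  \<open>D * card V\<close> edges through it; the binomial coefficient is at most
  \<open>(exp 1 * D * card V / s) ^ s\<close>.\<close>

lemma card_flowers_le:
  assumes "1 \<le> s"
  shows "real (card (flowers s)) \<le> real (card V) * (exp 1 * D * real (card V) / real s) ^ s"
proof -
  let ?d = "\<lambda>v. card {f\<in>E. v \<in> f}"
  have "flowers s \<subseteq> (\<Union>v\<in>V. Union ` {Q. Q \<subseteq> {f\<in>E. v \<in> f} \<and> card Q = s})"
  proof
    fix B assume "B \<in> flowers s"
    then obtain Q v where Q: "B = \<Union>Q" "Q \<subseteq> E" "card Q = s" "\<forall>f\<in>Q. v \<in> f"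
      unfolding flowers_def by blast
    have "Q \<noteq> {}" using Q(3) assms by auto
    then obtain f where "f \<in> Q" by blast
    then have "v \<in> V" using edge[of f] Q(2,4) by auto
    moreover have "Q \<in> {Q. Q \<subseteq> {f\<in>E. v \<in> f} \<and> card Q = s}" using Q by auto
    ultimately show "B \<in> (\<Union>v\<in>V. Union ` {Q. Q \<subseteq> {f\<in>E. v \<in> f} \<and> card Q = s})"
      unfolding Q(1) by (intro UN_I imageI)
  qed
  then have "card (flowers s) \<le> card (\<Union>v\<in>V. Union ` {Q. Q \<subseteq> {f\<in>E. v \<in> f} \<and> card Q = s})"
    by (rule card_mono[rotated]) (use finV finE in auto)
  also have "\<dots> \<le> (\<Sum>v\<in>V. card (Union ` {Q. Q \<subseteq> {f\<in>E. v \<in> f} \<and> card Q = s}))"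
    by (rule card_UN_le[OF finV])
  also have "\<dots> \<le> (\<Sum>v\<in>V. card {Q. Q \<subseteq> {f\<in>E. v \<in> f} \<and> card Q = s})"
    by (intro sum_mono card_image_le) (use finE in auto)
  also have "\<dots> = (\<Sum>v\<in>V. ?d v choose s)"
    by (intro sum.cong refl n_subsets) (use finE in auto)
  finally have "real (card (flowers s)) \<le> (\<Sum>v\<in>V. real (?d v choose s))"
    by (rule of_nat_le_sum)
  also have "\<dots> \<le> (\<Sum>v\<in>V. (exp 1 * D * real (card V) / real s) ^ s)"
  proof (rule sum_mono)
    fix v
    have "real (?d v choose s) * fact s \<le> real (?d v) ^ s"
      using binomial_fact_pow[of "?d v" s] by (metis of_nat_fact of_nat_le_iff of_nat_mult of_nat_power)
    also have "\<dots> \<le> (D * real (card V)) ^ s" using degree_le by (intro power_mono) auto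
    finally have "real (?d v choose s) \<le> (D * real (card V)) ^ s / fact s"
      by (simp add: field_simps)
    also have "\<dots> \<le> (D * real (card V)) ^ s * (exp (real s) / real s ^ s)"
    proof -
      have "1 / fact s \<le> exp (real s) / real s ^ s"
        using power_le_exp_fact[of s] assms by (simp add: field_simps)
      moreover have "0 \<le> (D * real (card V)) ^ s" using D1 by simp
      ultimately show ?thesis using mult_left_mono by fastforce
    qed
    also have "exp (real s) = exp 1 ^ s" using exp_of_nat_mult[of s 1] by simp
    finally show "real (?d v choose s) \<le> (exp 1 * D * real (card V) / real s) ^ s"
      by (simp add: power_mult_distrib power_divide mult_ac)
  qed
  finally show ?thesis by simp
qed

definition many_flowers :: "nat \<Rightarrow> nat \<Rightarrow> 'a set \<Rightarrow> bool" where
  "many_flowers s m A \<longleftrightarrow> (\<exists>C\<subseteq>flowers s. card C = m \<and> pairwise disjnt C \<and> (\<forall>S\<in>C. S \<subseteq> A))"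

text \<open>Each flower costs a factor \<open>p\<close> for every vertex except its centre, whose
  factor is given away. The choice of the centre leaves \<open>ln (card V)\<close> per flower.
  \<open>\<Theta>\<close> is \<open>exp 1\<close> times an upper bound for the expected degree of a
  chosen vertex.\<close>

lemma rprob_many_flowers_le:
  assumes "0 < p" "p \<le> 1" "1 \<le> s" "V \<noteq> {}"
  defines "\<Theta> \<equiv> exp 1 * D * real (card V) * p ^ (k - 1)"
  shows "rprob V p (many_flowers s m)
    \<le> exp (- (real m * (real s * ln (real s / \<Theta>) - ln (real (card V)))))"
proof -
  have N: "0 < real (card V)" using assms finV by (simp add: card_gt_0_iff)
  have \<Theta>: "0 < \<Theta>" using assms(1) D1 N unfolding \<Theta>_def by simp
  let ?w = "1 + s * (k - 1)"
  have "rprob V p (many_flowers s m) \<le> (real (card (flowers s)) * p ^ ?w) ^ m"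
    unfolding many_flowers_def using assms finV finite_flowers flower_props
    by (intro rprob_many_disjoint_le) auto
  also have "\<dots> \<le> (real (card V) * (\<Theta> / real s) ^ s) ^ m"
  proof (intro power_mono)
    have "real (card (flowers s)) * p ^ ?w
        \<le> (real (card V) * (exp 1 * D * real (card V) / real s) ^ s) * p ^ (s * (k - 1))"
    proof (rule mult_mono)
      show "p ^ ?w \<le> p ^ (s * (k - 1))" using assms by (intro power_decreasing) auto
    qed (use card_flowers_le assms D1 in auto)
    also have "\<dots> = real (card V) * (\<Theta> / real s) ^ s"
      unfolding \<Theta>_def by (simp add: power_mult_distrib power_divide power_mult[symmetric] mult_ac)
    finally show "real (card (flowers s)) * p ^ ?w \<le> real (card V) * (\<Theta> / real s) ^ s" .
  qed (use assms in auto)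
  also have "real (card V) * (\<Theta> / real s) ^ s = exp (ln (real (card V)) + real s * ln (\<Theta> / real s))"
    using N \<Theta> assms by (simp add: exp_add exp_of_nat_mult)
  also have "ln (\<Theta> / real s) = - ln (real s / \<Theta>)" using \<Theta> assms by (simp add: ln_div)
  finally show ?thesis by (simp add: exp_of_nat_mult[symmetric] algebra_simps)
qed

text \<open>Delete the vertices of a maximal disjoint family of sunflowers: the degrees become small.\<close>

lemma small_cover:
  assumes "\<not> many_flowers s m A" "1 \<le> s"
  obtains U where "finite U" "card U \<le> (m - 1) * (s * k)"
    "\<And>v. real (card {f\<in>E. f \<subseteq> A \<and> f \<inter> U = {} \<and> v \<in> f}) \<le> real s * real k * D"
proof -
  let ?CC = "{C. C \<subseteq> flowers s \<and> pairwise disjnt C \<and> (\<forall>S\<in>C. S \<subseteq> A)}"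
  have fin: "finite ?CC" using finite_flowers[OF assms(2)] by simp
  have "?CC \<noteq> {}" by (auto intro!: exI[of _ "{}"])
  then have "Max (card ` ?CC) \<in> card ` ?CC" using fin by (intro Max_in) auto
  then obtain C where C: "C \<in> ?CC" "card C = Max (card ` ?CC)" by (metis (no_types, lifting) imageE)
  have C_max: "card C' \<le> card C" if "C' \<in> ?CC" for C'
    unfolding C(2) using fin that by (intro Max_ge) auto
  have finC: "finite C" by (rule finite_subset[OF _ finite_flowers[OF assms(2)]]) (use C(1) in simp)
  \<comment> \<open>Strict inequality gives the factor \<open>m - 1\<close> in the size of
    \<open>U\<close>; in particular \<open>m = 1\<close> yields \<open>U = {}\<close>, which is used
    at the coarsest scale.\<close>
  have "card C < m"
  proof (rule ccontr)
    assume "\<not> card C < m"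
    then obtain C' where "C' \<subseteq> C" "card C' = m" using obtain_subset_with_card_n[of m C] by auto
    then have "many_flowers s m A" unfolding many_flowers_def using C(1)
      by (intro exI[of _ C']) (auto intro: pairwise_subset)
    then show False using assms by simp
  qed
  let ?U = "\<Union>C"
  have cards: "card S \<le> s * k" "finite S" if "S \<in> C" for S
  proof -
    have S: "S \<in> flowers s" using C(1) that by blast
    have "1 + s * (k - 1) \<le> s * k" using assms(2) k3 by (cases k) auto
    then show "card S \<le> s * k" using flower_props(2)[OF S assms(2)] by simp
    show "finite S" by (rule finite_subset[OF flower_props(1)[OF S assms(2)] finV])
  qed
  have "card ?U \<le> (\<Sum>S\<in>C. card S)" using card_UN_le[OF finC, of "\<lambda>f. f"] by simp
  also have "\<dots> \<le> (\<Sum>S\<in>C. s * k)" by (intro sum_mono cards)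
  also have "\<dots> = card C * (s * k)" by simp
  also have "\<dots> \<le> (m - 1) * (s * k)"
    by (rule mult_le_mono1) (use \<open>card C < m\<close> in linarith)
  finally have "card ?U \<le> (m - 1) * (s * k)" .
  moreover have "finite ?U" by (rule finite_Union[OF finC]) (rule cards)
  moreover have "real (card {f\<in>E. f \<subseteq> A \<and> f \<inter> ?U = {} \<and> v \<in> f}) \<le> real s * real k * D" for v
  proof (rule ccontr)
    let ?G = "{f\<in>E. f \<subseteq> A \<and> f \<inter> ?U = {} \<and> v \<in> f}"
    assume "\<not> ?thesis"
    \<comment> \<open>So many surviving edges at \<open>v\<close> contain another flower; it avoids
      \<open>?U\<close> and is nonempty, so adding it to \<open>C\<close> contradicts
      maximality.\<close>
    then have "real s * real k * D \<le> real (card ?G)" by simp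
    then have "\<exists>Q\<subseteq>?G. card Q = s \<and> (\<forall>f\<in>Q. \<forall>g\<in>Q. f \<noteq> g \<longrightarrow> f \<inter> g = {v})"
      by (rule sunflower_exists[rotated 2]) auto
    then obtain Q where Q: "Q \<subseteq> ?G" "card Q = s" "\<forall>f\<in>Q. \<forall>g\<in>Q. f \<noteq> g \<longrightarrow> f \<inter> g = {v}"
      by (elim exE conjE)
    let ?B = "\<Union>Q"
    have "Q \<subseteq> E" "\<forall>f\<in>Q. v \<in> f" using Q(1) by auto
    then have B: "?B \<in> flowers s" unfolding flowers_def using Q(2,3) by blast
    have "?B \<inter> ?U = {}" "?B \<subseteq> A" using Q(1) by auto
    have "Q \<noteq> {}" using Q(2) assms(2) by auto
    then have "?B \<noteq> {}" using \<open>\<forall>f\<in>Q. v \<in> f\<close> by blast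
    then have "?B \<notin> C" using \<open>?B \<inter> ?U = {}\<close> by auto
    have "insert ?B C \<in> ?CC"
      using B C(1) \<open>?B \<inter> ?U = {}\<close> \<open>?B \<subseteq> A\<close>
      by (auto simp: pairwise_insert disjnt_def)
    from C_max[OF this] show False using \<open>?B \<notin> C\<close> finC by simp
  qed
  ultimately show ?thesis using that[of ?U] by blast
qed

text \<open>An edge that avoids \<open>U (Suc i)\<close> but meets \<open>U i\<close> is charged to
  a vertex of \<open>U i\<close>, whose degree among the edges avoiding \<open>U (Suc i)\<close> is
  at most \<open>b (Suc i)\<close>. So each deleted set is weighed with the degree bound of the next
  scale.\<close>

lemma level_decomposition:
  assumes fin: "\<And>j. j \<le> J \<Longrightarrow> finite (U j)"
    and deg: "\<And>j v. j \<le> J \<Longrightarrow> real (card {f\<in>E. f \<subseteq> A \<and> f \<inter> U j = {} \<and> v \<in> f}) \<le> b j"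
  shows "i \<le> J \<Longrightarrow> real (card {f\<in>E. f \<subseteq> A \<and> f \<inter> U i = {}})
    \<le> real (card {f\<in>E. f \<subseteq> A \<and> f \<inter> U 0 = {}}) + (\<Sum>j<i. real (card (U j)) * b (Suc j))"
proof (induction i)
  case (Suc i)
  let ?G = "\<lambda>u. {f\<in>E. f \<subseteq> A \<and> f \<inter> U (Suc i) = {} \<and> u \<in> f}"
  have "card {f\<in>E. f \<subseteq> A \<and> f \<inter> U (Suc i) = {}}
      \<le> card ({f\<in>E. f \<subseteq> A \<and> f \<inter> U i = {}} \<union> (\<Union>u\<in>U i. ?G u))"
    using finE fin[of i] Suc.prems by (intro card_mono) auto
  also have "\<dots> \<le> card {f\<in>E. f \<subseteq> A \<and> f \<inter> U i = {}} + card (\<Union>u\<in>U i. ?G u)"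
    by (rule card_Un_le)
  finally have 1: "real (card {f\<in>E. f \<subseteq> A \<and> f \<inter> U (Suc i) = {}})
      \<le> real (card {f\<in>E. f \<subseteq> A \<and> f \<inter> U i = {}}) + real (card (\<Union>u\<in>U i. ?G u))"
    by simp
  have "card (\<Union>u\<in>U i. ?G u) \<le> (\<Sum>u\<in>U i. card (?G u))"
    using fin[of i] Suc.prems card_UN_le[of "U i"] by simp
  then have "real (card (\<Union>u\<in>U i. ?G u)) \<le> (\<Sum>u\<in>U i. real (card (?G u)))"
    by (rule of_nat_le_sum)
  with 1 have "real (card {f\<in>E. f \<subseteq> A \<and> f \<inter> U (Suc i) = {}})
      \<le> real (card {f\<in>E. f \<subseteq> A \<and> f \<inter> U i = {}}) + (\<Sum>u\<in>U i. real (card (?G u)))"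
    by linarith
  also have "(\<Sum>u\<in>U i. real (card (?G u))) \<le> (\<Sum>u\<in>U i. b (Suc i))"
    using Suc.prems by (intro sum_mono deg) auto
  finally show ?case using Suc by simp
qed simp

end

section \<open>Sums over dyadic scales\<close>

lemma sum_powers_le:
  fixes x :: real
  assumes "0 \<le> x" "x \<le> 1/2"
  shows "(\<Sum>j<J. x ^ Suc j) \<le> 2 * x"
proof -
  have "(\<Sum>j<J. x ^ Suc j) + 2 * x ^ Suc J \<le> 2 * x"
  proof (induction J)
    case (Suc J)
    have "2 * x * x ^ Suc J \<le> 1 * x ^ Suc J" using assms by (intro mult_right_mono) auto
    then show ?case using Suc by simp
  qed simp
  moreover have "0 \<le> 2 * x ^ Suc J" using assms by simp
  ultimately show ?thesis by linarith
qed

text \<open>The summands grow by a factor of at least 4/3.\<close>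

lemma sum_dyadic_le:
  fixes s L :: real
  assumes "0 < s" "2 \<le> L"
  shows "(\<Sum>j<Suc J. 2 ^ j * s / (L + real j * ln 2)) \<le> 4 * (2 ^ J * s / (L + real J * ln 2))"
proof (induction J)
  case 0
  have "0 \<le> s / L" using assms by simp
  then show ?case by simp
next
  case (Suc J)
  define x where "x = L + real J * ln 2"
  have x: "2 \<le> x" using assms unfolding x_def by (simp add: add_increasing2)
  have y: "L + real (Suc J) * ln 2 = x + ln 2" unfolding x_def by (simp add: algebra_simps)
  \<comment> \<open>For x \<ge> 2 the quotient 2 x / (x + ln 2) of consecutive summands is at least
    4/3, so the whole sum is at most 1 / (1 - 3/4) = 4 times its last term.\<close>
  have "c \<le> 1 \<Longrightarrow> 2 * (x + c) \<le> 3 * x" for c :: real using x by simp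
  then have "2 * (x + ln 2) \<le> 3 * x" using ln_2_less_1 by simp
  then have "4 * (2 ^ J * s / x) \<le> 3 * (2 ^ Suc J * s / (x + ln 2))"
    using x assms(1) add_pos_pos[of x "ln 2"] by (simp add: field_simps)
  then show ?case using Suc unfolding sum.lessThan_Suc[of _ "Suc J"] y x_def[symmetric] by linarith
qed

section \<open>The union bound over all degree scales\<close>

context codegree_hypergraph
begin

text \<open>Either \<open>L\<close> is comparable to \<open>ln (e / p)\<close>, or \<open>s\<close> is so close to \<open>\<Theta>\<close> that the lower bound
  on \<open>t\<close> wins.\<close>

lemma last_scale:
  fixes M t p \<Theta> s L a' :: real
  assumes "0 < p" "p \<le> 1" "0 < t" "0 < \<Theta>" "\<Theta> \<le> M" "0 < a'"
    and Mt: "M \<le> sqrt t * ln (exp 1 / p)" "a' * M * \<Theta> ^ 3 \<le> t\<^sup>2 * p ^ (k - 2)"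
    and s: "0 < s" "L = ln (s / \<Theta>)" "1 \<le> L" "s * L < M"
  shows "s * M / L \<le> max 64 (8 * (exp 1 / a') powr (1/4)) * t"
proof -
  define l where "l = ln (exp 1 / p)"
  have l: "l = 1 + ln (1/p)" using assms by (simp add: l_def ln_div)
  have l1: "1 \<le> l" using assms l by simp
  have M: "M \<le> sqrt t * l" "0 < M" using Mt assms by (auto simp: l_def)
  show ?thesis
  proof (cases "l / 8 \<le> L")
    \<comment> \<open>Here \<open>s \<le> M / L\<close>, so the loss is at most the square of
      \<open>M / L\<close>, and \<open>M \<le> sqrt t * l\<close> makes \<open>M / L\<close> at most
      \<open>8 * sqrt t\<close>.\<close>
    case True
    have "s \<le> M / L" using s by (simp add: field_simps)
    then have "s * M / L \<le> (M / L) * M / L" using M s by (intro divide_right_mono mult_right_mono) auto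
    also have "\<dots> = (M / L)\<^sup>2" by (simp add: power2_eq_square)
    also have "\<dots> \<le> (8 * sqrt t)\<^sup>2"
    proof (rule power_mono)
      have "sqrt t * l \<le> sqrt t * (8 * L)" using True assms by (intro mult_left_mono) auto
      then have "M \<le> 8 * sqrt t * L" using M by simp
      then show "M / L \<le> 8 * sqrt t" using s by (simp add: field_simps)
    qed (use M s in auto)
    also have "\<dots> = 64 * t" using assms by (simp add: power_mult_distrib)
    also have "\<dots> \<le> max 64 (8 * (exp 1 / a') powr (1/4)) * t" using assms by (intro mult_right_mono) auto
    finally show ?thesis .
  next
    \<comment> \<open>Now \<open>s < \<Theta> * exp (l / 8)\<close>. The remaining factor
      \<open>l\<close> is absorbed by another \<open>exp (l / 8)\<close>, so the excess over
      \<open>\<Theta> * sqrt t\<close> is of order (e/p)^(1/4). The value 1/8 is chosen so that this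
      cancels against the power 1/4 of \<open>p\<close> in the bound for \<open>\<Theta>\<close>
      below.\<close>
    case False
    have "s / \<Theta> = exp L" using s assms by simp
    then have s_eq: "s = \<Theta> * exp L" using assms by (simp add: field_simps)
    have "exp L \<le> exp (l / 8)" using False by simp
    then have "s \<le> \<Theta> * exp (l / 8)" unfolding s_eq using assms(4) by (intro mult_left_mono) auto
    then have "s * M \<le> \<Theta> * exp (l / 8) * (sqrt t * l)"
      using M s assms by (intro mult_mono) auto
    moreover have "s * M / L \<le> s * M"
      using s M by (simp add: divide_le_eq)
    moreover have "l \<le> 8 * exp (l / 8)" using exp_ge_add_one_self[of "l / 8"] by linarith
    then have "\<Theta> * exp (l / 8) * (sqrt t * l) \<le> \<Theta> * exp (l / 8) * (sqrt t * (8 * exp (l / 8)))"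
      using assms by (intro mult_left_mono) auto
    ultimately have 1: "s * M / L \<le> 8 * \<Theta> * sqrt t * (exp (l / 8))\<^sup>2"
      by (simp add: power2_eq_square mult_ac)
    have e2: "(exp (l / 8))\<^sup>2 = (exp 1 / p) powr (1/4)"
    proof -
      have "(exp (l / 8))\<^sup>2 = exp (l / 4)" by (simp add: power2_eq_square exp_add[symmetric])
      also have "\<dots> = (exp 1 / p) powr (1/4)" using assms by (simp add: powr_def l_def)
      finally show ?thesis .
    qed
    \<comment> \<open>\<open>\<Theta> \<le> M\<close> raises the cube to a fourth power, and
      \<open>k \<ge> 3\<close> leaves at least one factor \<open>p\<close>.\<close>
    have "a' * \<Theta> ^ 4 = a' * \<Theta> * \<Theta> ^ 3" by (simp add: power3_eq_cube power4_eq_xxxx)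
    also have "\<dots> \<le> a' * M * \<Theta> ^ 3" using assms by (intro mult_right_mono mult_left_mono) auto
    also have "\<dots> \<le> t\<^sup>2 * p ^ (k - 2)" by (rule Mt(2))
    also have "\<dots> \<le> t\<^sup>2 * p ^ 1" using assms k3 by (intro mult_left_mono power_decreasing) auto
    finally have "\<Theta> ^ 4 \<le> t\<^sup>2 * (p / a')" using assms by (simp add: field_simps)
    then have "\<Theta> \<le> (t\<^sup>2 * (p / a')) powr (1/4)"
    proof -
      assume *: "\<Theta> ^ 4 \<le> t\<^sup>2 * (p / a')"
      have "\<Theta> = (\<Theta> powr 4) powr (1/4)" using assms(4) by (simp only: powr_powr) simp
      also have "\<dots> = (\<Theta> ^ 4) powr (1/4)" using assms(4) by simp
      also have "\<dots> \<le> (t\<^sup>2 * (p / a')) powr (1/4)" using * assms by (intro powr_mono2) auto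
      finally show ?thesis .
    qed
    also have "\<dots> = (t\<^sup>2) powr (1/4) * (p / a') powr (1/4)"
      by (rule powr_mult)
    also have "(t\<^sup>2) powr (1/4) = (t powr 2) powr (1/4)" using assms(3) by simp
    also have "\<dots> = t powr (1/2)" by (simp only: powr_powr) simp
    also have "\<dots> = sqrt t" using assms(3) by (simp add: powr_half_sqrt)
    finally have "8 * \<Theta> * sqrt t * (exp (l / 8))\<^sup>2
        \<le> 8 * (sqrt t * (p / a') powr (1/4)) * sqrt t * (exp 1 / p) powr (1/4)"
      unfolding e2 using assms by (intro mult_mono) auto
    also have "\<dots> = 8 * (sqrt t * sqrt t) * ((p / a') powr (1/4) * (exp 1 / p) powr (1/4))"
      by (simp add: mult_ac)
    also have "(p / a') powr (1/4) * (exp 1 / p) powr (1/4) = (exp 1 / a') powr (1/4)"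
      using assms by (simp add: powr_mult[symmetric])
    also have "8 * (sqrt t * sqrt t) * (exp 1 / a') powr (1/4) = 8 * (exp 1 / a') powr (1/4) * t"
      using assms by simp
    also have "\<dots> \<le> max 64 (8 * (exp 1 / a') powr (1/4)) * t" using assms by (intro mult_right_mono) auto
    finally show ?thesis using 1 by linarith
  qed
qed

text \<open>The first summand is the bounded-degree count after the deletion at scale 0; the second
  is the union bound over the scales, whose factor \<open>1 / n\<close> comes from a geometric
  series in \<open>1 / (2 * n)\<close>. The conditions on \<open>s0\<close> keep the logarithms
  above 2, pay for this series and pay for the centres. The conditions on \<open>M\<close> are those
  of \<open>last_scale\<close>.\<close>

lemma upper_core:
  fixes p t M a' c1 :: real and s0 n :: nat
  assumes p: "0 < p" "p \<le> 1" and t: "0 < t" and E: "E \<noteq> {}" and n: "1 \<le> n" and a': "0 < a'"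
  defines "\<mu> \<equiv> real (card E) * p ^ k"
    and "\<Theta> \<equiv> exp 1 * D * real (card V) * p ^ (k - 1)"
    and "\<kappa> \<equiv> max 64 (8 * (exp 1 / a') powr (1/4))"
  assumes c1: "c1 = 1 / (16 * (real k)\<^sup>2 * D * \<kappa>)"
  assumes s0: "1 \<le> s0" "2 \<le> ln (real s0 / \<Theta>)"
    "4 * ln (2 * real n) \<le> real s0 * ln (real s0 / \<Theta>)"
    "2 * ln (real (card V)) \<le> real s0 * ln (real s0 / \<Theta>)"
  assumes M: "0 < M" "M \<le> sqrt t * ln (exp 1 / p)" "a' * M * \<Theta> ^ 3 \<le> t\<^sup>2 * p ^ (k - 2)"
  shows "rprob V p (\<lambda>A. \<mu> + t \<le> real (card {f\<in>E. f \<subseteq> A}))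
    \<le> exp (- (t / (4 * ((real k)\<^sup>2 * D * real s0))) * ln (1 + t / (4 * \<mu>)))
      + exp (- (c1 / 4 * M)) / real n"
proof -
  define L0 where "L0 = ln (real s0 / \<Theta>)"
  define s where "s j = 2 ^ j * s0" for j
  define L where "L j = L0 + real j * ln 2" for j
  have Vne: "V \<noteq> {}" using E edge k3 by fastforce
  then have N: "1 \<le> card V" using finV by (simp add: Suc_le_eq card_gt_0_iff)
  have \<Theta>: "0 < \<Theta>" using p D1 N unfolding \<Theta>_def by simp
  have \<kappa>: "64 \<le> \<kappa>" unfolding \<kappa>_def by simp
  have c1_pos: "0 < c1" using c1 \<kappa> D1 k3 by simp
  have c1_le: "c1 \<le> 1"
  proof -
    have "1 * 1 \<le> (16 * (real k)\<^sup>2 * D) * \<kappa>"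
    proof (rule mult_mono)
      have "1 \<le> (real k)\<^sup>2" using k3 by (intro one_le_power) auto
      then have "1 * 1 \<le> (16 * (real k)\<^sup>2) * D"
        using D1 by (intro mult_mono) auto
      then show "1 \<le> 16 * (real k)\<^sup>2 * D" by simp
    qed (use \<kappa> D1 in auto)
    then have "1 \<le> 16 * (real k)\<^sup>2 * D * \<kappa>" by simp
    then show ?thesis unfolding c1 by (subst divide_le_eq_1_pos) linarith+
  qed
  have s1: "1 \<le> s j" for j using s0(1) unfolding s_def by (simp add: Suc_le_eq)
  have L_eq: "L j = ln (real (s j) / \<Theta>)" for j
  proof -
    have "ln (real (s j) / \<Theta>) = ln (2 ^ j * (real s0 / \<Theta>))" unfolding s_def by simp
    also have "\<dots> = ln (2 ^ j) + ln (real s0 / \<Theta>)" using s0 \<Theta> by (intro ln_mult_pos) auto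
    finally show ?thesis by (simp add: L_def L0_def ln_realpow)
  qed
  have L2: "2 \<le> L j" for j
    using s0(2) unfolding L_def L0_def by (simp add: add_increasing2)
  \<comment> \<open>The growth of \<open>2 ^ j\<close> turns the reserve at \<open>s0\<close> into
    \<open>j + 1\<close> copies of it, one for each power of \<open>x\<close> needed at scale
    \<open>j\<close>.\<close>
  have sL: "real (j + 1) * (real s0 * L0) \<le> real (s j) * L j" for j
  proof -
    have "real (j + 1) \<le> 2 ^ j" by (induction j) auto
    then have "real (j + 1) * real s0 \<le> real (s j)" unfolding s_def by (simp add: mult_right_mono)
    moreover have "L0 \<le> L j" unfolding L_def by simp
    moreover have "0 \<le> L0" using s0(2) unfolding L0_def by simp
    ultimately have "(real (j + 1) * real s0) * L0 \<le> real (s j) * L j"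
      by (intro mult_mono) auto
    then show ?thesis by (simp add: mult_ac)
  qed
  have sL0: "0 \<le> real s0 * L0" using s0(2) unfolding L0_def by simp
  have sLN: "2 * ln (real (card V)) \<le> real (s j) * L j" for j
  proof -
    have "1 * (real s0 * L0) \<le> real (j + 1) * (real s0 * L0)" using sL0 by (intro mult_right_mono) auto
    then show ?thesis using sL[of j] s0(4) unfolding L0_def by linarith
  qed
  have ex: "\<exists>j. M \<le> real (s j) * L j"
  proof -
    obtain j :: nat where "M < real j" using reals_Archimedean2 by blast
    also have "real j \<le> 2 ^ j" by (simp add: less_imp_le)
    also have "\<dots> \<le> real (s j)" using s0(1) unfolding s_def by simp
    also have "\<dots> \<le> real (s j) * L j" using L2[of j] by (simp add: mult_le_cancel_left1)
    finally show ?thesis using less_imp_le by blast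
  qed
  \<comment> \<open>At the first scale with \<open>s J * L J \<ge> M\<close> a single flower is
    already improbable enough, so no coarser scale is needed.\<close>
  define J where "J = (LEAST j. M \<le> real (s j) * L j)"
  have J: "M \<le> real (s J) * L J" unfolding J_def using ex by (rule LeastI_ex)
  have J_min: "real (s j) * L j < M" if "j < J" for j
    using not_less_Least[of j "\<lambda>j. M \<le> real (s j) * L j"] that unfolding J_def by simp
  \<comment> \<open>\<open>u j\<close> times \<open>k\<close> will bound the number of vertices
    deleted at scale \<open>j\<close>, while \<open>m j\<close> flowers of size \<open>s j\<close>
    cost at least \<open>c1 * M\<close> in the exponent.\<close>
  define u where "u j = c1 * M / L j" for j
  have u0: "0 \<le> u j" for j using c1_pos M L2[of j] unfolding u_def by simp
  \<comment> \<open>The probability sees the rounded-up \<open>m j\<close>, the deleted set only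
    \<open>m j - 1\<close>. At \<open>J\<close> the value 1 makes \<open>U J\<close> empty.\<close>
  define m where "m j = (if j < J then nat \<lfloor>u j / real (s j)\<rfloor> + 1 else 1)" for j
  have m_le: "real (m j - 1) * real (s j) \<le> u j" if "j < J" for j
  proof -
    have "real (m j - 1) \<le> u j / real (s j)" using that u0[of j] unfolding m_def by simp
    then show ?thesis using s1[of j] by (simp add: field_simps)
  qed
  have m_ge: "c1 * M \<le> real (m j) * (real (s j) * L j)" if "j \<le> J" for j
  proof (cases "j < J")
    case True
    have "u j / real (s j) \<le> real (m j)" using True u0[of j] unfolding m_def by simp linarith
    then have "u j \<le> real (m j) * real (s j)" using s1[of j] by (simp add: field_simps)
    then have "u j * L j \<le> real (m j) * real (s j) * L j"
      using L2[of j] by (intro mult_right_mono) auto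
    moreover have "u j * L j = c1 * M" using L2[of j] unfolding u_def by simp
    ultimately show ?thesis by (simp add: mult_ac)
  next
    case False
    then have "m j = 1" "j = J" using that unfolding m_def by auto
    moreover have "c1 * M \<le> 1 * M" using c1_le M by (intro mult_right_mono) auto
    ultimately show ?thesis using J by simp
  qed
  have m1: "1 \<le> m j" for j unfolding m_def by simp
  define x where "x = 1 / (2 * real n)"
  have level: "rprob V p (many_flowers (s j) (m j)) \<le> x ^ Suc j * exp (- (c1 / 4 * M))" if "j \<le> J" for j
  proof -
    let ?y = "real (s j) * L j"
    have y0: "0 \<le> ?y" using L2[of j] by simp
    have "rprob V p (many_flowers (s j) (m j)) \<le> exp (- (real (m j) * (?y - ln (real (card V)))))"
      using rprob_many_flowers_le[OF p s1 Vne, of j "m j"] unfolding L_eq \<Theta>_def .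
    also have "\<dots> \<le> exp (- (real (j + 1) * ln (2 * real n)) - c1 / 4 * M)"
    proof -
      \<comment> \<open>Half of \<open>?y\<close> pays for the centres. Of the rest, one half is
        compared with \<open>s0 * L0\<close> and gives the geometric factor, the other half gives
        \<open>c1 / 4 * M\<close>.\<close>
      have "?y / 2 \<le> ?y - ln (real (card V))" using sLN[of j] by linarith
      then have 1: "real (m j) * (?y / 2) \<le> real (m j) * (?y - ln (real (card V)))"
        by (intro mult_left_mono) auto
      have 2: "1 * ?y \<le> real (m j) * ?y" using m1[of j] y0 by (intro mult_right_mono) auto
      have 3: "real (j + 1) * (4 * ln (2 * real n)) \<le> real (j + 1) * (real s0 * L0)"
        using s0(3) unfolding L0_def by (intro mult_left_mono) auto
      have 4: "real (m j) * (?y / 2) = (real (m j) * ?y) / 2"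
        "real (j + 1) * (4 * ln (2 * real n)) = 4 * (real (j + 1) * ln (2 * real n))"
        "c1 / 4 * M = c1 * M / 4" by simp_all
      show ?thesis unfolding exp_le_cancel_iff using 1 2 3 m_ge[OF that] sL[of j]
        unfolding 4 by linarith
    qed
    also have "\<dots> = exp (- ln (2 * real n)) ^ (j + 1) * exp (- (c1 / 4 * M))"
      by (simp add: exp_of_nat_mult[symmetric] exp_add[symmetric] algebra_simps)
    also have "exp (- ln (2 * real n)) = x" using n by (simp add: x_def exp_minus inverse_eq_divide)
    finally show ?thesis by simp
  qed
  let ?X = "\<lambda>A. real (card {f\<in>E. f \<subseteq> A})"
  let ?r = "(real k)\<^sup>2 * D * real s0"
  let ?P = "\<lambda>A. \<exists>G\<subseteq>E. (\<forall>S\<in>G. S \<subseteq> A \<and> real (card {S'\<in>G. S' \<inter> S \<noteq> {}}) \<le> ?r)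
            \<and> \<mu> + t / 2 \<le> real (card G)"
  let ?Q = "\<lambda>A. \<exists>j\<in>{..<Suc J}. many_flowers (s j) (m j) A"
  have "?P A \<or> ?Q A" if X: "\<mu> + t \<le> ?X A" for A
  proof (rule disjCI)
    assume "\<not> ?Q A"
    then have no: "\<not> many_flowers (s j) (m j) A" if "j \<le> J" for j using that by auto
    let ?U = "\<lambda>j U. finite U \<and> card U \<le> (m j - 1) * (s j * k) \<and>
        (\<forall>v. real (card {f\<in>E. f \<subseteq> A \<and> f \<inter> U = {} \<and> v \<in> f}) \<le> real (s j) * real k * D)"
    have "\<exists>U. ?U j U" if "j \<le> J" for j
      by (rule small_cover[OF no[OF that] s1]) blast
    then have "\<exists>U. \<forall>j\<in>{..J}. ?U j (U j)" by (intro bchoice) auto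
    then obtain U where "\<forall>j\<in>{..J}. ?U j (U j)" by (elim exE)
    then have U: "\<And>j. j \<le> J \<Longrightarrow> finite (U j)"
        "\<And>j. j \<le> J \<Longrightarrow> card (U j) \<le> (m j - 1) * (s j * k)"
        "\<And>j v. j \<le> J \<Longrightarrow> real (card {f\<in>E. f \<subseteq> A \<and> f \<inter> U j = {} \<and> v \<in> f}) \<le> real (s j) * real k * D"
      by simp_all
    have "m J = 1" unfolding m_def by simp
    then have "U J = {}" using U(1,2)[of J] by simp
    let ?G = "{f\<in>E. f \<subseteq> A \<and> f \<inter> U 0 = {}}"
    have "?X A \<le> real (card ?G) + (\<Sum>j<J. real (card (U j)) * (real (s (Suc j)) * real k * D))"
      using level_decomposition[of J U A "\<lambda>j. real (s j) * real k * D" J] U \<open>U J = {}\<close> by simp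
    also have "(\<Sum>j<J. real (card (U j)) * (real (s (Suc j)) * real k * D))
        \<le> (\<Sum>j<J. 2 * (real k)\<^sup>2 * D * (c1 * M) * (2 ^ j * real s0 / (L0 + real j * ln 2)))"
    proof (rule sum_mono)
      fix j assume "j \<in> {..<J}"
      then have j: "j < J" by simp
      have "real (card (U j)) \<le> real ((m j - 1) * (s j * k))" using U(2)[of j] j by (intro of_nat_mono) auto
      also have "\<dots> = real (m j - 1) * real (s j) * real k" by simp
      also have "\<dots> \<le> u j * real k" using m_le[OF j] by (intro mult_right_mono) auto
      finally have "real (card (U j)) * (real (s (Suc j)) * real k * D) \<le> u j * real k * (real (s (Suc j)) * real k * D)"
        using D1 by (intro mult_right_mono) auto
      also have "\<dots> = 2 * (real k)\<^sup>2 * D * (c1 * M) * (2 ^ j * real s0 / (L0 + real j * ln 2))"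
        unfolding u_def s_def L_def by (simp add: power2_eq_square mult_ac)
      finally show "real (card (U j)) * (real (s (Suc j)) * real k * D)
        \<le> 2 * (real k)\<^sup>2 * D * (c1 * M) * (2 ^ j * real s0 / (L0 + real j * ln 2))" .
    qed
    also have "\<dots> = 2 * (real k)\<^sup>2 * D * (c1 * M) * (\<Sum>j<J. 2 ^ j * real s0 / (L0 + real j * ln 2))"
      by (rule sum_distrib_left[symmetric])
    also have "\<dots> \<le> t / 2"
    proof (cases J)
      case 0
      then show ?thesis using t by simp
    next
      case (Suc I)
      \<comment> \<open>The last scale \<open>I\<close> below \<open>J\<close> carries the sum, and
        there \<open>s I * L I < M\<close> by minimality of \<open>J\<close>.\<close>
      have "(\<Sum>j<J. 2 ^ j * real s0 / (L0 + real j * ln 2)) \<le> 4 * (2 ^ I * real s0 / (L0 + real I * ln 2))"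
        unfolding Suc using s0 L0_def by (intro sum_dyadic_le) auto
      also have "2 ^ I * real s0 / (L0 + real I * ln 2) = real (s I) / L I" unfolding s_def L_def by simp
      finally have "2 * (real k)\<^sup>2 * D * (c1 * M) * (\<Sum>j<J. 2 ^ j * real s0 / (L0 + real j * ln 2))
          \<le> 2 * (real k)\<^sup>2 * D * (c1 * M) * (4 * (real (s I) / L I))"
        using D1 c1_pos M by (intro mult_left_mono) auto
      also have "\<dots> = 8 * (real k)\<^sup>2 * D * c1 * (real (s I) * M / L I)" by simp
      also have "\<dots> \<le> 8 * (real k)\<^sup>2 * D * c1 * (\<kappa> * t)"
      proof (rule mult_left_mono)
        have I: "real (s I) * L I < M" using J_min[of I] Suc by simp
        have "\<Theta> \<le> real s0"
        proof -
          have "1 \<le> exp (ln (real s0 / \<Theta>))" using s0(2) by simp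
          then have "1 \<le> real s0 / \<Theta>" using s0(1) \<Theta> by (simp add: divide_pos_pos)
          then show ?thesis using \<Theta> by simp
        qed
        also have "real s0 \<le> real (s I)" unfolding s_def by (intro of_nat_mono) simp
        also have "\<dots> \<le> real (s I) * L I" using L2[of I] by (simp add: mult_le_cancel_left1)
        finally have "\<Theta> \<le> M" using I by simp
        have "1 \<le> L I" using L2[of I] by simp
        moreover have "0 < real (s I)" using s1[of I] by simp
        ultimately show "real (s I) * M / L I \<le> \<kappa> * t"
          unfolding \<kappa>_def using p t \<Theta> \<open>\<Theta> \<le> M\<close> a' M(2,3) I L_eq[of I]
          by (intro last_scale)
      qed (use D1 c1_pos in auto)
      \<comment> \<open>\<open>c1\<close> was defined to make 8 k^2 D c1 \<kappa> equal to
        1/2.\<close>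
      also have "\<dots> = t / 2" unfolding c1 using D1 k3 \<kappa> by (simp add: field_simps)
      finally show ?thesis .
    qed
    finally have G: "\<mu> + t / 2 \<le> real (card ?G)" using X by simp
    \<comment> \<open>An edge has \<open>k\<close> vertices, each of degree at most
      \<open>s0 * k * D\<close> after the deletion at scale 0; this is the bound
      \<open>?r\<close>.\<close>
    have "real (card {S'\<in>?G. S' \<inter> S \<noteq> {}}) \<le> ?r" if "S \<in> ?G" for S
    proof -
      have S: "S \<in> E" using that by simp
      have "card {S'\<in>?G. S' \<inter> S \<noteq> {}} \<le> card (\<Union>v\<in>S. {f\<in>E. f \<subseteq> A \<and> f \<inter> U 0 = {} \<and> v \<in> f})"
        by (rule card_mono[rotated]) (use finE fin_edge[OF S] in auto)
      also have "\<dots> \<le> (\<Sum>v\<in>S. card {f\<in>E. f \<subseteq> A \<and> f \<inter> U 0 = {} \<and> v \<in> f})"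
        by (rule card_UN_le[OF fin_edge[OF S]])
      finally have "real (card {S'\<in>?G. S' \<inter> S \<noteq> {}})
          \<le> (\<Sum>v\<in>S. real (card {f\<in>E. f \<subseteq> A \<and> f \<inter> U 0 = {} \<and> v \<in> f}))"
        by (rule of_nat_le_sum)
      also have "\<dots> \<le> (\<Sum>v\<in>S. real (s 0) * real k * D)" by (intro sum_mono U(3)) simp
      also have "\<dots> = ?r" using edge[OF S] by (simp add: s_def power2_eq_square)
      finally show ?thesis .
    qed
    then show "?P A" using G by (intro exI[of _ ?G]) auto
  qed
  then have "rprob V p (\<lambda>A. \<mu> + t \<le> ?X A) \<le> rprob V p (\<lambda>A. ?P A \<or> ?Q A)"
    using p by (intro rprob_mono) auto
  also have "\<dots> \<le> rprob V p ?P + rprob V p ?Q" using p by (intro rprob_union) auto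
  also have "rprob V p ?P \<le> exp (- (t / 2 / (2 * ?r)) * ln (1 + t / 2 / (2 * \<mu>)))"
  proof (rule rprob_bounded_overlap_le[OF finV finE edge])
    have "0 < real (card E)" using E finE by (simp add: card_gt_0_iff)
    then show "0 < \<mu>" using p unfolding \<mu>_def by simp
    show "0 < ?r" using k3 D1 s0(1) by simp
  qed (use p t \<mu>_def in auto)
  also have "rprob V p ?Q \<le> exp (- (c1 / 4 * M)) / real n"
  proof -
    have "rprob V p ?Q \<le> (\<Sum>j<Suc J. rprob V p (many_flowers (s j) (m j)))"
      using p by (intro rprob_UN) auto
    also have "\<dots> \<le> (\<Sum>j<Suc J. x ^ Suc j * exp (- (c1 / 4 * M)))"
      by (intro sum_mono level) auto
    also have "\<dots> = (\<Sum>j<Suc J. x ^ Suc j) * exp (- (c1 / 4 * M))"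
      by (rule sum_distrib_right[symmetric])
    also have "\<dots> \<le> 2 * x * exp (- (c1 / 4 * M))"
    proof (rule mult_right_mono[OF sum_powers_le])
      show "x \<le> 1 / 2" using n by (simp add: x_def field_simps)
    qed (auto simp: x_def)
    also have "\<dots> = exp (- (c1 / 4 * M)) / real n" by (simp add: x_def)
    finally show ?thesis .
  qed
  finally show ?thesis by simp
qed

end

section \<open>Moments of the edge count\<close>

context codegree_hypergraph
begin

definition Xc :: "'a set \<Rightarrow> real" where "Xc A = real (card {f\<in>E. f \<subseteq> A})"
definition mu :: "real \<Rightarrow> real" where "mu p = real (card E) * p ^ k"
definition va :: "real \<Rightarrow> real" where "va p = rexp V p (\<lambda>A. (Xc A - mu p)\<^sup>2)"

lemma Xc_sum: "Xc A = (\<Sum>f\<in>E. of_bool (f \<subseteq> A))"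
  using finE by (simp add: Xc_def Int_def)

lemma Xc_nonneg: "0 \<le> Xc A" by (simp add: Xc_def)

lemma Xc_mono: "A \<subseteq> B \<Longrightarrow> Xc A \<le> Xc B"
  unfolding Xc_def using finE by (intro of_nat_mono card_mono) auto

lemma mu_nonneg: "0 \<le> p \<Longrightarrow> 0 \<le> mu p" by (simp add: mu_def)

lemma rexp_Xc: "rexp V p Xc = mu p"
proof -
  have "rexp V p Xc = rexp V p (\<lambda>A. \<Sum>f\<in>E. of_bool (f \<subseteq> A))"
    by (intro rexp_cong Xc_sum)
  also have "\<dots> = (\<Sum>f\<in>E. p ^ card f)"
    unfolding rexp_sum using edge finV by (intro sum.cong refl rexp_subset) auto
  also have "\<dots> = mu p" using edge by (simp add: mu_def)
  finally show ?thesis .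
qed

text \<open>The square of \<open>Xc\<close> counts ordered pairs of edges in \<open>A\<close>, and a
  pair \<open>f\<close>, \<open>g\<close> survives with probability
  \<open>p ^ card (f \<union> g)\<close>. Disjoint pairs contribute zero.\<close>

lemma va_sum: "va p = (\<Sum>f\<in>E. \<Sum>g\<in>E. p ^ card (f \<union> g) - p ^ (2 * k))"
proof -
  have "va p = rexp V p (\<lambda>A. (\<Sum>f\<in>E. \<Sum>g\<in>E. of_bool (f \<union> g \<subseteq> A)) - 2 * mu p * Xc A + (mu p)\<^sup>2)"
    unfolding va_def
  proof (rule rexp_cong)
    fix A
    have "(Xc A)\<^sup>2 = (\<Sum>f\<in>E. \<Sum>g\<in>E. of_bool (f \<union> g \<subseteq> A))"
      unfolding Xc_sum power2_eq_square sum_product by (intro sum.cong refl) auto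
    then show "(Xc A - mu p)\<^sup>2 = (\<Sum>f\<in>E. \<Sum>g\<in>E. of_bool (f \<union> g \<subseteq> A)) - 2 * mu p * Xc A + (mu p)\<^sup>2"
      by (simp add: power2_eq_square algebra_simps)
  qed
  also have "\<dots> = (\<Sum>f\<in>E. \<Sum>g\<in>E. p ^ card (f \<union> g)) - (mu p)\<^sup>2"
  proof -
    have "rexp V p (\<lambda>A. \<Sum>f\<in>E. \<Sum>g\<in>E. of_bool (f \<union> g \<subseteq> A)) = (\<Sum>f\<in>E. \<Sum>g\<in>E. p ^ card (f \<union> g))"
      unfolding rexp_sum using edge finV by (intro sum.cong refl rexp_subset) auto
    then show ?thesis using finV
      by (simp add: rexp_add rexp_diff rexp_cmult rexp_const rexp_Xc power2_eq_square)
  qed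
  also have "(mu p)\<^sup>2 = (\<Sum>f\<in>E. \<Sum>g\<in>E. p ^ (2 * k))"
    by (simp add: mu_def power2_eq_square mult_2 power_add)
  finally show ?thesis by (simp add: sum_subtractf)
qed

lemma card_union_edges: "f \<in> E \<Longrightarrow> g \<in> E \<Longrightarrow> card (f \<union> g) + card (f \<inter> g) = 2 * k"
  using card_Un_Int[of f g] fin_edge edge by simp

text \<open>With i = card (f \<inter> g) \<ge> 1 the term is p^(2k-i) (1 - p^i), and both factors
  are smallest at i = 1.\<close>

lemma va_term_ge:
  fixes p :: real
  assumes "0 \<le> p" "p \<le> 1" "f \<in> E" "g \<in> E" "f \<inter> g \<noteq> {}"
  shows "(1 - p) * p ^ (2 * k - 1) \<le> p ^ card (f \<union> g) - p ^ (2 * k)"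
proof -
  let ?i = "card (f \<inter> g)"
  have i: "1 \<le> ?i" using assms(5) fin_edge[OF assms(3)] by (simp add: Suc_le_eq card_gt_0_iff)
  have u: "card (f \<union> g) + ?i = 2 * k" by (rule card_union_edges[OF assms(3,4)])
  have "(1 - p) * p ^ (2 * k - 1) \<le> (1 - p ^ ?i) * p ^ card (f \<union> g)"
  proof (rule mult_mono)
    show "1 - p \<le> 1 - p ^ ?i" using power_decreasing[OF i assms(1,2)] by simp
    show "p ^ (2 * k - 1) \<le> p ^ card (f \<union> g)" using u i assms by (intro power_decreasing) auto
  qed (use assms power_le_one in auto)
  also have "\<dots> = p ^ card (f \<union> g) - p ^ (2 * k)"
    unfolding u[symmetric] power_add by (simp add: algebra_simps)
  finally show ?thesis .
qed

lemma va_term_nonneg: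
  fixes p :: real
  assumes "0 \<le> p" "p \<le> 1" "f \<in> E" "g \<in> E"
  shows "0 \<le> p ^ card (f \<union> g) - p ^ (2 * k)"
  using power_decreasing[of "card (f \<union> g)" "2 * k" p] card_union_edges[OF assms(3,4)] assms by simp

text \<open>Only the diagonal pairs are kept, all terms being nonnegative. For \<open>p\<close> away
  from 1 this makes the variance at least a constant times the mean, which removes the variance from
  the conditions with exponent 2/3.\<close>

lemma va_ge_mu:
  assumes "0 \<le> p" "p \<le> 1"
  shows "mu p * (1 - p ^ k) \<le> va p"
proof -
  have "p ^ (2 * k) = p ^ k * p ^ k" by (simp add: mult_2 power_add)
  then have "mu p * (1 - p ^ k) = (\<Sum>f\<in>E. p ^ card (f \<union> f) - p ^ (2 * k))"
    using edge by (simp add: mu_def right_diff_distrib mult.assoc)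
  also have "\<dots> \<le> (\<Sum>f\<in>E. \<Sum>g\<in>E. p ^ card (f \<union> g) - p ^ (2 * k))"
  proof (rule sum_mono)
    fix f assume "f \<in> E"
    then show "p ^ card (f \<union> f) - p ^ (2 * k) \<le> (\<Sum>g\<in>E. p ^ card (f \<union> g) - p ^ (2 * k))"
      using finE va_term_nonneg[OF assms]
      by (intro member_le_sum[where f="\<lambda>g. p ^ card (f \<union> g) - p ^ (2 * k)"]) auto
  qed
  finally show ?thesis unfolding va_sum .
qed

lemma sum_degree: "(\<Sum>v\<in>V. real (card {f\<in>E. v \<in> f})) = real k * real (card E)"
proof -
  have "(\<Sum>v\<in>V. real (card {f\<in>E. v \<in> f})) = (\<Sum>v\<in>V. \<Sum>f\<in>E. of_bool (v \<in> f))"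
    using finE by (simp add: Int_def)
  also have "\<dots> = (\<Sum>f\<in>E. \<Sum>v\<in>V. of_bool (v \<in> f))" by (rule sum.swap)
  also have "\<dots> = (\<Sum>f\<in>E. real k)"
  proof (rule sum.cong[OF refl])
    fix f assume f: "f \<in> E"
    have "(\<Sum>v\<in>V. of_bool (v \<in> f)) = real (card (V \<inter> f))" using finV by (simp add: Int_def)
    also have "V \<inter> f = f" using edge[OF f] by auto
    finally show "(\<Sum>v\<in>V. of_bool (v \<in> f)) = real k" using edge[OF f] by simp
  qed
  finally show ?thesis by simp
qed

text \<open>Cauchy--Schwarz for the degrees gives many intersecting pairs of edges.\<close>

lemma va_ge_pairs:
  assumes "0 \<le> p" "p \<le> 1" "V \<noteq> {}"
  shows "(1 - p) * p ^ (2 * k - 1) * (real k * (real (card E))\<^sup>2 / real (card V)) \<le> va p"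
proof -
  let ?b = "\<lambda>f g. of_bool (f \<inter> g \<noteq> {}) :: real"
  let ?P = "\<Sum>f\<in>E. \<Sum>g\<in>E. ?b f g"
  let ?d = "\<lambda>v. real (card {f\<in>E. v \<in> f})"
  have N: "0 < real (card V)" using assms finV by (simp add: card_gt_0_iff)
  have "(\<Sum>v\<in>V. (?d v)\<^sup>2) = (\<Sum>v\<in>V. \<Sum>f\<in>E. \<Sum>g\<in>E. of_bool (v \<in> f \<inter> g))"
  proof (rule sum.cong[OF refl])
    fix v
    have "?d v = (\<Sum>f\<in>E. of_bool (v \<in> f))" using finE by (simp add: Int_def)
    then show "(?d v)\<^sup>2 = (\<Sum>f\<in>E. \<Sum>g\<in>E. of_bool (v \<in> f \<inter> g))"
      unfolding power2_eq_square by (simp only: sum_product) (intro sum.cong refl; simp)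
  qed
  also have "\<dots> = (\<Sum>f\<in>E. \<Sum>g\<in>E. \<Sum>v\<in>V. of_bool (v \<in> f \<inter> g))"
    by (subst sum.swap) (intro sum.cong refl sum.swap)
  also have "\<dots> \<le> (\<Sum>f\<in>E. \<Sum>g\<in>E. real k * ?b f g)"
  proof (intro sum_mono)
    fix f g assume f: "f \<in> E" and g: "g \<in> E"
    have "(\<Sum>v\<in>V. of_bool (v \<in> f \<inter> g)) = real (card (V \<inter> (f \<inter> g)))" using finV by (simp add: Int_def)
    also have "\<dots> \<le> real k * ?b f g"
    proof (cases "f \<inter> g = {}")
      case False
      have "card (V \<inter> (f \<inter> g)) \<le> card f" using fin_edge[OF f] by (intro card_mono) auto
      then show ?thesis using False edge[OF f] by simp
    qed simp
    finally show "(\<Sum>v\<in>V. of_bool (v \<in> f \<inter> g)) \<le> real k * ?b f g" .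
  qed
  also have "\<dots> = real k * ?P" by (simp add: sum_distrib_left)
  finally have "(\<Sum>v\<in>V. (?d v)\<^sup>2) \<le> real k * ?P" .
  moreover have "(\<Sum>v\<in>V. ?d v)\<^sup>2 \<le> real (card V) * (\<Sum>v\<in>V. (?d v)\<^sup>2)"
    using sum_squared_le_sum_of_squares[of ?d V] by (simp add: mult.commute)
  ultimately have "(real k * real (card E))\<^sup>2 \<le> real (card V) * (real k * ?P)"
    unfolding sum_degree using N by (smt (verit) mult_left_mono)
  then have "real k * (real k * (real (card E))\<^sup>2) \<le> real k * (real (card V) * ?P)"
    by (simp add: power2_eq_square mult_ac)
  then have "real k * (real (card E))\<^sup>2 \<le> real (card V) * ?P" using k3 by simp
  then have "real k * (real (card E))\<^sup>2 / real (card V) \<le> ?P" using N by (simp add: field_simps)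
  then have "(1 - p) * p ^ (2 * k - 1) * (real k * (real (card E))\<^sup>2 / real (card V))
      \<le> (1 - p) * p ^ (2 * k - 1) * ?P"
    using assms by (intro mult_left_mono) auto
  also have "\<dots> = (\<Sum>f\<in>E. \<Sum>g\<in>E. (1 - p) * p ^ (2 * k - 1) * ?b f g)"
    by (simp only: sum_distrib_left)
  also have "\<dots> \<le> va p" unfolding va_sum
  proof (intro sum_mono)
    fix f g assume "f \<in> E" "g \<in> E"
    then show "(1 - p) * p ^ (2 * k - 1) * ?b f g \<le> p ^ card (f \<union> g) - p ^ (2 * k)"
      using va_term_ge[OF assms(1,2)] va_term_nonneg[OF assms(1,2)] by simp
  qed
  finally show ?thesis .
qed

lemma card_touching_le:
  assumes "finite W"
  shows "real (card {f\<in>E. f \<inter> W \<noteq> {}}) \<le> real (card W) * (D * real (card V))"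
proof -
  have "card {f\<in>E. f \<inter> W \<noteq> {}} \<le> card (\<Union>v\<in>W. {f\<in>E. v \<in> f})"
    by (rule card_mono[rotated]) (use finE assms in auto)
  also have "\<dots> \<le> (\<Sum>v\<in>W. card {f\<in>E. v \<in> f})" by (rule card_UN_le[OF assms])
  finally have "real (card {f\<in>E. f \<inter> W \<noteq> {}}) \<le> (\<Sum>v\<in>W. real (card {f\<in>E. v \<in> f}))"
    by (rule of_nat_le_sum)
  also have "\<dots> \<le> (\<Sum>v\<in>W. D * real (card V))" by (intro sum_mono degree_le)
  finally show ?thesis by simp
qed

text \<open>Fix one vertex of \<open>f \<inter> W\<close>; any second one shares at most
  \<open>D\<close> edges with it. Here the codegree bound improves on counting by degrees.\<close>

lemma card_touching_twice_le:
  assumes "finite W"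
  shows "real (card {f\<in>E. f \<inter> W \<noteq> {} \<and> 2 \<le> card (f \<inter> W)}) \<le> (real (card W))\<^sup>2 * D"
proof -
  have "{f\<in>E. f \<inter> W \<noteq> {} \<and> 2 \<le> card (f \<inter> W)} \<subseteq> (\<Union>v\<in>W. {f\<in>E. v \<in> f \<and> f \<inter> (W - {v}) \<noteq> {}})"
  proof
    fix f assume f: "f \<in> {f\<in>E. f \<inter> W \<noteq> {} \<and> 2 \<le> card (f \<inter> W)}"
    then obtain v where v: "v \<in> f \<inter> W" by auto
    have "f \<inter> W \<noteq> {v}" using f by auto
    then have "f \<inter> (W - {v}) \<noteq> {}" using v by blast
    then show "f \<in> (\<Union>v\<in>W. {f\<in>E. v \<in> f \<and> f \<inter> (W - {v}) \<noteq> {}})" using v f by auto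
  qed
  then have "card {f\<in>E. f \<inter> W \<noteq> {} \<and> 2 \<le> card (f \<inter> W)}
      \<le> card (\<Union>v\<in>W. {f\<in>E. v \<in> f \<and> f \<inter> (W - {v}) \<noteq> {}})"
    by (rule card_mono[rotated]) (use finE assms in auto)
  also have "\<dots> \<le> (\<Sum>v\<in>W. card {f\<in>E. v \<in> f \<and> f \<inter> (W - {v}) \<noteq> {}})"
    by (rule card_UN_le[OF assms])
  finally have "real (card {f\<in>E. f \<inter> W \<noteq> {} \<and> 2 \<le> card (f \<inter> W)})
      \<le> (\<Sum>v\<in>W. real (card {f\<in>E. v \<in> f \<and> f \<inter> (W - {v}) \<noteq> {}}))"
    by (rule of_nat_le_sum)
  also have "\<dots> \<le> (\<Sum>v\<in>W. real (card W) * D)"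
  proof (rule sum_mono)
    fix v
    have "real (card {f\<in>E. v \<in> f \<and> f \<inter> (W - {v}) \<noteq> {}}) \<le> real (card (W - {v})) * D"
      using assms by (intro card_meeting_le) auto
    also have "\<dots> \<le> real (card W) * D"
      using assms D1 by (intro mult_right_mono of_nat_mono card_mono) auto
    finally show "real (card {f\<in>E. v \<in> f \<and> f \<inter> (W - {v}) \<noteq> {}}) \<le> real (card W) * D" .
  qed
  finally show ?thesis by (simp add: power2_eq_square mult_ac)
qed

text \<open>The first term accounts for the edges that meet \<open>W\<close> once, the second for the others.\<close>

lemma sum_touching_le:
  fixes x y :: real
  assumes "finite W" "0 \<le> x" "0 \<le> y"
    and 1: "\<And>f. f \<in> E \<Longrightarrow> f \<inter> W \<noteq> {} \<Longrightarrow> card (f \<inter> W) = 1 \<Longrightarrow> h f \<le> x"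
    and 2: "\<And>f. f \<in> E \<Longrightarrow> 2 \<le> card (f \<inter> W) \<Longrightarrow> h f \<le> y"
  shows "(\<Sum>f | f \<in> E \<and> f \<inter> W \<noteq> {}. h f)
    \<le> real (card W) * (D * real (card V)) * x + (real (card W))\<^sup>2 * D * y"
proof -
  have "(\<Sum>f | f \<in> E \<and> f \<inter> W \<noteq> {}. h f)
      \<le> (\<Sum>f | f \<in> E \<and> f \<inter> W \<noteq> {}. x + (if 2 \<le> card (f \<inter> W) then y else 0))"
  proof (rule sum_mono)
    fix f assume "f \<in> {f. f \<in> E \<and> f \<inter> W \<noteq> {}}"
    then have f: "f \<in> E" "f \<inter> W \<noteq> {}" by auto
    have "card (f \<inter> W) \<noteq> 0" using f fin_edge[OF f(1)] by simp
    then consider "card (f \<inter> W) = 1" | "2 \<le> card (f \<inter> W)" by linarith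
    then show "h f \<le> x + (if 2 \<le> card (f \<inter> W) then y else 0)"
      using 1[OF f] 2[OF f(1)] assms(2,3) by cases auto
  qed
  also have "\<dots> = real (card {f\<in>E. f \<inter> W \<noteq> {}}) * x
      + real (card {f\<in>E. f \<inter> W \<noteq> {} \<and> 2 \<le> card (f \<inter> W)}) * y"
    using finE by (simp add: sum.distrib sum.If_cases Int_def conj_ac)
  also have "real (card {f\<in>E. f \<inter> W \<noteq> {}}) \<le> real (card W) * (D * real (card V))"
    by (rule card_touching_le[OF assms(1)])
  also have "real (card {f\<in>E. f \<inter> W \<noteq> {} \<and> 2 \<le> card (f \<inter> W)}) \<le> (real (card W))\<^sup>2 * D"
    by (rule card_touching_twice_le[OF assms(1)])
  finally show ?thesis using assms by (simp add: mult_right_mono)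
qed

text \<open>For fixed \<open>f\<close>, the edges meeting it in one vertex number at most
  \<open>k * D * card V\<close> and have exponent \<open>2 * k - 1\<close>; the at most k^2 D others
  meeting it have exponent at least \<open>k\<close>.\<close>

lemma va_le:
  assumes "0 \<le> p" "p \<le> 1"
  shows "va p \<le> (real k)\<^sup>2 * D * mu p * (1 + real (card V) * p ^ (k - 1))"
proof -
  let ?N = "real (card V)"
  have "va p \<le> (\<Sum>f\<in>E. real k * (D * ?N) * p ^ (2 * k - 1) + (real k)\<^sup>2 * D * p ^ k)"
    unfolding va_sum
  proof (rule sum_mono)
    fix f assume f: "f \<in> E"
    let ?I = "{g. g \<in> E \<and> g \<inter> f \<noteq> {}}"
    have "(\<Sum>g\<in>E. p ^ card (f \<union> g) - p ^ (2 * k)) = (\<Sum>g\<in>?I. p ^ card (f \<union> g) - p ^ (2 * k))"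
    proof (rule sum.mono_neutral_right)
      show "\<forall>g\<in>E - ?I. p ^ card (f \<union> g) - p ^ (2 * k) = 0"
      proof
        fix g assume "g \<in> E - ?I"
        then have "g \<in> E" "f \<inter> g = {}" by auto
        then have "card (f \<union> g) = 2 * k" using card_union_edges[OF f, of g] by simp
        then show "p ^ card (f \<union> g) - p ^ (2 * k) = 0" by simp
      qed
    qed (use finE in auto)
    also have "\<dots> \<le> (\<Sum>g\<in>?I. p ^ card (f \<union> g))" using assms by (intro sum_mono) auto
    also have "\<dots> \<le> real (card f) * (D * ?N) * p ^ (2 * k - 1) + (real (card f))\<^sup>2 * D * p ^ k"
    proof (rule sum_touching_le)
      fix g assume g: "g \<in> E" "card (g \<inter> f) = 1"
      then have "card (f \<union> g) = 2 * k - 1" using card_union_edges[OF f g(1)] by (simp add: Int_commute)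
      then show "p ^ card (f \<union> g) \<le> p ^ (2 * k - 1)" by simp
    next
      fix g assume g: "g \<in> E"
      have "card f \<le> card (f \<union> g)" using fin_edge f g by (intro card_mono) auto
      then show "p ^ card (f \<union> g) \<le> p ^ k" using edge[OF f] assms by (intro power_decreasing) auto
    qed (use fin_edge[OF f] assms in auto)
    finally show "(\<Sum>g\<in>E. p ^ card (f \<union> g) - p ^ (2 * k))
        \<le> real k * (D * ?N) * p ^ (2 * k - 1) + (real k)\<^sup>2 * D * p ^ k" using edge[OF f] by simp
  qed
  also have "\<dots> = mu p * (real k * (D * ?N) * p ^ (k - 1) + (real k)\<^sup>2 * D)"
  proof -
    have "2 * k - 1 = k + (k - 1)" using k3 by simp
    then show ?thesis by (simp add: mu_def power_add algebra_simps)
  qed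
  also have "\<dots> \<le> mu p * ((real k)\<^sup>2 * (D * ?N) * p ^ (k - 1) + (real k)\<^sup>2 * D)"
    using k3 D1 assms mu_nonneg by (intro mult_left_mono add_right_mono mult_right_mono)
      (auto simp: power2_eq_square)
  finally show ?thesis by (simp add: algebra_simps)
qed

lemma chebyshev:
  assumes "0 \<le> p" "p \<le> 1" "0 < s"
  shows "rprob V p (\<lambda>A. s \<le> \<bar>Xc A - mu p\<bar>) \<le> va p / s\<^sup>2"
proof -
  have "rprob V p (\<lambda>A. s \<le> \<bar>Xc A - mu p\<bar>) \<le> rprob V p (\<lambda>A. s\<^sup>2 \<le> (Xc A - mu p)\<^sup>2)"
    using assms by (intro rprob_mono) (auto simp: abs_le_square_iff[symmetric])
  also have "\<dots> \<le> va p / s\<^sup>2" unfolding va_def using assms by (intro rprob_markov) auto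
  finally show ?thesis .
qed

end

section \<open>The upper bound\<close>

lemma ln_one_plus_ge:
  fixes x :: real
  assumes "0 \<le> x"
  shows "2 * x / (2 + x) \<le> ln (1 + x)"
proof -
  have "ln (1 + 0) - 2 * 0 / (2 + 0) \<le> ln (1 + x) - 2 * x / (2 + x)"
  proof (rule DERIV_nonneg_imp_nondecreasing[OF assms])
    fix y :: real assume "0 \<le> y" "y \<le> x"
    then have y: "0 < 1 + y" "0 < 2 + y" by auto
    have "((\<lambda>y. ln (1 + y) - 2 * y / (2 + y)) has_real_derivative
        1 / (1 + y) - (2 * (2 + y) - 2 * y) / (2 + y)\<^sup>2) (at y)"
      using y by (auto intro!: derivative_eq_intros simp: power2_eq_square)
    moreover have "1 / (1 + y) - (2 * (2 + y) - 2 * y) / (2 + y)\<^sup>2 = y\<^sup>2 / ((1 + y) * (2 + y)\<^sup>2)"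
      using y by (simp add: divide_simps) (simp add: power2_eq_square algebra_simps)
    moreover have "0 \<le> y\<^sup>2 / ((1 + y) * (2 + y)\<^sup>2)" using y by simp
    ultimately show "\<exists>d. ((\<lambda>y. ln (1 + y) - 2 * y / (2 + y)) has_real_derivative d) (at y) \<and> 0 \<le> d"
      by metis
  qed
  then show ?thesis by simp
qed

lemma phi_le_ln: "0 \<le> x \<Longrightarrow> phi x \<le> x * ln (1 + x)"
  using ln_add_one_self_le_self[of x] by (simp add: phi_def algebra_simps)

lemma phi_le_square: "0 \<le> x \<Longrightarrow> phi x \<le> x\<^sup>2"
  using phi_le_ln[of x] mult_left_mono[OF ln_add_one_self_le_self[of x], of x]
  by (simp add: power2_eq_square)

text \<open>Rearranges the rational lower bound for the logarithm. With \<open>phi_le_ln\<close>,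
  \<open>phi x\<close> and \<open>x * ln (1 + x)\<close> agree up to a factor 2, so the logarithms
  produced by counting tuples can be exchanged for \<open>phi\<close>.\<close>

lemma phi_ge_ln:
  assumes "0 \<le> x"
  shows "x * ln (1 + x) \<le> 2 * phi x"
proof -
  have "2 * x \<le> (2 + x) * ln (1 + x)" using ln_one_plus_ge[OF assms] assms by (simp add: field_simps)
  then show ?thesis by (simp add: phi_def algebra_simps)
qed

lemma phi_ge_square:
  assumes "0 \<le> x"
  shows "x\<^sup>2 / (2 + x) \<le> phi x"
proof -
  have "x * (2 * x / (2 + x)) \<le> x * ln (1 + x)"
    using ln_one_plus_ge[OF assms] assms by (intro mult_left_mono) auto
  moreover have "x * (2 * x / (2 + x)) = 2 * (x\<^sup>2 / (2 + x))" by (simp add: power2_eq_square)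
  ultimately show ?thesis using phi_ge_ln[OF assms] by linarith
qed

lemma phi_pos:
  assumes "0 < x"
  shows "0 < phi x"
proof -
  have "0 < x\<^sup>2 / (2 + x)" using assms by simp
  then show ?thesis using phi_ge_square[of x] assms by linarith
qed

lemma ln_le_powr_div:
  fixes x :: real
  assumes "0 < \<eta>" "1 \<le> x"
  shows "ln x \<le> x powr \<eta> / \<eta>"
proof -
  have "\<eta> * ln x = ln (x powr \<eta>)" using assms by (simp add: ln_powr)
  also have "\<dots> \<le> x powr \<eta>" using ln_bound[of "x powr \<eta>"] assms by simp
  finally show ?thesis using assms by (simp add: field_simps)
qed

lemma ln_le_sqrt:
  fixes x :: real
  assumes "0 < x"
  shows "ln x \<le> sqrt x"
proof -
  have "ln (sqrt x / 2) \<le> sqrt x / 2 - 1" using assms by (intro ln_le_minus_one) simp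
  then have "ln (sqrt x) \<le> sqrt x / 2 - 1 + ln 2" using assms by (simp add: ln_div)
  moreover have "ln x = 2 * ln (sqrt x)" using assms by (simp add: ln_sqrt)
  ultimately show ?thesis using ln_2_less_1 by linarith
qed

lemma ln_nat_ge_1: "3 \<le> (n::nat) \<Longrightarrow> 1 \<le> ln (real n)"
proof -
  assume n: "3 \<le> n"
  have "exp 1 \<le> (3::real)" using exp_le by simp
  then have "ln (exp 1) \<le> ln (real n)" using n by (subst ln_le_cancel_iff) auto
  then show ?thesis by simp
qed

text \<open>Bernoulli's inequality with exponent 4. It undoes the two halvings of \<open>t\<close>
  that leave \<open>t / (4 * \<mu>)\<close> inside the logarithm of the bounded-degree
  count.\<close>

lemma ln_quarter_ge:
  fixes x :: real
  assumes "0 \<le> x"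
  shows "ln (1 + x) / 4 \<le> ln (1 + x / 4)"
proof -
  have "1 + 4 * (x / 4) \<le> (1 + x / 4) ^ 4"
    using Bernoulli_inequality[of "x / 4" 4] assms by simp
  then have "ln (1 + x) \<le> ln ((1 + x / 4) ^ 4)" using assms by (subst ln_le_cancel_iff) auto
  also have "\<dots> = 4 * ln (1 + x / 4)" using assms by (simp add: ln_realpow)
  finally show ?thesis by simp
qed

section \<open>Hypergraphs with at least a n^2 edges on at most D n vertices\<close>

locale dense_hypergraph = codegree_hypergraph +
  fixes n :: nat and a :: real
  assumes a0: "0 < a" and n3: "3 \<le> n" and V_le: "real (card V) \<le> D * real n"
    and E_ge: "a * (real n)\<^sup>2 \<le> real (card E)"
begin

definition Lam :: "real \<Rightarrow> real" where "Lam p = mu p * (1 + real n * p ^ (k - 1))"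

text \<open>Written with \<open>exp 1 / p\<close>, so that the logarithm is at least 1 and the
  exponent stays positive up to \<open>p = 1\<close>.\<close>

definition upper_exp :: "real \<Rightarrow> real \<Rightarrow> real" where
  "upper_exp p t = min (phi (t / mu p) * (mu p)\<^sup>2 / Lam p) (sqrt t * ln (exp 1 / p))"

lemma E_ne: "E \<noteq> {}" and card_E_pos: "0 < real (card E)"
proof -
  have "0 < a * (real n)\<^sup>2" using a0 n3 by simp
  then show "0 < real (card E)" using E_ge by linarith
  then show "E \<noteq> {}" by auto
qed

lemma V_ne: "V \<noteq> {}" using E_ne edge k3 by fastforce

lemma V_pos: "1 \<le> card V" using V_ne finV by (simp add: Suc_le_eq card_gt_0_iff)

lemma card_E_le: "real (card E) \<le> D ^ 3 * (real n)\<^sup>2"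
proof -
  have "1 * real (card E) \<le> real k * real (card E)" using k3 by (intro mult_right_mono) auto
  also have "\<dots> \<le> (\<Sum>v\<in>V. D * real (card V))" unfolding sum_degree[symmetric] by (intro sum_mono degree_le)
  also have "\<dots> = D * (real (card V) * real (card V))" by simp
  also have "\<dots> \<le> D * ((D * real n) * (D * real n))"
    using V_le D1 by (intro mult_left_mono mult_mono) auto
  finally show ?thesis by (simp add: power2_eq_square power3_eq_cube mult_ac)
qed

lemma mu_pos: "0 < p \<Longrightarrow> 0 < mu p" using card_E_pos by (simp add: mu_def)

lemma mu_ge: "0 \<le> p \<Longrightarrow> a * (real n)\<^sup>2 * p ^ k \<le> mu p"
  unfolding mu_def using E_ge by (intro mult_right_mono) auto

lemma mu_le: "0 \<le> p \<Longrightarrow> mu p \<le> D ^ 3 * (real n)\<^sup>2 * p ^ k"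
  unfolding mu_def using card_E_le by (intro mult_right_mono) auto

lemma Lam_ge_mu: "0 \<le> p \<Longrightarrow> mu p \<le> Lam p"
  using mu_nonneg[of p] by (simp add: Lam_def mult_le_cancel_left1 not_less)

lemma Lam_pos: "0 < p \<Longrightarrow> 0 < Lam p"
  using Lam_ge_mu[of p] mu_pos[of p] by simp

lemma va_le_Lam:
  assumes "0 \<le> p" "p \<le> 1"
  shows "va p \<le> (real k)\<^sup>2 * D\<^sup>2 * Lam p"
proof -
  have "va p \<le> (real k)\<^sup>2 * D * mu p * (1 + real (card V) * p ^ (k - 1))" by (rule va_le[OF assms])
  also have "\<dots> \<le> (real k)\<^sup>2 * D * mu p * (D * (1 + real n * p ^ (k - 1)))"
  proof (rule mult_left_mono)
    have "real (card V) * p ^ (k - 1) \<le> D * real n * p ^ (k - 1)"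
      using V_le assms by (intro mult_right_mono) auto
    then show "1 + real (card V) * p ^ (k - 1) \<le> D * (1 + real n * p ^ (k - 1))"
      using D1 by (simp add: algebra_simps)
  qed (use D1 mu_nonneg[OF assms(1)] in auto)
  finally show ?thesis by (simp add: Lam_def power2_eq_square mult_ac)
qed

lemma upper_exp_pos:
  assumes "0 < p" "p \<le> 1" "0 < t"
  shows "0 < upper_exp p t"
proof -
  have "0 < phi (t / mu p)" using mu_pos assms by (intro phi_pos) auto
  moreover have "0 < ln (exp 1 / p)"
  proof -
    have "ln p \<le> 0" using assms by simp
    moreover have "ln (exp 1 / p) = 1 - ln p" using assms by (simp add: ln_div)
    ultimately show ?thesis by linarith
  qed
  ultimately show ?thesis unfolding upper_exp_def
    using mu_pos[OF assms(1)] Lam_pos[OF assms(1)] assms(3)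
    by (simp only: min_less_iff_conj) (intro conjI divide_pos_pos mult_pos_pos; simp)
qed

text \<open>\<open>upper_exp\<close> is at most the first entry of its minimum, which is phi(t/mu)
  mu / (1 + n p^(k-1)). So a large multiple of the ratio exceeds every fixed multiple of n p^(k-1),
  and the logarithm of the quotient is bounded below.\<close>

lemma ratio_ge:
  assumes p: "0 < p" "p \<le> 1" and t: "0 < t"
  shows "1 + real n * p ^ (k - 1) \<le> phi (t / mu p) * mu p / upper_exp p t"
proof -
  have M: "0 < upper_exp p t" using p t by (rule upper_exp_pos)
  have \<mu>: "0 < mu p" using mu_pos p by simp
  have "upper_exp p t \<le> phi (t / mu p) * (mu p)\<^sup>2 / Lam p" unfolding upper_exp_def by simp
  then have "upper_exp p t * (mu p * (1 + real n * p ^ (k - 1))) \<le> phi (t / mu p) * (mu p)\<^sup>2"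
    using Lam_pos p unfolding Lam_def by (simp add: pos_le_divide_eq)
  then have "mu p * (upper_exp p t * (1 + real n * p ^ (k - 1))) \<le> mu p * (phi (t / mu p) * mu p)"
    by (simp add: power2_eq_square mult_ac)
  then have "upper_exp p t * (1 + real n * p ^ (k - 1)) \<le> phi (t / mu p) * mu p" using \<mu> by simp
  then show ?thesis using M by (simp add: field_simps)
qed

lemma phi_mu_ge:
  assumes "0 < p" "0 < t"
  shows "t\<^sup>2 / (2 * mu p + t) \<le> phi (t / mu p) * mu p"
proof -
  have \<mu>: "0 < mu p" using mu_pos assms by simp
  have "2 + t / mu p = (2 * mu p + t) / mu p" using \<mu> by (simp add: add_divide_distrib)
  then have "t\<^sup>2 / (2 * mu p + t) = (t / mu p)\<^sup>2 / (2 + t / mu p) * mu p"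
    using \<mu> by (simp add: power2_eq_square)
  also have "\<dots> \<le> phi (t / mu p) * mu p" using \<mu> assms by (intro mult_right_mono phi_ge_square) auto
  finally show ?thesis .
qed

text \<open>The sunflower size is \<open>K * R\<close> rounded up. The first hypothesis on
  \<open>K\<close> keeps the logarithms above 2, the second is the reserve of order ln n for centres
  and scales. A size of order \<open>R\<close> makes the exponent of the bounded-degree count a
  multiple of \<open>M\<close>.\<close>

lemma upper_of_threshold:
  assumes p: "0 < p" "p \<le> 1" and t: "0 < t"
  defines "M \<equiv> upper_exp p t" and "\<mu> \<equiv> mu p"
  defines "R \<equiv> phi (t / \<mu>) * \<mu> / M"
  assumes K: "exp 1 ^ 3 * D\<^sup>2 \<le> K"
    and KR: "4 * ln (2 * real n) + 2 * ln (D * real n)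
      \<le> K * R * ln (K * R / (exp 1 * D\<^sup>2 * real n * p ^ (k - 1)))"
  defines "c1 \<equiv> 1 / (16 * (real k)\<^sup>2 * D * max 64 (8 * (exp 1 / (a / (exp 1 * D\<^sup>2) ^ 3)) powr (1/4)))"
  shows "rprob V p (\<lambda>A. \<mu> + t \<le> Xc A)
    \<le> (1 + 1 / real n) * exp (- min (1 / (32 * (real k)\<^sup>2 * D * K)) (c1 / 4) * M)"
proof -
  define \<Theta> where "\<Theta> = exp 1 * D * real (card V) * p ^ (k - 1)"
  define \<Theta>' where "\<Theta>' = exp 1 * D\<^sup>2 * real n * p ^ (k - 1)"
  define s0 where "s0 = nat \<lceil>K * R\<rceil>"
  have \<mu>: "0 < \<mu>" using mu_pos p \<mu>_def by simp
  have x: "0 < t / \<mu>" using \<mu> t by simp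
  have M: "0 < M" unfolding M_def using p t by (rule upper_exp_pos)
  have \<Theta>: "0 < \<Theta>" unfolding \<Theta>_def using p D1 V_pos by simp
  have \<Theta>': "\<Theta> \<le> \<Theta>'"
  proof -
    have "exp 1 * D * real (card V) * p ^ (k - 1) \<le> exp 1 * D * (D * real n) * p ^ (k - 1)"
      using V_le D1 p by (intro mult_left_mono mult_right_mono) auto
    then show ?thesis by (simp add: \<Theta>_def \<Theta>'_def power2_eq_square mult_ac)
  qed
  have e1: "1 \<le> exp (1::real)" by simp
  have K1: "1 \<le> K"
  proof -
    have "1 * 1 \<le> exp (1::real) ^ 3 * D\<^sup>2" using D1 e1 by (intro mult_mono one_le_power) auto
    then show ?thesis using K by simp
  qed
  have MLam: "M * Lam p \<le> phi (t / \<mu>) * \<mu>\<^sup>2"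
  proof -
    have "M \<le> phi (t / \<mu>) * \<mu>\<^sup>2 / Lam p" unfolding M_def upper_exp_def \<mu>_def by simp
    then show ?thesis using Lam_pos p by (simp add: pos_le_divide_eq)
  qed
  have R_ge: "1 + real n * p ^ (k - 1) \<le> R"
    unfolding R_def M_def \<mu>_def by (rule ratio_ge[OF p t])
  have np: "0 < real n * p ^ (k - 1)" using n3 p by simp
  have R1: "1 \<le> R" using R_ge np by linarith
  have KR1: "1 \<le> K * R" using mult_mono[OF K1 R1] K1 by simp
  have s0_ge: "K * R \<le> real s0" unfolding s0_def by linarith
  have s0_le: "real s0 \<le> 2 * K * R" unfolding s0_def using KR1 by linarith
  have s0_1: "1 \<le> s0" using s0_ge KR1 by linarith
  have sT: "K * R / \<Theta>' \<le> real s0 / \<Theta>"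
    using s0_ge \<Theta> \<Theta>' KR1 by (intro frac_le) auto
  have KT: "exp 1 ^ 2 \<le> K * R / \<Theta>'"
  proof -
    have "exp 1 ^ 2 * \<Theta>' = (exp 1 ^ 3 * D\<^sup>2) * (real n * p ^ (k - 1))"
      unfolding \<Theta>'_def by (simp add: power2_eq_square power3_eq_cube)
    also have "\<dots> \<le> K * R"
      using K K1 R_ge np by (intro mult_mono) auto
    finally show ?thesis using \<Theta> \<Theta>' by (simp add: pos_le_divide_eq)
  qed
  have l2: "2 \<le> ln (K * R / \<Theta>')"
  proof -
    have "ln (exp 1 ^ 2) \<le> ln (K * R / \<Theta>')"
      using KT by (intro ln_mono) (auto intro: less_le_trans[OF _ KT])
    then show ?thesis by (simp add: ln_realpow)
  qed
  have l3: "ln (K * R / \<Theta>') \<le> ln (real s0 / \<Theta>)"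
    using sT KT by (intro ln_mono) (auto intro: less_le_trans[OF _ KT])
  have big: "4 * ln (2 * real n) + 2 * ln (D * real n) \<le> real s0 * ln (real s0 / \<Theta>)"
  proof -
    have "K * R * ln (K * R / \<Theta>') \<le> real s0 * ln (real s0 / \<Theta>)"
      using s0_ge l2 l3 KR1 by (intro mult_mono) auto
    then show ?thesis using KR unfolding \<Theta>'_def by linarith
  qed
  have pos_logs: "0 \<le> ln (2 * real n)" "0 \<le> ln (D * real n)"
  proof -
    show "0 \<le> ln (2 * real n)" using n3 by (intro ln_ge_zero) auto
    have "1 * 1 \<le> D * real n" using D1 n3 by (intro mult_mono) auto
    then show "0 \<le> ln (D * real n)" by (intro ln_ge_zero) auto
  qed
  define a' where "a' = a / (exp 1 * D\<^sup>2) ^ 3"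
  have a': "0 < a'" using a0 D1 unfolding a'_def by simp
  \<comment> \<open>The identity (n p^(k-1))^3 = (n^2 p^k) (n p^(k-1)) p^(k-2) brings in the mean
    and then \<open>Lam p\<close>; and \<open>M * Lam p\<close> is at most phi(t/mu) mu^2, hence at
    most t^2.\<close>
  have M3: "a' * M * \<Theta> ^ 3 \<le> t\<^sup>2 * p ^ (k - 2)"
  proof -
    have "a' * M * \<Theta> ^ 3 \<le> a' * M * \<Theta>' ^ 3"
      using a' M \<Theta> \<Theta>' by (intro mult_left_mono power_mono) auto
    also have "\<dots> = a * M * (real n * p ^ (k - 1)) ^ 3"
      unfolding a'_def \<Theta>'_def using D1 by (simp add: power_mult_distrib)
    also have "\<dots> = M * (a * (real n)\<^sup>2 * p ^ k * (real n * p ^ (k - 1))) * p ^ (k - 2)"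
    proof -
      have "p ^ (k - 1) * p ^ (k - 1) = p ^ k * p ^ (k - 2)"
        unfolding power_add[symmetric] using k3 by (intro arg_cong[where f="\<lambda>i. p ^ i"]) auto
      then show ?thesis by (simp add: power2_eq_square power3_eq_cube mult_ac)
    qed
    also have "\<dots> \<le> M * (mu p * (1 + real n * p ^ (k - 1))) * p ^ (k - 2)"
      using mu_ge[of p] M p np mu_nonneg[of p]
      by (intro mult_right_mono mult_left_mono mult_mono) auto
    also have "\<dots> = M * Lam p * p ^ (k - 2)" by (simp add: Lam_def)
    also have "\<dots> \<le> (t\<^sup>2) * p ^ (k - 2)"
    proof (rule mult_right_mono)
      have "phi (t / \<mu>) * \<mu>\<^sup>2 \<le> (t / \<mu>)\<^sup>2 * \<mu>\<^sup>2" using x by (intro mult_right_mono phi_le_square) auto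
      also have "\<dots> = t\<^sup>2" using \<mu> by (simp add: power_divide)
      finally show "M * Lam p \<le> t\<^sup>2" using MLam by linarith
    qed (use p in auto)
    finally show ?thesis .
  qed
  have "rprob V p (\<lambda>A. real (card E) * p ^ k + t \<le> real (card {f\<in>E. f \<subseteq> A}))
    \<le> exp (- (t / (4 * ((real k)\<^sup>2 * D * real s0))) * ln (1 + t / (4 * (real (card E) * p ^ k))))
      + exp (- (c1 / 4 * M)) / real n"
  proof (rule upper_core[OF p t E_ne _ a'])
    show "c1 = 1 / (16 * (real k)\<^sup>2 * D * max 64 (8 * (exp 1 / a') powr (1 / 4)))"
      unfolding c1_def a'_def ..
    show "1 \<le> s0" by (rule s0_1)
    show "2 \<le> ln (real s0 / (exp 1 * D * real (card V) * p ^ (k - 1)))"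
      using l2 l3 unfolding \<Theta>_def by linarith
    show "4 * ln (2 * real n) \<le> real s0 * ln (real s0 / (exp 1 * D * real (card V) * p ^ (k - 1)))"
      using big pos_logs unfolding \<Theta>_def by linarith
    have "ln (real (card V)) \<le> ln (D * real n)" using V_le V_pos by (intro ln_mono) auto
    then show "2 * ln (real (card V)) \<le> real s0 * ln (real s0 / (exp 1 * D * real (card V) * p ^ (k - 1)))"
      using big pos_logs unfolding \<Theta>_def by linarith
    show "M \<le> sqrt t * ln (exp 1 / p)" unfolding M_def upper_exp_def by simp
    show "a' * M * (exp 1 * D * real (card V) * p ^ (k - 1)) ^ 3 \<le> t\<^sup>2 * p ^ (k - 2)"
      using M3 unfolding \<Theta>_def .
  qed (use M n3 in auto)
  then have main: "rprob V p (\<lambda>A. \<mu> + t \<le> Xc A)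
    \<le> exp (- (t / (4 * ((real k)\<^sup>2 * D * real s0)) * ln (1 + t / (4 * \<mu>)))) + exp (- (c1 / 4 * M)) / real n"
    unfolding \<mu>_def mu_def Xc_def by simp
  let ?c = "min (1 / (32 * (real k)\<^sup>2 * D * K)) (c1 / 4)"
  \<comment> \<open>The factor 32 collects 4 from the count, 4 from \<open>ln_quarter_ge\<close> and
    2 from rounding \<open>K * R\<close>.\<close>
  have "?c * M \<le> t / (4 * ((real k)\<^sup>2 * D * real s0)) * ln (1 + t / (4 * \<mu>))"
  proof -
    have "phi (t / \<mu>) * \<mu> / 4 \<le> t * (ln (1 + t / \<mu>) / 4)"
    proof -
      have "phi (t / \<mu>) * \<mu> \<le> (t / \<mu> * ln (1 + t / \<mu>)) * \<mu>"
        using x \<mu> by (intro mult_right_mono phi_le_ln) auto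
      then show ?thesis using \<mu> by simp
    qed
    also have "\<dots> \<le> t * ln (1 + t / \<mu> / 4)"
      using x t by (intro mult_left_mono ln_quarter_ge) auto
    finally have l: "phi (t / \<mu>) * \<mu> / 4 \<le> t * ln (1 + t / (4 * \<mu>))" by (simp add: mult.commute)
    have k0: "0 < (real k)\<^sup>2 * D" using k3 D1 by simp
    have "?c * M \<le> 1 / (32 * (real k)\<^sup>2 * D * K) * M" using M by (intro mult_right_mono) auto
    also have "\<dots> = 1 / (4 * ((real k)\<^sup>2 * D)) * (M / (8 * K))" by simp
    also have "\<dots> \<le> 1 / (4 * ((real k)\<^sup>2 * D)) * ((phi (t / \<mu>) * \<mu> / 4) / real s0)"
    proof (rule mult_left_mono)
      have "M * real s0 \<le> M * (2 * K * R)" using M s0_le by (intro mult_left_mono) auto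
      also have "\<dots> = 2 * K * (phi (t / \<mu>) * \<mu>)" unfolding R_def using M by simp
      finally show "M / (8 * K) \<le> phi (t / \<mu>) * \<mu> / 4 / real s0"
        using K1 s0_1 by (simp add: field_simps)
    qed (use k0 in auto)
    also have "\<dots> \<le> 1 / (4 * ((real k)\<^sup>2 * D)) * ((t * ln (1 + t / (4 * \<mu>))) / real s0)"
      using l k0 by (intro mult_left_mono divide_right_mono) auto
    also have "\<dots> = t / (4 * ((real k)\<^sup>2 * D * real s0)) * ln (1 + t / (4 * \<mu>))" by simp
    finally show ?thesis .
  qed
  moreover have "?c * M \<le> c1 / 4 * M" using M by (intro mult_right_mono) auto
  ultimately have "exp (- (t / (4 * ((real k)\<^sup>2 * D * real s0)) * ln (1 + t / (4 * \<mu>)))) + exp (- (c1 / 4 * M)) / real n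
      \<le> exp (- (?c * M)) + exp (- (?c * M)) / real n"
    by (intro add_mono divide_right_mono) auto
  then show ?thesis using main by (simp add: algebra_simps)
qed

end

text \<open>The constant of \<open>upper_of_threshold\<close>, named so that it visibly depends on
  \<open>k\<close>, \<open>a\<close>, \<open>D\<close> and \<open>K\<close> only and can be chosen
  before the hypergraph.\<close>

definition upper_const :: "nat \<Rightarrow> real \<Rightarrow> real \<Rightarrow> real \<Rightarrow> real" where
  "upper_const k a D K = min (1 / (32 * (real k)\<^sup>2 * D * K))
     (1 / (16 * (real k)\<^sup>2 * D * max 64 (8 * (exp 1 / (a / (exp 1 * D\<^sup>2) ^ 3)) powr (1/4))) / 4)"

lemma upper_const_pos: "3 \<le> k \<Longrightarrow> 1 \<le> D \<Longrightarrow> 0 < K \<Longrightarrow> 0 < upper_const k a D K"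
  unfolding upper_const_def by (auto intro!: divide_pos_pos mult_pos_pos)

section \<open>From the conditions on p and t to the reserve of order ln n\<close>

context dense_hypergraph
begin

text \<open>Either alternative makes \<open>R\<close> times the logarithm at least
  \<open>\<delta> * ln n\<close>: in the first \<open>R \<ge> 1\<close> and the logarithm is large,
  in the second the logarithm is at least 1 and \<open>R\<close> is large. The entry
  \<open>(10 + 2 * ln D) / \<delta>\<close> of the constant turns this into the required
  reserve.\<close>

lemma upper_of_dichotomy:
  assumes p: "0 < p" "p \<le> 1" and t: "0 < t" and \<delta>: "0 < \<delta>"
    and cond: "real n * p ^ (k - 1) \<le> real n powr (- \<delta>)
      \<or> \<delta> * ln (real n) \<le> phi (t / mu p) * mu p / upper_exp p t"
  shows "rprob V p (\<lambda>A. mu p + t \<le> Xc A)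
    \<le> (1 + 1 / real n) * exp (- upper_const k a D (max (exp 1 ^ 3 * D\<^sup>2) ((10 + 2 * ln D) / \<delta>)) * upper_exp p t)"
proof -
  define K where "K = max (exp 1 ^ 3 * D\<^sup>2) ((10 + 2 * ln D) / \<delta>)"
  define R where "R = phi (t / mu p) * mu p / upper_exp p t"
  define q where "q = real n * p ^ (k - 1)"
  have l1: "1 \<le> ln (real n)" using n3 by (rule ln_nat_ge_1)
  have lD: "0 \<le> ln D" using D1 by simp
  have q: "0 < q" unfolding q_def using n3 p by simp
  have R: "1 + q \<le> R" unfolding q_def R_def by (rule ratio_ge[OF p t])
  have K3: "exp 1 ^ 3 * D\<^sup>2 \<le> K" unfolding K_def by simp
  have D2: "1 \<le> D\<^sup>2" using D1 by simp
  have e3: "exp 1 \<le> exp (1::real) ^ 3" using power_increasing[of 1 3 "exp (1::real)"] by simp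
  have eK: "exp 1 * D\<^sup>2 \<le> K"
    using K3 mult_right_mono[OF e3, of "D\<^sup>2"] by simp
  have K0: "0 < K" using eK D2 by (smt (verit) exp_gt_zero mult_pos_pos)
  have K\<delta>: "10 + 2 * ln D \<le> K * \<delta>"
  proof -
    have "(10 + 2 * ln D) / \<delta> \<le> K" unfolding K_def by simp
    then show ?thesis using \<delta> by (simp add: field_simps)
  qed
  have logs: "4 * ln (2 * real n) + 2 * ln (D * real n) \<le> (10 + 2 * ln D) * ln (real n)"
  proof -
    have "ln (2 * real n) \<le> ln (real n * real n)" using n3 by (intro ln_mono) auto
    also have "\<dots> = 2 * ln (real n)" using n3 by (simp add: ln_mult)
    finally have 1: "ln (2 * real n) \<le> 2 * ln (real n)" .
    have 2: "ln (D * real n) = ln D + ln (real n)" using D1 n3 by (simp add: ln_mult)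
    have 3: "ln D * 1 \<le> ln D * ln (real n)" using l1 lD by (intro mult_left_mono) auto
    show ?thesis using 1 2 3 by (simp add: algebra_simps)
  qed
  also have "\<dots> \<le> K * \<delta> * ln (real n)" using K\<delta> l1 by (intro mult_right_mono) auto
  also have "\<dots> \<le> K * R * ln (K * R / (exp 1 * D\<^sup>2 * q))"
  proof (cases "q \<le> real n powr (- \<delta>)")
    case True
    have "real n powr \<delta> \<le> 1 / q"
      using True q n3 by (simp add: powr_minus field_simps)
    also have "\<dots> \<le> R * (K / (exp 1 * D\<^sup>2)) / q"
    proof (rule divide_right_mono)
      have "0 < exp 1 * D\<^sup>2" using D1 by simp
      then have "1 \<le> K / (exp 1 * D\<^sup>2)" using eK by (simp only: le_divide_eq_1_pos)
      moreover have "1 \<le> R" using R q by linarith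
      ultimately have "1 * 1 \<le> R * (K / (exp 1 * D\<^sup>2))" by (intro mult_mono) auto
      then show "1 \<le> R * (K / (exp 1 * D\<^sup>2))" by (simp only: mult_1)
    qed (use q in auto)
    also have "\<dots> = K * R / (exp 1 * D\<^sup>2 * q)" by simp
    finally have x: "real n powr \<delta> \<le> K * R / (exp 1 * D\<^sup>2 * q)" .
    have "\<delta> * ln (real n) = ln (real n powr \<delta>)" using n3 by (simp add: ln_powr)
    also have "\<dots> \<le> ln (K * R / (exp 1 * D\<^sup>2 * q))"
      using x n3 by (intro ln_mono) (auto intro: less_le_trans[OF _ x])
    finally have y: "\<delta> * ln (real n) \<le> ln (K * R / (exp 1 * D\<^sup>2 * q))" .
    have "K * 1 * (\<delta> * ln (real n)) \<le> K * R * ln (K * R / (exp 1 * D\<^sup>2 * q))"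
      using y R q K0 \<delta> l1 by (intro mult_mono) auto
    then show ?thesis by (simp add: mult_ac)
  next
    case False
    then have r: "\<delta> * ln (real n) \<le> R" using cond unfolding q_def R_def by blast
    have "exp 1 * (exp 1 * D\<^sup>2 * q) = exp 1 ^ 2 * (D\<^sup>2 * q)" by (simp only: power2_eq_square mult_ac)
    also have "\<dots> \<le> exp 1 ^ 3 * (D\<^sup>2 * q)"
      using q D2 by (intro mult_right_mono power_increasing) auto
    also have "\<dots> = (exp 1 ^ 3 * D\<^sup>2) * q" by (simp only: mult.assoc)
    finally have "exp 1 * (exp 1 * D\<^sup>2 * q) \<le> (exp 1 ^ 3 * D\<^sup>2) * q" .
    also have "(exp 1 ^ 3 * D\<^sup>2) * q \<le> K * R" using K3 K0 R q by (intro mult_mono) auto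
    finally have x: "exp 1 \<le> K * R / (exp 1 * D\<^sup>2 * q)" using q D1 by (subst pos_le_divide_eq) auto
    have "ln (exp 1) \<le> ln (K * R / (exp 1 * D\<^sup>2 * q))"
      using x by (intro ln_mono) (auto intro: less_le_trans[OF _ x])
    then have y: "1 \<le> ln (K * R / (exp 1 * D\<^sup>2 * q))" by simp
    have "K * (\<delta> * ln (real n)) * 1 \<le> K * R * ln (K * R / (exp 1 * D\<^sup>2 * q))"
      using y r K0 R q \<delta> l1 by (intro mult_mono) auto
    then show ?thesis by (simp add: mult_ac)
  qed
  finally have KR: "4 * ln (2 * real n) + 2 * ln (D * real n)
      \<le> K * R * ln (K * R / (exp 1 * D\<^sup>2 * real n * p ^ (k - 1)))"
    unfolding q_def by (simp add: mult.assoc)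
  from upper_of_threshold[OF p t K3 KR[unfolded R_def]]
  show ?thesis unfolding upper_const_def K_def .
qed

lemma powr_root_power:
  assumes "0 < x"
  shows "(x powr (c / (real k - 1))) ^ (k - 1) = x powr c"
proof -
  have "real (k - 1) = real k - 1" "real k - 1 \<noteq> 0" using k3 by (auto simp: of_nat_diff)
  then show ?thesis using assms by (simp add: powr_power)
qed

text \<open>Suppose neither alternative holds. Since R exceeds n p^(k-1), \<open>p\<close> lies
  below the upper end of the window; since n p^(k-1) is not polynomially small, above its lower end.
  So (b) or (c) holds, and either gives t^(3/2) \<ge> 9 \<delta> (ln n)^2 max(mu, t). With M \<le> 3
  sqrt t ln n and phi(t/mu) mu \<ge> t^2 / (3 max(mu, t)) this forces R \<ge> \<delta> ln n.\<close>

lemma dichotomy_of_conditions: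
  assumes p: "0 < p" "p \<le> 1" and t: "0 < t" and \<gamma>: "0 < \<gamma>" "\<gamma> < 1"
    and \<delta>: "0 < \<delta>" "\<delta> \<le> 1/6" "\<delta> \<le> \<gamma>" "\<delta> \<le> \<gamma> ^ (k - 1)" "9 * 256 * \<delta> \<le> sqrt a"
      "27 * \<delta> \<le> \<gamma> powr (3/2)" "\<delta> \<le> \<eta>" "9 * \<delta> \<le> sqrt a * \<eta>\<^sup>2"
    and \<eta>: "\<eta> = \<gamma> / (4 * (real k - 1))"
    and cond: "p \<notin> {real n powr (- 1 / (real k - 1) - \<gamma>) <..<
                   \<gamma> * real n powr (- 1 / (real k - 1)) * ln (real n) powr (1 / (real k - 1))}
            \<or> \<gamma> * min (va p powr (2/3)) (mu p powr (2/3)) * ln (real n) powr (4/3) \<le> t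
            \<or> mu p * p powr ((real k - 2) / 3 - \<gamma>) \<le> t"
  shows "real n * p ^ (k - 1) \<le> real n powr (- \<delta>)
      \<or> \<delta> * ln (real n) \<le> phi (t / mu p) * mu p / upper_exp p t"
proof (rule disjCI)
  define N where "N = real n"
  define l where "l = ln N"
  define q where "q = N * p ^ (k - 1)"
  define \<mu> where "\<mu> = mu p"
  define R where "R = phi (t / \<mu>) * \<mu> / upper_exp p t"
  have l1: "1 \<le> l" unfolding l_def N_def using n3 by (rule ln_nat_ge_1)
  have N: "3 \<le> N" unfolding N_def using n3 by simp
  have k1: "real (k - 1) = real k - 1" "2 \<le> real k - 1" using k3 by (auto simp: of_nat_diff)
  have \<mu>: "0 < \<mu>" unfolding \<mu>_def using mu_pos p by simp
  have q0: "0 < q" using N p unfolding q_def by simp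
  have R: "1 + q \<le> R" unfolding q_def R_def N_def \<mu>_def by (rule ratio_ge[OF p t])
  have \<eta>0: "0 < \<eta>" unfolding \<eta> using \<gamma> k1 by simp
  assume "\<not> \<delta> * ln (real n) \<le> phi (t / mu p) * mu p / upper_exp p t"
  then have nR: "R < \<delta> * l" unfolding R_def l_def N_def \<mu>_def by simp
  let ?lo = "N powr (- 1 / (real k - 1) - \<gamma>)"
  let ?hi = "\<gamma> * N powr (- 1 / (real k - 1)) * l powr (1 / (real k - 1))"
  have p_hi: "p < ?hi"
  proof (rule ccontr)
    assume "\<not> p < ?hi"
    then have "?hi ^ (k - 1) \<le> p ^ (k - 1)" using \<gamma> by (intro power_mono) auto
    moreover have "?hi ^ (k - 1) = \<gamma> ^ (k - 1) * N powr (-1) * l powr 1"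
      using N l1 by (simp only: power_mult_distrib powr_root_power)
    ultimately have "\<gamma> ^ (k - 1) * N powr (-1) * l powr 1 \<le> p ^ (k - 1)" by simp
    then have "\<gamma> ^ (k - 1) * l \<le> q" unfolding q_def using N l1 by (simp add: powr_minus field_simps)
    moreover have "\<delta> * l \<le> \<gamma> ^ (k - 1) * l" using \<delta>(4) l1 by (intro mult_right_mono) auto
    ultimately show False using R nR by linarith
  qed
  show "real n * p ^ (k - 1) \<le> real n powr (- \<delta>)"
  proof (rule ccontr)
    assume "\<not> real n * p ^ (k - 1) \<le> real n powr (- \<delta>)"
    then have q_gt: "N powr (- \<delta>) < q" unfolding q_def N_def by simp
    have p_lo: "?lo < p"
    proof (rule ccontr)
      assume "\<not> ?lo < p"
      then have "p ^ (k - 1) \<le> ?lo ^ (k - 1)" using p by (intro power_mono) auto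
      also have "?lo = N powr ((- 1 - \<gamma> * (real k - 1)) / (real k - 1))"
        using k1 by (simp add: diff_divide_distrib)
      also have "\<dots> ^ (k - 1) = N powr (- 1 - \<gamma> * (real k - 1))" using N by (intro powr_root_power) auto
      finally have "q \<le> N * N powr (- 1 - \<gamma> * (real k - 1))" unfolding q_def using N by (intro mult_left_mono) auto
      also have "\<dots> = N powr (1 + (- 1 - \<gamma> * (real k - 1)))" using N by (subst powr_add) simp
      also have "\<dots> \<le> N powr (- \<delta>)"
      proof (rule powr_mono)
        have "\<gamma> * 1 \<le> \<gamma> * (real k - 1)" using \<gamma> k1 by (intro mult_left_mono) auto
        then show "1 + (- 1 - \<gamma> * (real k - 1)) \<le> - \<delta>" using \<delta>(3) by simp
      qed (use N in auto)
      finally show False using q_gt by simp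
    qed
    have bc: "\<gamma> * min (va p powr (2/3)) (\<mu> powr (2/3)) * l powr (4/3) \<le> t
            \<or> \<mu> * p powr ((real k - 2) / 3 - \<gamma>) \<le> t"
      using cond p_lo p_hi unfolding N_def l_def \<mu>_def by auto
    have pq: "p ^ (k - 1) = q / N" unfolding q_def using N by simp
    have q_lt: "q < l"
    proof -
      have "p ^ (k - 1) < ?hi ^ (k - 1)" using p_hi p k3 by (intro power_strict_mono) auto
      also have "?hi ^ (k - 1) = \<gamma> ^ (k - 1) * N powr (-1) * l powr 1"
        using N l1 by (simp only: power_mult_distrib powr_root_power)
      also have "\<dots> \<le> 1 * N powr (-1) * l powr 1"
        using \<gamma> by (intro mult_right_mono power_le_one) auto
      finally show ?thesis unfolding q_def using N l1 by (simp add: powr_minus field_simps)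
    qed
    have pk_le: "p ^ (k - 1) \<le> N powr (-1/2)"
    proof -
      have "l \<le> N powr (1/2)" using ln_le_sqrt[of N] N unfolding l_def by (simp add: powr_half_sqrt)
      then have "q \<le> N powr (1/2)" using q_lt by simp
      then have "q / N \<le> N powr (1/2) / N powr 1" using N by (simp add: divide_right_mono)
      also have "\<dots> = N powr (-1/2)" unfolding powr_diff[symmetric] by simp
      finally show ?thesis unfolding pq .
    qed
    have pk_ge: "N powr (-1 - \<delta>) \<le> p ^ (k - 1)"
    proof -
      have "N powr (-1 - \<delta>) = N powr (- \<delta>) / N" using N by (simp add: powr_diff powr_minus field_simps)
      then show ?thesis unfolding pq using q_gt N by (simp add: divide_right_mono)
    qed
    have lnp: "ln (exp 1 / p) \<le> 3 * l"
    proof -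
      have "p ^ (k - 1) \<le> p ^ 1" using p k3 by (intro power_decreasing) auto
      then have "N powr (-1 - \<delta>) \<le> p" using pk_ge by simp
      then have "ln (N powr (-1 - \<delta>)) \<le> ln p" using N by (intro ln_mono) auto
      then have "- ln p \<le> (1 + \<delta>) * l" using N unfolding l_def by (simp add: ln_powr algebra_simps)
      also have "\<dots> \<le> 2 * l" using \<delta>(2) l1 by (intro mult_right_mono) auto
      finally show ?thesis using p l1 by (simp add: ln_div)
    qed
    \<comment> \<open>As k - 1 \<ge> 2, p^k is at least (p^(k-1))^(3/2) \<ge> N^(-7/4), where (1 +
      1/6) 3/2 = 7/4. So \<open>\<mu>\<close> is polynomially large and beats powers of
      \<open>l\<close>.\<close>
    have \<mu>N: "a * N powr (1/4) \<le> \<mu>"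
    proof -
      have "p ^ (k - 1) \<le> p\<^sup>2" using p k3 by (intro power_decreasing) auto
      then have "sqrt (p ^ (k - 1)) \<le> sqrt (p\<^sup>2)" by (rule real_sqrt_le_mono)
      then have "(p ^ (k - 1)) powr (1/2) \<le> p" using p by (simp add: powr_half_sqrt)
      then have "(p ^ (k - 1)) powr (1/2) * (p ^ (k - 1)) powr 1 \<le> p * p ^ (k - 1)"
        using p by (intro mult_mono) auto
      then have "(p ^ (k - 1)) powr (3/2) \<le> p * p ^ (k - 1)" unfolding powr_add[symmetric] by simp
      also have "p * p ^ (k - 1) = p ^ k" using k3 by (simp add: power_eq_if)
      finally have "(p ^ (k - 1)) powr (3/2) \<le> p ^ k" .
      moreover have "(N powr (-1 - \<delta>)) powr (3/2) \<le> (p ^ (k - 1)) powr (3/2)"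
        using pk_ge by (intro powr_mono2) auto
      moreover have "N powr (- 7/4) \<le> (N powr (-1 - \<delta>)) powr (3/2)"
        unfolding powr_powr using \<delta>(2) N by (intro powr_mono) auto
      ultimately have pk: "N powr (- 7/4) \<le> p ^ k" by linarith
      have "N powr (1/4) = N powr 2 * N powr (- 7/4)" unfolding powr_add[symmetric] by simp
      also have "\<dots> \<le> N\<^sup>2 * p ^ k" using pk N by (simp add: mult_left_mono)
      finally have "a * N powr (1/4) \<le> a * (N\<^sup>2 * p ^ k)" using a0 by (intro mult_left_mono) auto
      then show ?thesis using mu_ge[of p] p unfolding \<mu>_def N_def by simp
    qed
    have ln_small: "9 * \<delta> * l\<^sup>2 \<le> sqrt \<mu>"
    proof -
      have "l \<le> 16 * N powr (1/16)" using ln_le_powr_div[of "1/16" N] N unfolding l_def by simp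
      then have "l\<^sup>2 \<le> (16 * N powr (1/16))\<^sup>2" using l1 by (intro power_mono) auto
      also have "\<dots> = 256 * N powr (1/8)" using N by (simp add: power_mult_distrib powr_power)
      finally have "9 * \<delta> * l\<^sup>2 \<le> 9 * \<delta> * (256 * N powr (1/8))" using \<delta>(1) by (intro mult_left_mono) auto
      also have "\<dots> = 9 * 256 * \<delta> * N powr (1/8)" by simp
      also have "\<dots> \<le> sqrt a * N powr (1/8)" using \<delta>(5) by (intro mult_right_mono) auto
      also have "\<dots> = sqrt (a * N powr (1/4))"
        using N by (simp add: real_sqrt_mult powr_half_sqrt[symmetric] powr_powr)
      also have "\<dots> \<le> sqrt \<mu>" using \<mu>N by (rule real_sqrt_le_mono)
      finally show ?thesis .
    qed
    have t32: "t * sqrt t = t powr (3/2)"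
    proof -
      have "t powr (3/2) = t powr (1 + 1/2)" by simp
      also have "\<dots> = t * sqrt t" using t by (subst powr_add) (simp add: powr_half_sqrt)
      finally show ?thesis by simp
    qed
    have key: "9 * \<delta> * l\<^sup>2 * max \<mu> t \<le> t * sqrt t"
    proof (cases "\<mu> \<le> t")
      \<comment> \<open>Once \<open>t \<ge> \<mu>\<close>, the polynomial size of
        \<open>\<mu>\<close> alone suffices.\<close>
      case True
      have "9 * \<delta> * l\<^sup>2 \<le> sqrt t" using ln_small real_sqrt_le_mono[OF True] by linarith
      then have "9 * \<delta> * l\<^sup>2 * t \<le> sqrt t * t" using t by (intro mult_right_mono) auto
      then show ?thesis using True by (simp add: max_absorb2 mult.commute)
    next
      case False
      then have mx: "max \<mu> t = \<mu>" by simp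
      from bc show ?thesis
      proof
        assume b: "\<gamma> * min (va p powr (2/3)) (\<mu> powr (2/3)) * l powr (4/3) \<le> t"
        \<comment> \<open>\<open>p ^ k \<le> 2/3\<close> makes the variance at least
          \<open>\<mu> / 3\<close>, so the minimum in (b) may be replaced by a power of
          \<open>\<mu> / 3\<close>; then the inequality is raised to the power 3/2.\<close>
        have "p ^ k \<le> p ^ (k - 1)" using p by (intro power_decreasing) auto
        also have "\<dots> \<le> N powr (-1/2)" by (rule pk_le)
        also have "\<dots> \<le> 3 powr (-1/2)" using N by (intro powr_mono2') auto
        also have "\<dots> = 1 / sqrt 3" by (simp add: powr_minus powr_half_sqrt[symmetric] inverse_eq_divide)
        also have "\<dots> \<le> 2/3"
        proof -
          have "(3/2) \<le> sqrt 3" by (rule real_le_rsqrt) (simp add: power2_eq_square)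
          then show ?thesis by (simp add: field_simps)
        qed
        finally have "1/3 \<le> 1 - p ^ k" by simp
        then have "\<mu> * (1/3) \<le> \<mu> * (1 - p ^ k)" using \<mu> by (intro mult_left_mono) auto
        then have v: "\<mu> / 3 \<le> va p" using va_ge_mu[of p] p unfolding \<mu>_def by simp
        have "(\<mu> / 3) powr (2/3) \<le> min (va p powr (2/3)) (\<mu> powr (2/3))"
          using v \<mu> by (auto intro!: powr_mono2)
        then have "\<gamma> * (\<mu> / 3) powr (2/3) * l powr (4/3) \<le> t"
          using b \<gamma> by (meson mult_left_mono mult_right_mono less_imp_le order_trans powr_ge_zero)
        then have "(\<gamma> * (\<mu> / 3) powr (2/3) * l powr (4/3)) powr (3/2) \<le> t powr (3/2)"
          using \<gamma> by (intro powr_mono2) auto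
        moreover have "(\<gamma> * (\<mu> / 3) powr (2/3) * l powr (4/3)) powr (3/2) = \<gamma> powr (3/2) * (\<mu> / 3) * l\<^sup>2"
          using \<gamma> \<mu> l1 by (simp add: powr_mult powr_powr)
        moreover have "27 * \<delta> * (\<mu> / 3) * l\<^sup>2 \<le> \<gamma> powr (3/2) * (\<mu> / 3) * l\<^sup>2"
          using \<delta>(6) \<mu> by (intro mult_right_mono) auto
        ultimately show ?thesis unfolding t32 mx by (simp add: mult_ac)
      next
        assume c: "\<mu> * p powr ((real k - 2) / 3 - \<gamma>) \<le> t"
        \<comment> \<open>Raised to the power 3/2, (c) gains the factor sqrt mu p^((k-2)/2 -
          3\<gamma>/2). With sqrt mu \<ge> sqrt a N p^(k/2) this is at least sqrt a q
          p^(-3\<gamma>/2): the exponent (k-2)/3 is the one for which N and \<open>p\<close> combine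
          to \<open>q\<close>, and the slack \<gamma> gives a positive power of
          \<open>N\<close>.\<close>
        then have "(\<mu> * p powr ((real k - 2) / 3 - \<gamma>)) powr (3/2) \<le> t powr (3/2)"
          using \<mu> by (intro powr_mono2) auto
        moreover have "(\<mu> * p powr ((real k - 2) / 3 - \<gamma>)) powr (3/2)
            = \<mu> * (sqrt \<mu> * p powr ((real k - 2) / 2 - 3 * \<gamma> / 2))"
        proof -
          have "\<mu> powr (3/2) = \<mu> powr (1 + 1/2)" by simp
          also have "\<dots> = \<mu> * sqrt \<mu>" using \<mu> by (subst powr_add) (simp add: powr_half_sqrt)
          finally have 1: "\<mu> powr (3/2) = \<mu> * sqrt \<mu>" .
          have 2: "((real k - 2) / 3 - \<gamma>) * (3/2) = (real k - 2) / 2 - 3 * \<gamma> / 2"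
            by (simp add: field_simps)
          show ?thesis by (simp only: powr_mult powr_powr 1 2 mult.assoc)
        qed
        ultimately have 1: "\<mu> * (sqrt \<mu> * p powr ((real k - 2) / 2 - 3 * \<gamma> / 2)) \<le> t * sqrt t"
          unfolding t32 by simp
        have "p powr (real k / 2) = (p powr real k) powr (1/2)" by (simp only: powr_powr) simp
        also have "\<dots> = sqrt (p ^ k)" using p by (simp add: powr_half_sqrt powr_realpow)
        finally have "sqrt a * N * p powr (real k / 2) = sqrt (a * N\<^sup>2 * p ^ k)"
          using N by (simp add: real_sqrt_mult)
        also have "\<dots> \<le> sqrt \<mu>" using mu_ge[of p] p unfolding \<mu>_def N_def by simp
        finally have "sqrt a * N * p powr (real k / 2) * p powr ((real k - 2) / 2 - 3 * \<gamma> / 2)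
            \<le> sqrt \<mu> * p powr ((real k - 2) / 2 - 3 * \<gamma> / 2)"
          by (intro mult_right_mono) auto
        moreover have "sqrt a * N * p powr (real k / 2) * p powr ((real k - 2) / 2 - 3 * \<gamma> / 2)
            = sqrt a * (q * p powr (- 3 * \<gamma> / 2))"
        proof -
          have "p powr (real k / 2) * p powr ((real k - 2) / 2 - 3 * \<gamma> / 2)
              = p powr (real (k - 1)) * p powr (- 3 * \<gamma> / 2)"
            unfolding powr_add[symmetric] k1(1)
            by (intro arg_cong[where f="\<lambda>x. p powr x"]) (simp add: field_simps)
          then show ?thesis unfolding q_def using p by (simp add: powr_realpow mult_ac)
        qed
        moreover have "N powr (2 * \<eta>) \<le> q * p powr (- 3 * \<gamma> / 2)"
        proof -
          have "p = (p ^ (k - 1)) powr (1 / (real k - 1))"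
          proof -
            have "(p ^ (k - 1)) powr (1 / (real k - 1)) = (p powr real (k - 1)) powr (1 / (real k - 1))"
              using p by (simp only: powr_realpow)
            also have "\<dots> = p" unfolding powr_powr k1(1) using p k1(2) by simp
            finally show ?thesis by simp
          qed
          also have "\<dots> \<le> (N powr (-1/2)) powr (1 / (real k - 1))"
            using pk_le p k1 by (intro powr_mono2) auto
          finally have "p \<le> N powr (- 1 / (2 * (real k - 1)))" unfolding powr_powr by simp
          then have "(N powr (- 1 / (2 * (real k - 1)))) powr (- 3 * \<gamma> / 2) \<le> p powr (- 3 * \<gamma> / 2)"
            using p \<gamma> N by (intro powr_mono2') auto
          \<comment> \<open>\<open>\<eta>\<close> was chosen for this: p^(-3\<gamma>/2) is at least
            N^(3\<eta>), and at most one \<eta> is lost to q > N^(-\<delta>).\<close>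
          moreover have "(N powr (- 1 / (2 * (real k - 1)))) powr (- 3 * \<gamma> / 2) = N powr (3 * \<eta>)"
            unfolding powr_powr \<eta> using k1 by (simp add: field_simps)
          ultimately have "N powr (- \<delta>) * N powr (3 * \<eta>) \<le> q * p powr (- 3 * \<gamma> / 2)"
            using q_gt q0 by (intro mult_mono) auto
          moreover have "N powr (2 * \<eta>) \<le> N powr (- \<delta> + 3 * \<eta>)"
            using N \<delta>(7) by (intro powr_mono) auto
          ultimately show ?thesis unfolding powr_add by linarith
        qed
        then have "sqrt a * N powr (2 * \<eta>) \<le> sqrt a * (q * p powr (- 3 * \<gamma> / 2))"
          using a0 by (intro mult_left_mono) auto
        moreover have "9 * \<delta> * l\<^sup>2 \<le> sqrt a * N powr (2 * \<eta>)"
        proof -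
          have "\<eta> * l \<le> N powr \<eta>" using ln_le_powr_div[OF \<eta>0, of N] N \<eta>0 unfolding l_def by (simp add: field_simps)
          then have "(\<eta> * l)\<^sup>2 \<le> (N powr \<eta>)\<^sup>2" using \<eta>0 l1 by (intro power_mono) auto
          also have "\<dots> = N powr (2 * \<eta>)" using N by (simp add: powr_power)
          finally have "sqrt a * (\<eta>\<^sup>2 * l\<^sup>2) \<le> sqrt a * N powr (2 * \<eta>)"
            using a0 by (intro mult_left_mono) (auto simp: power_mult_distrib)
          moreover have "9 * \<delta> * l\<^sup>2 \<le> sqrt a * \<eta>\<^sup>2 * l\<^sup>2" using \<delta>(8) by (intro mult_right_mono) auto
          ultimately show ?thesis by simp
        qed
        ultimately have "9 * \<delta> * l\<^sup>2 \<le> sqrt \<mu> * p powr ((real k - 2) / 2 - 3 * \<gamma> / 2)" by linarith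
        then have "\<mu> * (9 * \<delta> * l\<^sup>2) \<le> \<mu> * (sqrt \<mu> * p powr ((real k - 2) / 2 - 3 * \<gamma> / 2))"
          using \<mu> by (intro mult_left_mono) auto
        then show ?thesis using 1 unfolding mx by (simp add: mult_ac)
      qed
    qed
    have "\<delta> * l \<le> R"
    proof -
      let ?x = "max \<mu> t"
      have x0: "0 < ?x" using \<mu> by simp
      have M: "0 < upper_exp p t" using p t by (rule upper_exp_pos)
      have "upper_exp p t \<le> sqrt t * ln (exp 1 / p)" unfolding upper_exp_def by simp
      also have "\<dots> \<le> sqrt t * (3 * l)" using lnp t by (intro mult_left_mono) auto
      finally have M_le: "upper_exp p t \<le> sqrt t * (3 * l)" .
      have "t\<^sup>2 / (3 * ?x) \<le> t\<^sup>2 / (2 * \<mu> + t)" using \<mu> t by (intro divide_left_mono) auto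
      also have "\<dots> \<le> phi (t / \<mu>) * \<mu>" unfolding \<mu>_def by (rule phi_mu_ge[OF p(1) t])
      finally have ph: "t\<^sup>2 / (3 * ?x) \<le> phi (t / \<mu>) * \<mu>" .
      have "\<delta> * l * (sqrt t * (3 * l)) = sqrt t / (3 * ?x) * (9 * \<delta> * l\<^sup>2 * ?x)"
        using x0 by (simp add: power2_eq_square field_simps)
      also have "\<dots> \<le> sqrt t / (3 * ?x) * (t * sqrt t)"
        using key x0 t by (intro mult_left_mono) auto
      also have "\<dots> = t\<^sup>2 / (3 * ?x)" using t by (simp add: power2_eq_square)
      finally have "\<delta> * l * (sqrt t * (3 * l)) \<le> phi (t / \<mu>) * \<mu>" using ph by linarith
      moreover have "\<delta> * l * upper_exp p t \<le> \<delta> * l * (sqrt t * (3 * l))"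
        using M_le \<delta>(1) l1 by (intro mult_left_mono) auto
      ultimately have "\<delta> * l * upper_exp p t \<le> phi (t / \<mu>) * \<mu>" by linarith
      then show ?thesis unfolding R_def using M by (simp add: field_simps)
    qed
    then show False using nR by simp
  qed
qed

section \<open>Lower bounds by planting and tilting\<close>

lemma rprob_ge_planted:
  assumes p: "0 < p" "p \<le> 1" and W: "W \<subseteq> V"
  shows "p ^ card W * rprob V p (\<lambda>A. Q (A \<union> W)) \<le> rprob V p Q"
proof -
  have "p ^ card W * rprob V p (\<lambda>A. Q (A \<union> W)) = rexp V p (\<lambda>A. of_bool (W \<subseteq> A) * of_bool (Q A))"
    unfolding rprob_def by (rule rexp_plant[OF finV W, symmetric])
  also have "\<dots> \<le> rprob V p Q" unfolding rprob_def using p by (intro rexp_mono) auto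
  finally show ?thesis .
qed

text \<open>The edges inside \<open>A\<close> and those inside \<open>W\<close> lie in the union;
  those counted twice lie inside \<open>A \<inter> W\<close>. The subtracted term is the part of the
  planted gain that was present anyway.\<close>

lemma Xc_planted_ge:
  "Xc A + Xc W - Xc (A \<inter> W) \<le> Xc (A \<union> W)"
proof -
  have "card {f\<in>E. f \<subseteq> A} + card {f\<in>E. f \<subseteq> W}
      = card ({f\<in>E. f \<subseteq> A} \<union> {f\<in>E. f \<subseteq> W}) + card ({f\<in>E. f \<subseteq> A} \<inter> {f\<in>E. f \<subseteq> W})"
    using finE by (intro card_Un_Int) auto
  also have "{f\<in>E. f \<subseteq> A} \<inter> {f\<in>E. f \<subseteq> W} = {f\<in>E. f \<subseteq> A \<inter> W}" by auto
  also have "card ({f\<in>E. f \<subseteq> A} \<union> {f\<in>E. f \<subseteq> W}) \<le> card {f\<in>E. f \<subseteq> A \<union> W}"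
    by (rule card_mono) (use finE in auto)
  finally show ?thesis unfolding Xc_def by linarith
qed

lemma rexp_Xc_inter: "rexp V p (\<lambda>A. Xc (A \<inter> W)) = Xc W * p ^ k"
proof -
  have "rexp V p (\<lambda>A. Xc (A \<inter> W)) = rexp V p (\<lambda>A. \<Sum>f | f \<in> E \<and> f \<subseteq> W. of_bool (f \<subseteq> A))"
    using finE by (intro rexp_cong) (auto simp: Xc_def Int_def intro!: arg_cong[where f=card])
  also have "\<dots> = (\<Sum>f | f \<in> E \<and> f \<subseteq> W. p ^ card f)"
    unfolding rexp_sum using edge finV by (intro sum.cong refl rexp_subset) auto
  also have "\<dots> = Xc W * p ^ k" using edge by (simp add: Xc_def)
  finally show ?thesis .
qed

text \<open>By Chebyshev, \<open>Xc A\<close> falls short by \<open>K * t\<close> with probability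
  at most \<open>\<gamma> / 4\<close>. By Markov, with probability at least
  \<open>\<gamma> / 2\<close> less than a fraction \<open>1 - \<gamma> / 2\<close> of the edges of
  \<open>W\<close> was already present, as p^k \<le> 1 - \<gamma> \<le> (1 - \<gamma>/2)^2. On the
  intersection the gain \<open>\<gamma> / 2 * Xc W\<close> covers
  \<open>(K + 1) * t\<close>.\<close>

lemma cluster_lower:
  assumes p: "0 < p" "p \<le> 1 - \<gamma>" and \<gamma>: "0 < \<gamma>" "\<gamma> < 1" and t: "0 < t"
    and B: "0 < B" "va p \<le> B * t\<^sup>2" and W: "W \<subseteq> V" "\<theta> * t \<le> Xc W"
    and \<theta>: "2 * (sqrt (4 * B / \<gamma>) + 1) / \<gamma> \<le> \<theta>"
  shows "\<gamma> / 4 * p ^ card W \<le> rprob V p (\<lambda>A. mu p + t \<le> Xc A)"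
proof -
  define K where "K = sqrt (4 * B / \<gamma>)"
  have p1: "p \<le> 1" using p \<gamma> by simp
  have K: "0 < K" "K\<^sup>2 = 4 * B / \<gamma>" unfolding K_def using B \<gamma> by auto
  have \<theta>0: "0 < \<theta>"
  proof -
    have "0 < 2 * (K + 1) / \<gamma>" using K(1) \<gamma> by (intro divide_pos_pos) auto
    then show ?thesis using \<theta> unfolding K_def by linarith
  qed
  have e: "0 < Xc W" using W \<theta>0 t by (smt (verit) mult_pos_pos)
  have 1: "rprob V p (\<lambda>A. K * t \<le> \<bar>Xc A - mu p\<bar>) \<le> \<gamma> / 4"
  proof -
    have "rprob V p (\<lambda>A. K * t \<le> \<bar>Xc A - mu p\<bar>) \<le> va p / (K * t)\<^sup>2"
      using p p1 K t by (intro chebyshev) auto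
    also have "\<dots> \<le> B * t\<^sup>2 / (K * t)\<^sup>2" using B by (intro divide_right_mono) auto
    also have "\<dots> = \<gamma> / 4" using K t B \<gamma> by (simp add: power_mult_distrib)
    finally show ?thesis .
  qed
  have 2: "rprob V p (\<lambda>A. (1 - \<gamma> / 2) * Xc W \<le> Xc (A \<inter> W)) \<le> 1 - \<gamma> / 2"
  proof -
    have "rprob V p (\<lambda>A. (1 - \<gamma> / 2) * Xc W \<le> Xc (A \<inter> W))
        \<le> rexp V p (\<lambda>A. Xc (A \<inter> W)) / ((1 - \<gamma> / 2) * Xc W)"
      using p p1 e \<gamma> Xc_nonneg by (intro rprob_markov) auto
    also have "\<dots> = p ^ k / (1 - \<gamma> / 2)" unfolding rexp_Xc_inter using e by simp
    also have "\<dots> \<le> (1 - \<gamma> / 2)"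
    proof -
      have "p ^ k \<le> p ^ 1" using p p1 k3 by (intro power_decreasing) auto
      also have "\<dots> \<le> 1 - \<gamma>" using p by simp
      also have "\<dots> \<le> (1 - \<gamma> / 2) * (1 - \<gamma> / 2)" by (simp add: algebra_simps)
      finally show ?thesis using \<gamma> by (simp add: pos_divide_le_eq)
    qed
    finally show ?thesis .
  qed
  have "\<gamma> / 4 \<le> 1 - rprob V p (\<lambda>A. K * t \<le> \<bar>Xc A - mu p\<bar>) + (1 - rprob V p (\<lambda>A. (1 - \<gamma> / 2) * Xc W \<le> Xc (A \<inter> W))) - 1"
    using 1 2 by linarith
  also have "\<dots> = rprob V p (\<lambda>A. \<not> K * t \<le> \<bar>Xc A - mu p\<bar>)
      + rprob V p (\<lambda>A. \<not> (1 - \<gamma> / 2) * Xc W \<le> Xc (A \<inter> W)) - 1"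
    by (simp only: rprob_compl[OF finV])
  also have "\<dots> \<le> rprob V p (\<lambda>A. \<not> K * t \<le> \<bar>Xc A - mu p\<bar> \<and> \<not> (1 - \<gamma> / 2) * Xc W \<le> Xc (A \<inter> W))"
    using p p1 by (intro rprob_inter_ge finV) auto
  also have "\<dots> \<le> rprob V p (\<lambda>A. mu p + t \<le> Xc (A \<union> W))"
  proof (rule rprob_mono)
    fix A assume A: "\<not> K * t \<le> \<bar>Xc A - mu p\<bar> \<and> \<not> (1 - \<gamma> / 2) * Xc W \<le> Xc (A \<inter> W)"
    then have "mu p - K * t \<le> Xc A" by linarith
    moreover have "Xc W - Xc (A \<inter> W) \<ge> \<gamma> / 2 * Xc W" using A by (simp add: algebra_simps)
    moreover have "(K + 1) * t \<le> \<gamma> / 2 * Xc W"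
    proof -
      have "2 * (K + 1) / \<gamma> * t \<le> \<theta> * t" using \<theta> t unfolding K_def by (intro mult_right_mono) auto
      then have "2 * (K + 1) / \<gamma> * t \<le> Xc W" using W by linarith
      then have "\<gamma> / 2 * (2 * (K + 1) / \<gamma> * t) \<le> \<gamma> / 2 * Xc W" using \<gamma> by (intro mult_left_mono) auto
      moreover have "\<gamma> / 2 * (2 * (K + 1) / \<gamma> * t) = (K + 1) * t" using \<gamma> by simp
      ultimately show ?thesis by (simp only:)
    qed
    moreover have "(K + 1) * t = K * t + t" by (simp add: algebra_simps)
    ultimately show "mu p + t \<le> Xc (A \<union> W)" using Xc_planted_ge[of A W] by linarith
  qed (use p p1 in auto)
  finally have "p ^ card W * (\<gamma> / 4) \<le> p ^ card W * rprob V p (\<lambda>A. mu p + t \<le> Xc (A \<union> W))"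
    using p by (intro mult_left_mono) auto
  also have "\<dots> \<le> rprob V p (\<lambda>A. mu p + t \<le> Xc A)" using p p1 W by (intro rprob_ge_planted) auto
  finally show ?thesis by (simp add: mult.commute)
qed

definition dense_at :: "real \<Rightarrow> bool" where
  "dense_at x \<longleftrightarrow> (\<exists>W\<subseteq>V. real (card W) \<le> D * max (sqrt x) 1 \<and> x \<le> Xc W)"

text \<open>The minimum has two meanings: with \<open>\<theta> * t\<close> planted edges
  \<open>cluster_lower\<close> applies, with \<open>mu p + t\<close> of them \<open>W\<close> alone
  realises the event. The lower bound \<open>\<tau>\<close> for \<open>t\<close> absorbs the 1 in
  \<open>max (sqrt x) 1\<close> into a multiple of \<open>sqrt t\<close>.\<close>

lemma dense_lower:
  assumes p: "0 < p" "p \<le> 1 - \<gamma>" and \<gamma>: "0 < \<gamma>" "\<gamma> < 1" and t: "0 < \<tau>" "\<tau> \<le> t"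
    and B: "0 < B" "va p \<le> B * t\<^sup>2"
    and \<theta>: "2 * (sqrt (4 * B / \<gamma>) + 1) / \<gamma> \<le> \<theta>"
    and dense: "dense_at (min (\<theta> * t) (mu p + t))"
  shows "\<gamma> / 4 * exp (- (D * (sqrt \<theta> + 1 / sqrt \<tau>)) * (sqrt t * ln (1 / p)))
    \<le> rprob V p (\<lambda>A. mu p + t \<le> Xc A)"
proof -
  have p1: "p \<le> 1" using p \<gamma> by simp
  have t0: "0 < t" using t by simp
  obtain W where W: "W \<subseteq> V" "real (card W) \<le> D * max (sqrt (min (\<theta> * t) (mu p + t))) 1"
      "min (\<theta> * t) (mu p + t) \<le> Xc W"
    using dense unfolding dense_at_def by blast
  have "\<gamma> / 4 * p ^ card W \<le> rprob V p (\<lambda>A. mu p + t \<le> Xc A)"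
  proof (cases "\<theta> * t \<le> mu p + t")
    case True
    then have "\<theta> * t \<le> Xc W" using W by simp
    then show ?thesis using cluster_lower[OF p \<gamma> t0 B W(1) _ \<theta>] by simp
  next
    case False
    then have w: "mu p + t \<le> Xc W" using W by simp
    have all: "rprob V p (\<lambda>A. mu p + t \<le> Xc (A \<union> W)) = 1"
    proof -
      have "mu p + t \<le> Xc (A \<union> W)" for A using w Xc_mono[of W "A \<union> W"] by simp
      then show ?thesis by (simp add: rprob_def rexp_const finV)
    qed
    have "\<gamma> / 4 * p ^ card W \<le> 1 * p ^ card W" using \<gamma> p by (intro mult_right_mono) auto
    also have "\<dots> = p ^ card W * rprob V p (\<lambda>A. mu p + t \<le> Xc (A \<union> W))" unfolding all by simp
    also have "\<dots> \<le> rprob V p (\<lambda>A. mu p + t \<le> Xc A)" using p p1 W by (intro rprob_ge_planted) auto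
    finally show ?thesis .
  qed
  moreover have "exp (- (D * (sqrt \<theta> + 1 / sqrt \<tau>)) * (sqrt t * ln (1 / p))) \<le> p ^ card W"
  proof -
    have \<theta>0: "0 \<le> \<theta>"
    proof -
      have "0 \<le> 2 * (sqrt (4 * B / \<gamma>) + 1) / \<gamma>" using B \<gamma> by simp
      then show ?thesis using \<theta> by linarith
    qed
    have "max (sqrt (min (\<theta> * t) (mu p + t))) 1 \<le> (sqrt \<theta> + 1 / sqrt \<tau>) * sqrt t"
    proof -
      have "sqrt (min (\<theta> * t) (mu p + t)) \<le> sqrt (\<theta> * t)" by (intro real_sqrt_le_mono) simp
      also have "\<dots> = sqrt \<theta> * sqrt t" by (simp add: real_sqrt_mult)
      finally have 1: "sqrt (min (\<theta> * t) (mu p + t)) \<le> sqrt \<theta> * sqrt t" .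
      have 2: "1 \<le> 1 / sqrt \<tau> * sqrt t" using t by simp
      have 3: "0 \<le> sqrt \<theta> * sqrt t" "0 \<le> 1 / sqrt \<tau> * sqrt t" using \<theta>0 t t0 by auto
      show ?thesis using 1 2 3 unfolding distrib_right by linarith
    qed
    then have "D * max (sqrt (min (\<theta> * t) (mu p + t))) 1 \<le> D * ((sqrt \<theta> + 1 / sqrt \<tau>) * sqrt t)"
      using D1 by (intro mult_left_mono) auto
    then have "real (card W) \<le> D * ((sqrt \<theta> + 1 / sqrt \<tau>) * sqrt t)" using W(2) by linarith
    then have "real (card W) * ln (1 / p) \<le> D * ((sqrt \<theta> + 1 / sqrt \<tau>) * sqrt t) * ln (1 / p)"
      using p p1 by (intro mult_right_mono) auto
    then have "exp (- (D * (sqrt \<theta> + 1 / sqrt \<tau>)) * (sqrt t * ln (1 / p))) \<le> exp (- (real (card W) * ln (1 / p)))"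
      by (simp add: mult_ac)
    also have "\<dots> = exp (real (card W) * ln p)" using p by (simp add: ln_div)
    also have "\<dots> = p ^ card W" using p by (simp add: exp_of_nat_mult)
    finally show ?thesis .
  qed
  then have "\<gamma> / 4 * exp (- (D * (sqrt \<theta> + 1 / sqrt \<tau>)) * (sqrt t * ln (1 / p))) \<le> \<gamma> / 4 * p ^ card W"
    using \<gamma> by (intro mult_left_mono) auto
  ultimately show ?thesis by linarith
qed

text \<open>Raising \<open>p\<close> to \<open>q = p * (1 + x)\<close> lifts the mean by at least
  \<open>C1 * t\<close>, and \<open>(C1 - 1) * t\<close> is at least sqrt 2 standard deviations at
  \<open>q\<close>, so the event has probability at least 1/2 there. Returning to \<open>p\<close>
  costs at most exp (card V (q - p)^2 / (p (1 - p))).\<close>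

lemma tilt_lower:
  assumes p: "0 < p" "p \<le> 1 - \<gamma>" and \<gamma>: "0 < \<gamma>" "\<gamma> < 1" and t: "0 < t"
    and c1: "0 < c1" "c1 * Lam p \<le> t\<^sup>2"
    and C1: "C1 = 1 + sqrt (2 * (real k)\<^sup>2 * D\<^sup>2 * 4 ^ k / c1)" and small: "C1 * t \<le> \<gamma> * mu p"
  shows "1/4 * exp (- (D * C1\<^sup>2 / \<gamma> * (real n * p * (t / mu p)\<^sup>2))) \<le> rprob V p (\<lambda>A. mu p + t \<le> Xc A)"
proof -
  define \<mu> where "\<mu> = mu p"
  define x where "x = C1 * t / \<mu>"
  define q where "q = p * (1 + x)"
  have \<mu>: "0 < \<mu>" unfolding \<mu>_def using mu_pos p by simp
  have p1: "p < 1" using p \<gamma> by simp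
  define S where "S = 2 * (real k)\<^sup>2 * D\<^sup>2 * 4 ^ k / c1"
  have S: "0 < S" unfolding S_def using k3 D1 c1 by simp
  have C1': "C1 = 1 + sqrt S" unfolding C1 S_def ..
  have C1_gt: "1 < C1" unfolding C1' using S by simp
  have x: "0 < x" "x \<le> \<gamma>" unfolding x_def using small \<mu> t C1_gt by (auto simp: \<mu>_def pos_divide_le_eq)
  have q: "0 < q" "q \<le> 2 * p" "q \<le> 1"
  proof -
    show "0 < q" unfolding q_def using p x by simp
    show "q \<le> 2 * p" unfolding q_def using p x \<gamma> by simp
    have "q \<le> (1 - \<gamma>) * (1 + \<gamma>)" unfolding q_def using p x \<gamma> by (intro mult_mono) auto
    also have "\<dots> \<le> 1" by (simp add: algebra_simps)
    finally show "q \<le> 1" .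
  qed
  have mu_q: "\<mu> + C1 * t \<le> mu q"
  proof -
    have "(1 + x) ^ 1 \<le> (1 + x) ^ k" using k3 x by (intro power_increasing) auto
    then have "1 + x \<le> (1 + x) ^ k" by simp
    then have "\<mu> * (1 + x) \<le> \<mu> * (1 + x) ^ k" using \<mu> by (intro mult_left_mono) auto
    also have "\<dots> = mu q" unfolding \<mu>_def mu_def q_def by (simp add: power_mult_distrib)
    finally show ?thesis using \<mu> by (simp add: x_def distrib_left)
  qed
  have Lam_q: "Lam q \<le> 4 ^ k * Lam p"
  proof -
    have pw: "q ^ i \<le> 2 ^ k * p ^ i" if "i \<le> k" for i
    proof -
      have "q ^ i \<le> (2 * p) ^ i" using q by (intro power_mono) auto
      also have "\<dots> = 2 ^ i * p ^ i" by (simp add: power_mult_distrib)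
      also have "\<dots> \<le> 2 ^ k * p ^ i" using p that by (intro mult_right_mono power_increasing) auto
      finally show ?thesis .
    qed
    have m: "mu q \<le> 2 ^ k * mu p"
      unfolding mu_def using mult_left_mono[OF pw[of k], of "real (card E)"] by (simp add: mult_ac)
    have "1 + real n * q ^ (k - 1) \<le> 2 ^ k + real n * (2 ^ k * p ^ (k - 1))"
      by (intro add_mono mult_left_mono pw) auto
    also have "\<dots> = 2 ^ k * (1 + real n * p ^ (k - 1))" by (simp add: algebra_simps)
    finally have "mu q * (1 + real n * q ^ (k - 1)) \<le> (2 ^ k * mu p) * (2 ^ k * (1 + real n * p ^ (k - 1)))"
      using m q mu_nonneg[of p] p by (intro mult_mono) auto
    also have "\<dots> = (2 * 2) ^ k * Lam p" unfolding Lam_def power_mult_distrib by simp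
    finally show ?thesis by (simp add: Lam_def)
  qed
  have var: "va q \<le> S / 2 * t\<^sup>2"
  proof -
    have "va q \<le> (real k)\<^sup>2 * D\<^sup>2 * Lam q" using q by (intro va_le_Lam) auto
    also have "\<dots> \<le> (real k)\<^sup>2 * D\<^sup>2 * (4 ^ k * (t\<^sup>2 / c1))"
    proof (intro mult_left_mono)
      have "Lam p \<le> t\<^sup>2 / c1" using c1 by (simp add: pos_le_divide_eq mult.commute)
      then have "4 ^ k * Lam p \<le> 4 ^ k * (t\<^sup>2 / c1)" by (intro mult_left_mono) auto
      then show "Lam q \<le> 4 ^ k * (t\<^sup>2 / c1)" using Lam_q by linarith
    qed auto
    finally show ?thesis unfolding S_def by simp
  qed
  have half: "1 / 2 \<le> rprob V q (\<lambda>A. \<mu> + t \<le> Xc A)"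
  proof -
    have "rprob V q (\<lambda>A. sqrt S * t \<le> \<bar>Xc A - mu q\<bar>) \<le> va q / (sqrt S * t)\<^sup>2"
      using q S t by (intro chebyshev) auto
    also have "\<dots> \<le> S / 2 * t\<^sup>2 / (sqrt S * t)\<^sup>2" using var by (intro divide_right_mono) auto
    also have "\<dots> = 1 / 2" using S t by (simp add: power_mult_distrib)
    finally have "1 / 2 \<le> rprob V q (\<lambda>A. \<not> sqrt S * t \<le> \<bar>Xc A - mu q\<bar>)"
      unfolding rprob_compl[OF finV] by simp
    also have "\<dots> \<le> rprob V q (\<lambda>A. \<mu> + t \<le> Xc A)"
    proof (rule rprob_mono)
      fix A assume "\<not> sqrt S * t \<le> \<bar>Xc A - mu q\<bar>"
      moreover have "C1 * t = t + sqrt S * t" unfolding C1' by (simp add: algebra_simps)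
      ultimately show "\<mu> + t \<le> Xc A" using mu_q by linarith
    qed (use q in auto)
    finally show ?thesis .
  qed
  let ?P = "rprob V p (\<lambda>A. \<mu> + t \<le> Xc A)"
  let ?y = "(q - p)\<^sup>2 / (p * (1 - p))"
  have P0: "0 \<le> ?P" using p p1 by (intro rprob_nonneg) auto
  have "(1/2)\<^sup>2 \<le> (rprob V q (\<lambda>A. \<mu> + t \<le> Xc A))\<^sup>2" using half by (intro power_mono) auto
  also have "\<dots> \<le> (1 + ?y) ^ card V * rexp V p (\<lambda>A. (of_bool (\<mu> + t \<le> Xc A))\<^sup>2)"
    unfolding rprob_def using p p1 q by (intro rexp_change_measure finV) auto
  also have "rexp V p (\<lambda>A. (of_bool (\<mu> + t \<le> Xc A))\<^sup>2) = ?P"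
    unfolding rprob_def by (intro rexp_cong) simp
  also have "(1 + ?y) ^ card V * ?P \<le> exp (D * C1\<^sup>2 / \<gamma> * (real n * p * (t / \<mu>)\<^sup>2)) * ?P"
  proof (rule mult_right_mono[OF _ P0])
    have y0: "0 \<le> ?y" using p p1 by simp
    have "(1 + ?y) ^ card V \<le> exp ?y ^ card V"
      using y0 exp_ge_add_one_self[of ?y] by (intro power_mono) auto
    also have "\<dots> = exp (real (card V) * ?y)" by (simp only: exp_of_nat_mult)
    also have "\<dots> \<le> exp (D * C1\<^sup>2 / \<gamma> * (real n * p * (t / \<mu>)\<^sup>2))"
    proof -
      have "?y \<le> (q - p)\<^sup>2 / (p * \<gamma>)" using p \<gamma> p1 by (intro divide_left_mono mult_left_mono) auto
      also have "\<dots> = p * (C1 * (t / \<mu>))\<^sup>2 / \<gamma>" unfolding q_def x_def using p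
        by (simp add: algebra_simps power2_eq_square)
      finally have "real (card V) * ?y \<le> (D * real n) * (p * (C1 * (t / \<mu>))\<^sup>2 / \<gamma>)"
        using V_le y0 D1 by (intro mult_mono) auto
      also have "\<dots> = D * C1\<^sup>2 / \<gamma> * (real n * p * (t / \<mu>)\<^sup>2)"
        by (simp only: power_mult_distrib[of C1]) simp
      finally show ?thesis unfolding exp_le_cancel_iff .
    qed
    finally show "(1 + ?y) ^ card V \<le> exp (D * C1\<^sup>2 / \<gamma> * (real n * p * (t / \<mu>)\<^sup>2))" .
  qed
  finally have "1/4 \<le> exp (D * C1\<^sup>2 / \<gamma> * (real n * p * (t / \<mu>)\<^sup>2)) * ?P" by (simp add: power2_eq_square)
  then have "exp (- (D * C1\<^sup>2 / \<gamma> * (real n * p * (t / \<mu>)\<^sup>2))) * (1/4)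
      \<le> exp (- (D * C1\<^sup>2 / \<gamma> * (real n * p * (t / \<mu>)\<^sup>2))) * (exp (D * C1\<^sup>2 / \<gamma> * (real n * p * (t / \<mu>)\<^sup>2)) * ?P)"
    by (intro mult_left_mono) auto
  also have "\<dots> = ?P" by (simp add: exp_minus)
  finally show ?thesis unfolding \<mu>_def by (simp add: mult.commute)
qed

end

lemma ln_one_plus_mult_le:
  fixes x :: real
  assumes "0 \<le> x" "1 \<le> K"
  shows "ln (1 + real K * x) \<le> real K * ln (1 + x)"
proof -
  have "1 + real K * x \<le> (1 + x) ^ K" using Bernoulli_inequality[of x K] assms by simp
  then have "ln (1 + real K * x) \<le> ln ((1 + x) ^ K)" using assms by (intro ln_mono) (auto simp: add_pos_nonneg)
  also have "\<dots> = real K * ln (1 + x)" using assms by (simp add: ln_realpow)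
  finally show ?thesis .
qed

section \<open>Planting disjoint edges in the sparse range\<close>

context dense_hypergraph
begin

text \<open>Exactly one new edge at each choice keeps the number of edges inside the chosen set
  equal to the number of choices. This bounds the planted gain from above, which the change of
  measure needs as much as the lower bound.\<close>

definition fresh :: "'a set \<Rightarrow> 'a set \<Rightarrow> bool" where
  "fresh U S \<longleftrightarrow> card {f\<in>E. f \<subseteq> U \<union> S} = Suc (card {f\<in>E. f \<subseteq> U})"

text \<open>An edge \<open>S\<close> disjoint from \<open>U\<close> fails to be fresh only if some other edge meets both
  \<open>U\<close> and \<open>S\<close>, and one of them at least twice.\<close>

lemma card_not_fresh_le:
  assumes U: "finite U"
  defines "u \<equiv> real (card U)" and "N \<equiv> real (card V)"
  shows "real (card {S\<in>E. \<not> (S \<inter> U = {} \<and> fresh U S)})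
    \<le> u * (D * N) + u\<^sup>2 * D * (real k * (D * N)) + u * (D * N) * ((real k)\<^sup>2 * D)"
proof -
  let ?B1 = "{S\<in>E. S \<inter> U \<noteq> {}}"
  let ?F2 = "{f\<in>E. f \<inter> U \<noteq> {} \<and> 2 \<le> card (f \<inter> U)}"
  let ?B2 = "\<Union>f\<in>?F2. {S\<in>E. S \<inter> f \<noteq> {}}"
  let ?B3 = "\<Union>f\<in>{f\<in>E. f \<inter> U \<noteq> {}}. {S\<in>E. S \<inter> f \<noteq> {} \<and> 2 \<le> card (S \<inter> f)}"
  \<comment> \<open>The three families give the three summands: \<open>S\<close> meets
    \<open>U\<close>; \<open>S\<close> meets an edge with two vertices in \<open>U\<close>;
    \<open>S\<close> shares two vertices with an edge that meets \<open>U\<close>.\<close>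
  have sub: "{S\<in>E. \<not> (S \<inter> U = {} \<and> fresh U S)} \<subseteq> ?B1 \<union> ?B2 \<union> ?B3"
  proof
    fix S assume "S \<in> {S\<in>E. \<not> (S \<inter> U = {} \<and> fresh U S)}"
    then have S: "S \<in> E" "\<not> (S \<inter> U = {} \<and> fresh U S)" by auto
    show "S \<in> ?B1 \<union> ?B2 \<union> ?B3"
    proof (cases "S \<inter> U = {}")
      case False
      then show ?thesis using S by blast
    next
      case True
      then have nf: "\<not> fresh U S" using S by blast
      have finS: "finite S" by (rule fin_edge[OF S(1)])
      have "S \<noteq> {}" using edge[OF S(1)] k3 by auto
      then have "\<not> S \<subseteq> U" using True by blast
      have "{f\<in>E. f \<subseteq> U \<union> S} \<noteq> insert S {f\<in>E. f \<subseteq> U}"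
      proof
        assume "{f\<in>E. f \<subseteq> U \<union> S} = insert S {f\<in>E. f \<subseteq> U}"
        then have "card {f\<in>E. f \<subseteq> U \<union> S} = Suc (card {f\<in>E. f \<subseteq> U})"
          using \<open>\<not> S \<subseteq> U\<close> finE by simp
        then show False using nf unfolding fresh_def by simp
      qed
      moreover have "insert S {f\<in>E. f \<subseteq> U} \<subseteq> {f\<in>E. f \<subseteq> U \<union> S}" using S by auto
      ultimately obtain f where f: "f \<in> E" "f \<subseteq> U \<union> S" "f \<noteq> S" "\<not> f \<subseteq> U" by auto
      have fS: "S \<inter> f \<noteq> {}" using f by blast
      have fU: "f \<inter> U \<noteq> {}"
      proof
        assume "f \<inter> U = {}"
        then have "f \<subseteq> S" using f by blast
        then have "f = S" using card_subset_eq[OF finS] edge[OF f(1)] edge[OF S(1)] by simp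
        then show False using f by simp
      qed
      \<comment> \<open>A witness \<open>f\<close> is split between \<open>U\<close> and
        \<open>S\<close>, and having at least three vertices it has two on one side.\<close>
      have "card ((f \<inter> U) \<union> (S \<inter> f)) = card (f \<inter> U) + card (S \<inter> f)"
        using U finS True by (intro card_Un_disjoint) auto
      moreover have "(f \<inter> U) \<union> (S \<inter> f) = f" using f by auto
      ultimately have "3 \<le> card (f \<inter> U) + card (S \<inter> f)" using edge[OF f(1)] k3 by simp
      then have "2 \<le> card (f \<inter> U) \<or> 2 \<le> card (S \<inter> f)" by linarith
      then show ?thesis using S f fS fU by blast
    qed
  qed
  have fin: "finite ?F2" "finite {f\<in>E. f \<inter> U \<noteq> {}}" using finE by auto
  have "card {S\<in>E. \<not> (S \<inter> U = {} \<and> fresh U S)} \<le> card (?B1 \<union> ?B2 \<union> ?B3)"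
    by (rule card_mono[OF _ sub]) (use finE in auto)
  also have "\<dots> \<le> card ?B1 + card ?B2 + card ?B3"
    using card_Un_le[of "?B1 \<union> ?B2" ?B3] card_Un_le[of ?B1 ?B2] by linarith
  finally have 0: "real (card {S\<in>E. \<not> (S \<inter> U = {} \<and> fresh U S)})
      \<le> real (card ?B1) + real (card ?B2) + real (card ?B3)" by linarith
  have 1: "real (card ?B1) \<le> u * (D * N)" unfolding u_def N_def by (rule card_touching_le[OF U])
  have "real (card ?B2) \<le> (\<Sum>f\<in>?F2. real (card {S\<in>E. S \<inter> f \<noteq> {}}))"
    by (rule of_nat_le_sum, rule card_UN_le[OF fin(1)])
  also have "\<dots> \<le> (\<Sum>f\<in>?F2. real k * (D * N))"
  proof (rule sum_mono)
    fix f assume "f \<in> ?F2"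
    then have f: "f \<in> E" by simp
    show "real (card {S\<in>E. S \<inter> f \<noteq> {}}) \<le> real k * (D * N)"
      using card_touching_le[OF fin_edge[OF f]] edge[OF f] unfolding N_def by simp
  qed
  also have "\<dots> = real (card ?F2) * (real k * (D * N))" by simp
  also have "\<dots> \<le> u\<^sup>2 * D * (real k * (D * N))"
    using card_touching_twice_le[OF U] D1 unfolding u_def N_def by (intro mult_right_mono) auto
  finally have 2: "real (card ?B2) \<le> u\<^sup>2 * D * (real k * (D * N))" .
  have "real (card ?B3) \<le> (\<Sum>f | f \<in> E \<and> f \<inter> U \<noteq> {}. real (card {S\<in>E. S \<inter> f \<noteq> {} \<and> 2 \<le> card (S \<inter> f)}))"
    by (rule of_nat_le_sum, rule card_UN_le[OF fin(2)])
  also have "\<dots> \<le> (\<Sum>f | f \<in> E \<and> f \<inter> U \<noteq> {}. (real k)\<^sup>2 * D)"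
  proof (rule sum_mono)
    fix f assume "f \<in> {f. f \<in> E \<and> f \<inter> U \<noteq> {}}"
    then have f: "f \<in> E" by simp
    show "real (card {S\<in>E. S \<inter> f \<noteq> {} \<and> 2 \<le> card (S \<inter> f)}) \<le> (real k)\<^sup>2 * D"
      using card_touching_twice_le[OF fin_edge[OF f]] edge[OF f] by simp
  qed
  also have "\<dots> = real (card {f\<in>E. f \<inter> U \<noteq> {}}) * ((real k)\<^sup>2 * D)" by simp
  also have "\<dots> \<le> u * (D * N) * ((real k)\<^sup>2 * D)" using 1 D1 by (intro mult_right_mono) auto
  finally have 3: "real (card ?B3) \<le> u * (D * N) * ((real k)\<^sup>2 * D)" .
  show ?thesis using 0 1 2 3 by linarith
qed

lemma card_fresh_ge:
  assumes U: "finite U" "card U = i * k" "i < j"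
  shows "real (card E) - 3 * (real j)\<^sup>2 * real k ^ 3 * D ^ 3 * real n
    \<le> real (card {S. S \<in> E \<and> S \<inter> U = {} \<and> fresh U S})"
proof -
  let ?G = "{S. S \<in> E \<and> S \<inter> U = {} \<and> fresh U S}"
  let ?H = "{S\<in>E. \<not> (S \<inter> U = {} \<and> fresh U S)}"
  define X where "X = (real j)\<^sup>2 * real k ^ 3 * D ^ 3 * real n"
  define u where "u = real (card U)"
  have j1: "1 \<le> real j" using U by simp
  have k1: "1 \<le> real k" using k3 by simp
  have u: "0 \<le> u" "u \<le> real j * real k"
    unfolding u_def using U by (auto intro!: mult_right_mono)
  have N: "D * real (card V) \<le> D * (D * real n)" using V_le D1 by (intro mult_left_mono) auto
  have D_up: "D\<^sup>2 \<le> D ^ 3" "1 \<le> D" using D1 by (auto intro: power_increasing)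
  have k_up: "real k \<le> real k ^ 3" "(real k)\<^sup>2 \<le> real k ^ 3"
    using k1 power_increasing[of 1 3 "real k"] power_increasing[of 2 3 "real k"] by auto
  have j_up: "real j \<le> (real j)\<^sup>2" using j1 power_increasing[of 1 2 "real j"] by simp
  have n0: "0 \<le> real n" by simp
  have 1: "u * (D * real (card V)) \<le> X"
  proof -
    have "u * (D * real (card V)) \<le> (real j * real k) * (D * (D * real n))"
      using u N D1 by (intro mult_mono) auto
    also have "\<dots> = (real j * real k * D\<^sup>2) * real n" by (simp add: power2_eq_square)
    also have "\<dots> \<le> ((real j)\<^sup>2 * real k ^ 3 * D ^ 3) * real n"
      using j_up k_up D_up D1 by (intro mult_right_mono mult_mono) auto
    finally show ?thesis unfolding X_def .
  qed
  have 2: "u\<^sup>2 * D * (real k * (D * real (card V))) \<le> X"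
  proof -
    have "u\<^sup>2 * D * (real k * (D * real (card V))) \<le> (real j * real k)\<^sup>2 * D * (real k * (D * (D * real n)))"
      using u N D1 by (intro mult_mono power_mono mult_left_mono) auto
    also have "\<dots> = X" unfolding X_def by (simp add: power2_eq_square power3_eq_cube)
    finally show ?thesis .
  qed
  have 3: "u * (D * real (card V)) * ((real k)\<^sup>2 * D) \<le> X"
  proof -
    have "u * (D * real (card V)) * ((real k)\<^sup>2 * D) \<le> (real j * real k) * (D * (D * real n)) * ((real k)\<^sup>2 * D)"
      using u N D1 by (intro mult_right_mono mult_mono) auto
    also have "\<dots> = real j * (real k ^ 3 * D ^ 3 * real n)" by (simp add: power2_eq_square power3_eq_cube)
    also have "\<dots> \<le> (real j)\<^sup>2 * (real k ^ 3 * D ^ 3 * real n)"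
      using j_up D1 by (intro mult_right_mono) auto
    finally show ?thesis unfolding X_def by (simp add: mult_ac)
  qed
  have "card E = card ?G + card ?H"
    using finE by (subst card_Un_disjoint[symmetric]) (auto intro!: arg_cong[where f=card])
  then have "real (card E) = real (card ?G) + real (card ?H)" by simp
  moreover have "real (card ?H) \<le> 3 * X"
    using card_not_fresh_le[OF U(1)] 1 2 3 unfolding u_def by linarith
  ultimately show ?thesis unfolding X_def by simp
qed

text \<open>An edge with one vertex in \<open>U\<close> still needs \<open>k - 1\<close> random
  vertices; one with more still needs at least one, not being contained in \<open>U\<close>.\<close>

lemma rexp_new_edges_le:
  assumes p: "0 \<le> p" "p \<le> 1" and U: "finite U"
  shows "rexp V p (\<lambda>A. \<Sum>f | f \<in> E \<and> f \<inter> U \<noteq> {} \<and> \<not> f \<subseteq> U. of_bool (f - U \<subseteq> A))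
    \<le> real (card U) * (D * real (card V)) * p ^ (k - 1) + (real (card U))\<^sup>2 * D * p"
proof -
  let ?F = "{f. f \<in> E \<and> f \<inter> U \<noteq> {} \<and> \<not> f \<subseteq> U}"
  have "rexp V p (\<lambda>A. \<Sum>f\<in>?F. of_bool (f - U \<subseteq> A)) = (\<Sum>f\<in>?F. p ^ card (f - U))"
    unfolding rexp_sum using edge finV by (intro sum.cong refl rexp_subset) auto
  also have "\<dots> = (\<Sum>f\<in>?F. if f \<subseteq> U then 0 else p ^ card (f - U))" by (intro sum.cong) auto
  also have "\<dots> \<le> (\<Sum>f | f \<in> E \<and> f \<inter> U \<noteq> {}. if f \<subseteq> U then 0 else p ^ card (f - U))"
    using finE p by (intro sum_mono2) auto
  also have "\<dots> \<le> real (card U) * (D * real (card V)) * p ^ (k - 1) + (real (card U))\<^sup>2 * D * p"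
  proof (rule sum_touching_le[OF U])
    fix f assume f: "f \<in> E" "f \<inter> U \<noteq> {}" "card (f \<inter> U) = 1"
    have "card (f - U) = k - 1"
      using card_Diff_subset_Int[of f U] f fin_edge[OF f(1)] edge[OF f(1)] by simp
    then show "(if f \<subseteq> U then 0 else p ^ card (f - U)) \<le> p ^ (k - 1)" using p by simp
  next
    fix f assume f: "f \<in> E"
    show "(if f \<subseteq> U then 0 else p ^ card (f - U)) \<le> p"
    proof (cases "f \<subseteq> U")
      case False
      then have "1 \<le> card (f - U)" using fin_edge[OF f] by (simp add: Suc_le_eq card_gt_0_iff)
      then have "p ^ card (f - U) \<le> p ^ 1" using p by (intro power_decreasing) auto
      then show ?thesis using False by simp
    qed (use p in simp)
  qed (use p in auto)
  finally show ?thesis .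
qed

lemma Xc_planted_le:
  assumes "finite U"
  shows "Xc (A \<union> U) \<le> Xc A + Xc U + (\<Sum>f | f \<in> E \<and> f \<inter> U \<noteq> {} \<and> \<not> f \<subseteq> U. of_bool (f - U \<subseteq> A))"
proof -
  let ?F = "{f. f \<in> E \<and> f \<inter> U \<noteq> {} \<and> \<not> f \<subseteq> U}"
  have "card {f\<in>E. f \<subseteq> A \<union> U} \<le> card ({f\<in>E. f \<subseteq> A} \<union> {f\<in>E. f \<subseteq> U} \<union> {f\<in>?F. f - U \<subseteq> A})"
    by (rule card_mono) (use finE in auto)
  also have "\<dots> \<le> card {f\<in>E. f \<subseteq> A} + card {f\<in>E. f \<subseteq> U} + card {f\<in>?F. f - U \<subseteq> A}"
    using card_Un_le[of "{f\<in>E. f \<subseteq> A} \<union> {f\<in>E. f \<subseteq> U}" "{f\<in>?F. f - U \<subseteq> A}"]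
      card_Un_le[of "{f\<in>E. f \<subseteq> A}" "{f\<in>E. f \<subseteq> U}"] by linarith
  finally have "Xc (A \<union> U) \<le> Xc A + Xc U + real (card {f\<in>?F. f - U \<subseteq> A})" unfolding Xc_def by linarith
  also have "real (card {f\<in>?F. f - U \<subseteq> A}) = (\<Sum>f\<in>?F. of_bool (f - U \<subseteq> A))"
    using finE by (simp add: Int_def)
  finally show ?thesis .
qed

text \<open>Three bad events have probability at most 1/8 each: \<open>Xc A\<close> far from its
  mean, half of the planted edges present already, too many edges completed by the planting. The
  upper end of the window matters because the tuple count is later divided by a power of it.
  \<open>H\<close> controls the edges completed through two or more planted vertices, of order j^2 p
  in expectation.\<close>

lemma rprob_planted_window:
  assumes p: "0 < p" "p \<le> 1/16" and q: "real n * p ^ (k - 1) \<le> 1"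
    and t: "1/2 \<le> t" "mu p \<le> t\<^sup>2" and H: "t * p \<le> H"
    and K: "K = 4 * real k * D" and M: "M = 2 * K + 4"
    and C: "C = real k * D\<^sup>2 + (real k)\<^sup>2 * D * (M * H)"
    and j: "2 * (K + 1) * t \<le> real j" "real j \<le> M * t" "1 \<le> j"
    and U: "finite U" "card U = j * k" "card {f\<in>E. f \<subseteq> U} = j"
  shows "1/2 \<le> rprob V p (\<lambda>A. mu p + t \<le> Xc (A \<union> U) \<and> Xc (A \<union> U) \<le> mu p + (K + M + 8 * C * M) * t)"
proof -
  have p1: "0 \<le> p" "p \<le> 1" using p by auto
  have t0: "0 < t" using t by simp
  have K0: "0 < K" unfolding K using k3 D1 by simp
  have M0: "0 < M" unfolding M using K0 by simp
  have H0: "0 \<le> H" using H t0 p by (meson less_imp_le mult_nonneg_nonneg order_trans)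
  have C0: "0 < C" unfolding C using k3 D1 M0 H0 by (intro add_pos_nonneg) auto
  have j0: "0 < real j" using j by simp
  have XU: "Xc U = real j" unfolding Xc_def U(3) ..
  let ?Z = "\<lambda>A. \<Sum>f | f \<in> E \<and> f \<inter> U \<noteq> {} \<and> \<not> f \<subseteq> U. of_bool (f - U \<subseteq> A) :: real"
  let ?P1 = "\<lambda>A. K * t \<le> \<bar>Xc A - mu p\<bar>"
  let ?P2 = "\<lambda>A. real j / 2 \<le> Xc (A \<inter> U)"
  let ?P3 = "\<lambda>A. 8 * C * real j \<le> ?Z A"
  have 1: "rprob V p ?P1 \<le> 1/8"
  proof -
    have "va p \<le> (real k)\<^sup>2 * D\<^sup>2 * Lam p" using p1 by (rule va_le_Lam)
    also have "\<dots> \<le> (real k)\<^sup>2 * D\<^sup>2 * (2 * t\<^sup>2)"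
    proof (rule mult_left_mono)
      have "Lam p \<le> mu p * 2" unfolding Lam_def using q mu_nonneg[of p] p1 by (intro mult_left_mono) auto
      then show "Lam p \<le> 2 * t\<^sup>2" using t by linarith
    qed auto
    finally have v: "va p \<le> (K * t)\<^sup>2 / 8" unfolding K by (simp add: power_mult_distrib mult_ac)
    have "rprob V p ?P1 \<le> va p / (K * t)\<^sup>2" using p1 K0 t0 by (intro chebyshev) auto
    also have "\<dots> \<le> (K * t)\<^sup>2 / 8 / (K * t)\<^sup>2" using v by (intro divide_right_mono) auto
    also have "\<dots> = 1/8" using K0 t0 by simp
    finally show ?thesis .
  qed
  have 2: "rprob V p ?P2 \<le> 1/8"
  proof -
    have "rprob V p ?P2 \<le> rexp V p (\<lambda>A. Xc (A \<inter> U)) / (real j / 2)"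
      using p1 j0 Xc_nonneg by (intro rprob_markov) auto
    also have "\<dots> = 2 * p ^ k" unfolding rexp_Xc_inter XU using j0 by simp
    also have "\<dots> \<le> 2 * p ^ 1" using p1 k3 by (intro mult_left_mono power_decreasing) auto
    also have "\<dots> \<le> 1/8" using p by simp
    finally show ?thesis .
  qed
  have 3: "rprob V p ?P3 \<le> 1/8"
  proof -
    have "rprob V p ?P3 \<le> rexp V p ?Z / (8 * C * real j)"
      using p1 C0 j0 by (intro rprob_markov) (auto intro!: sum_nonneg)
    also have "\<dots> \<le> (C * real j) / (8 * C * real j)"
    proof (rule divide_right_mono)
      have "rexp V p ?Z \<le> real (card U) * (D * real (card V)) * p ^ (k - 1) + (real (card U))\<^sup>2 * D * p"
        by (rule rexp_new_edges_le[OF p1 U(1)])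
      also have "real (card U) * (D * real (card V)) * p ^ (k - 1) \<le> real j * real k * (D * (D * real n)) * p ^ (k - 1)"
        unfolding U(2) using V_le D1 p1 by (intro mult_right_mono mult_mono) auto
      also have "\<dots> = real j * (real k * D\<^sup>2) * (real n * p ^ (k - 1))" by (simp add: power2_eq_square)
      also have "\<dots> \<le> real j * (real k * D\<^sup>2) * 1" using q by (intro mult_left_mono) auto
      also have "(real (card U))\<^sup>2 * D * p = real j * ((real k)\<^sup>2 * D * (real j * p))"
        unfolding U(2) by (simp add: power2_eq_square)
      also have "\<dots> \<le> real j * ((real k)\<^sup>2 * D * (M * H))"
      proof (intro mult_left_mono)
        have "real j * p \<le> M * t * p" using j p1 by (intro mult_right_mono) auto
        also have "\<dots> \<le> M * H" using H M0 by (simp add: mult.assoc)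
        finally show "real j * p \<le> M * H" .
      qed (use D1 in auto)
      finally show "rexp V p ?Z \<le> C * real j" unfolding C by (simp add: algebra_simps)
    qed (use C0 j0 in auto)
    also have "\<dots> = 1/8" using C0 j0 by simp
    finally show ?thesis .
  qed
  have "1 - 3 * (1/8) \<le> rprob V p (\<lambda>A. \<not> (?P1 A \<or> ?P2 A \<or> ?P3 A))"
  proof -
    have "rprob V p (\<lambda>A. ?P1 A \<or> ?P2 A \<or> ?P3 A) \<le> rprob V p ?P1 + (rprob V p ?P2 + rprob V p ?P3)"
      using rprob_union[OF p1, of V ?P1 "\<lambda>A. ?P2 A \<or> ?P3 A"] rprob_union[OF p1, of V ?P2 ?P3] by linarith
    then show ?thesis unfolding rprob_compl[OF finV] using 1 2 3 by linarith
  qed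
  also have "\<dots> \<le> rprob V p (\<lambda>A. mu p + t \<le> Xc (A \<union> U) \<and> Xc (A \<union> U) \<le> mu p + (K + M + 8 * C * M) * t)"
  proof (rule rprob_mono[OF p1])
    fix A assume A: "\<not> (?P1 A \<or> ?P2 A \<or> ?P3 A)"
    have eq: "(K + 1) * t = K * t + t" "(K + M + 8 * C * M) * t = K * t + M * t + 8 * C * (M * t)"
      by (simp_all add: algebra_simps)
    have jj: "(K + 1) * t \<le> real j / 2" using j(1) by (simp add: algebra_simps)
    have "mu p + t \<le> Xc (A \<union> U)"
      using Xc_planted_ge[of A U] A jj unfolding XU eq by linarith
    moreover have "8 * C * real j \<le> 8 * C * (M * t)" using j C0 by (intro mult_left_mono) auto
    ultimately show "mu p + t \<le> Xc (A \<union> U) \<and> Xc (A \<union> U) \<le> mu p + (K + M + 8 * C * M) * t"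
      using Xc_planted_le[OF U(1), of A] A j(2) unfolding XU eq by linarith
  qed
  finally show ?thesis by simp
qed

text \<open>The expected number of tuples of \<open>j\<close> fresh edges, counted on the window
  only, is at least \<open>(z * p ^ k) ^ j / 2\<close>, while each outcome in the window has at most
  \<open>(mu p + L * t) ^ j\<close> of them. The quotient is (mu / (mu + L t))^j up to a constant,
  and as j = O(t) its negative logarithm is at most of order phi(t/mu) mu.\<close>

lemma planting_lower:
  assumes p: "0 < p" "p \<le> 1/16" and q: "real n * p ^ (k - 1) \<le> 1"
    and t: "1/2 \<le> t" "mu p \<le> t\<^sup>2" and H: "t * p \<le> H"
    and K: "K = 4 * real k * D" and M: "M = 2 * K + 4"
    and C: "C = real k * D\<^sup>2 + (real k)\<^sup>2 * D * (M * H)"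
    and big: "6 * real k ^ 3 * D ^ 3 * (M * t) ^ 3 \<le> a * real n"
    and L: "K + M + 8 * C * M \<le> real L"
  shows "1/4 * exp (- (4 * M * real L) * (phi (t / mu p) * (mu p)\<^sup>2 / Lam p))
    \<le> rprob V p (\<lambda>A. mu p + t \<le> Xc A)"
proof -
  have p1: "0 \<le> p" "p \<le> 1" using p by auto
  have t0: "0 < t" using t by simp
  have \<mu>: "0 < mu p" using mu_pos p by simp
  have K0: "0 < K" unfolding K using k3 D1 by simp
  have M4: "4 \<le> M" unfolding M using K0 by simp
  have H0: "0 \<le> H" using H t0 p by (meson less_imp_le mult_nonneg_nonneg order_trans)
  have C0: "0 < C" unfolding C using k3 D1 M4 H0 by (intro add_pos_nonneg) auto
  have L1: "1 \<le> L"
  proof -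
    have "0 < 8 * C * M" using C0 M4 by simp
    then have "1 \<le> real L" using L K0 M4 by linarith
    then show ?thesis by simp
  qed
  \<comment> \<open>Half of the planted edges may be present already and \<open>Xc A\<close> may
    fall short by \<open>K * t\<close>, so \<open>2 * (K + 1) * t\<close> of them guarantee a gain
    of \<open>t\<close>. Rounding up costs at most \<open>2 * t\<close> because
    \<open>t \<ge> 1/2\<close>.\<close>
  define j where "j = nat \<lceil>2 * (K + 1) * t\<rceil>"
  have Kt: "0 < 2 * (K + 1) * t" using K0 t0 by simp
  have j1: "2 * (K + 1) * t \<le> real j" unfolding j_def by linarith
  have j2: "real j \<le> M * t"
  proof -
    have "real j \<le> 2 * (K + 1) * t + 1" unfolding j_def using Kt by linarith
    also have "\<dots> \<le> 2 * (K + 1) * t + 2 * t" using t by simp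
    also have "\<dots> = M * t" unfolding M by (simp add: algebra_simps)
    finally show ?thesis .
  qed
  have j3: "1 \<le> j" using j1 Kt by linarith
  let ?G = "\<lambda>A. mu p + t \<le> Xc A \<and> Xc A \<le> mu p + (K + M + 8 * C * M) * t"
  define R where "R i U \<longleftrightarrow> finite U \<and> card U = i * k \<and> card {f\<in>E. f \<subseteq> U} = i" for i :: nat and U :: "'a set"
  define z where "z = real (card E) - 3 * (real j)\<^sup>2 * real k ^ 3 * D ^ 3 * real n"
  have z_ge: "real (card E) * (1 - 1 / (2 * real j)) \<le> z" "0 \<le> z"
  proof -
    have "6 * real k ^ 3 * D ^ 3 * real j ^ 3 \<le> 6 * real k ^ 3 * D ^ 3 * (M * t) ^ 3"
      using j2 D1 by (intro mult_left_mono power_mono) auto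
    also have "\<dots> \<le> a * real n" by (rule big)
    finally have "(6 * real k ^ 3 * D ^ 3 * real j ^ 3) * real n \<le> a * real n * real n"
      by (intro mult_right_mono) auto
    also have "\<dots> \<le> real (card E)" using E_ge by (simp add: power2_eq_square mult.assoc)
    finally have "(3 * (real j)\<^sup>2 * real k ^ 3 * D ^ 3 * real n) * (2 * real j) \<le> real (card E)"
      by (simp add: power2_eq_square power3_eq_cube mult_ac)
    then have "3 * (real j)\<^sup>2 * real k ^ 3 * D ^ 3 * real n \<le> real (card E) / (2 * real j)"
      using j3 by (simp add: pos_le_divide_eq)
    then show 1: "real (card E) * (1 - 1 / (2 * real j)) \<le> z" unfolding z_def by (simp add: algebra_simps)
    have "1 / (2 * real j) \<le> 1" using j3 by simp
    then have "0 \<le> real (card E) * (1 - 1 / (2 * real j))" by simp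
    then show "0 \<le> z" using 1 by linarith
  qed
  have main: "(z * p ^ k) ^ j * (1/2) \<le> rexp V p (\<lambda>A. of_bool (?G (A \<union> {})) * dcount fresh E j {} A)"
  proof (rule rexp_dcount_ge[where R=R and i=0 and j=j and g="\<lambda>A. of_bool (?G A)", OF finV finE edge])
    fix i U S assume "R i U" "i < j" "S \<in> E" "S \<inter> U = {}" "fresh U S"
    then have S: "finite U" "card U = i * k" "card {f\<in>E. f \<subseteq> U} = i" "S \<in> E" "S \<inter> U = {}" "fresh U S"
      unfolding R_def by auto
    have "card (U \<union> S) = card U + card S"
      using S fin_edge[OF S(4)] by (intro card_Un_disjoint) auto
    then show "R (Suc i) (U \<union> S)"
      using S fin_edge[OF S(4)] edge[OF S(4)] unfolding R_def fresh_def by simp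
  next
    fix i U assume "R i U" "i < j"
    then show "z \<le> real (card {S. S \<in> E \<and> S \<inter> U = {} \<and> fresh U S})"
      unfolding z_def R_def by (intro card_fresh_ge) auto
  next
    fix U assume "R j U"
    then have U: "finite U" "card U = j * k" "card {f\<in>E. f \<subseteq> U} = j" unfolding R_def by auto
    show "1/2 \<le> rexp V p (\<lambda>A. of_bool (?G (A \<union> U)))"
      using rprob_planted_window[OF p q t H K M C j1 j2 j3 U] unfolding rprob_def .
  next
    have "{f\<in>E. f \<subseteq> {}} = {}" using edge k3 by fastforce
    then show "R 0 {}" unfolding R_def by simp
  qed (use p z_ge in auto)
  let ?x = "mu p + real L * t"
  have x0: "0 < ?x" using \<mu> t0 by (simp add: add_pos_nonneg)
  have "rexp V p (\<lambda>A. of_bool (?G (A \<union> {})) * dcount fresh E j {} A)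
      \<le> rexp V p (\<lambda>A. ?x ^ j * of_bool (mu p + t \<le> Xc A))"
  proof (rule rexp_mono[OF p1])
    fix A
    show "of_bool (?G (A \<union> {})) * dcount fresh E j {} A \<le> ?x ^ j * of_bool (mu p + t \<le> Xc A)"
    proof (cases "?G A")
      case True
      have "dcount fresh E j {} A \<le> Xc A ^ j"
        using dcount_le_power[OF finE] unfolding Xc_def by simp
      also have "\<dots> \<le> ?x ^ j"
      proof (rule power_mono)
        have "(K + M + 8 * C * M) * t \<le> real L * t" using L t0 by (intro mult_right_mono) auto
        then show "Xc A \<le> ?x" using True by linarith
      qed (rule Xc_nonneg)
      finally show ?thesis using True by simp
    next
      case False
      have "0 \<le> ?x ^ j" using x0 by simp
      then show ?thesis using False by auto
    qed
  qed
  also have "\<dots> = ?x ^ j * rprob V p (\<lambda>A. mu p + t \<le> Xc A)" unfolding rexp_cmult rprob_def ..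
  finally have up: "(z * p ^ k) ^ j * (1/2) \<le> ?x ^ j * rprob V p (\<lambda>A. mu p + t \<le> Xc A)"
    using main by linarith
  have low: "mu p ^ j * (1/2) \<le> (z * p ^ k) ^ j"
  proof -
    have "1/2 \<le> (1 - 1 / (2 * real j)) ^ j"
      using Bernoulli_inequality[of "- 1 / (2 * real j)" j] j3 by (simp add: field_simps)
    then have "mu p ^ j * (1/2) \<le> mu p ^ j * (1 - 1 / (2 * real j)) ^ j"
      using \<mu> by (intro mult_left_mono) auto
    also have "\<dots> = (real (card E) * (1 - 1 / (2 * real j)) * p ^ k) ^ j"
      unfolding mu_def power_mult_distrib[symmetric] by (simp add: mult_ac)
    also have "\<dots> \<le> (z * p ^ k) ^ j"
    proof (intro power_mono mult_right_mono)
      have "1 / (2 * real j) \<le> 1" using j3 by simp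
      then show "0 \<le> real (card E) * (1 - 1 / (2 * real j)) * p ^ k" using p1 by simp
    qed (use z_ge p1 in auto)
    finally show ?thesis .
  qed
  have "1/4 * (mu p / ?x) ^ j \<le> rprob V p (\<lambda>A. mu p + t \<le> Xc A)"
  proof -
    have "mu p ^ j * (1/4) \<le> ?x ^ j * rprob V p (\<lambda>A. mu p + t \<le> Xc A)" using up low by linarith
    then show ?thesis using x0 by (simp add: power_divide pos_divide_le_eq mult_ac)
  qed
  moreover have "exp (- (4 * M * real L) * (phi (t / mu p) * (mu p)\<^sup>2 / Lam p)) \<le> (mu p / ?x) ^ j"
  proof -
    define y where "y = t / mu p"
    have y0: "0 < y" unfolding y_def using t0 \<mu> by simp
    have "?x = mu p * (1 + real L * y)" unfolding y_def using \<mu> by (simp add: distrib_left)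
    then have "mu p / ?x = inverse (1 + real L * y)" using \<mu> by (simp add: inverse_eq_divide)
    also have "\<dots> = exp (- ln (1 + real L * y))" using y0 by (simp add: exp_minus add_pos_nonneg)
    finally have e: "(mu p / ?x) ^ j = exp (- (real j * ln (1 + real L * y)))"
      by (simp add: exp_of_nat_mult[symmetric])
    \<comment> \<open>That \<open>L\<close> is a natural number lets Bernoulli's inequality move it
      out of the logarithm.\<close>
    have "real j * ln (1 + real L * y) \<le> (M * t) * (real L * ln (1 + y))"
      using j2 ln_one_plus_mult_le[OF less_imp_le[OF y0] L1] y0 t0 M4
      by (intro mult_mono) (auto intro!: ln_ge_zero)
    also have "\<dots> = M * real L * mu p * (y * ln (1 + y))" unfolding y_def using \<mu> by simp
    also have "\<dots> \<le> M * real L * mu p * (2 * phi y)"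
      using phi_ge_ln[of y] y0 M4 \<mu> by (intro mult_left_mono) auto
    also have "\<dots> \<le> (4 * M * real L) * (phi y * (mu p)\<^sup>2 / Lam p)"
    proof -
      have "Lam p \<le> mu p * 2" unfolding Lam_def using q \<mu> by (intro mult_left_mono) auto
      then have "phi y * (mu p)\<^sup>2 / (mu p * 2) \<le> phi y * (mu p)\<^sup>2 / Lam p"
        using Lam_pos[OF p(1)] \<mu> phi_pos[OF y0] by (intro divide_left_mono) auto
      then have "phi y * mu p / 2 \<le> phi y * (mu p)\<^sup>2 / Lam p" using \<mu> by (simp add: power2_eq_square)
      then have "(4 * M * real L) * (phi y * mu p / 2) \<le> (4 * M * real L) * (phi y * (mu p)\<^sup>2 / Lam p)"
        using M4 by (intro mult_left_mono) auto
      then show ?thesis by (simp add: mult_ac)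
    qed
    finally show ?thesis unfolding e y_def by simp
  qed
  ultimately show ?thesis by linarith
qed

end

section \<open>Lower bounds in the different density ranges\<close>

lemma lower_combine:
  fixes A B P d C C1 C2 :: real
  assumes "0 \<le> A" "0 \<le> B" "0 \<le> d" "d * exp (- (C1 * A)) \<le> P" "d * exp (- (C2 * B)) \<le> P" "C1 \<le> C" "C2 \<le> C"
  shows "d * exp (- (C * min A B)) \<le> P"
proof (cases "A \<le> B")
  case True
  have "C1 * A \<le> C * A" using assms by (intro mult_right_mono) auto
  then have "d * exp (- (C * A)) \<le> d * exp (- (C1 * A))" using assms by (intro mult_left_mono) auto
  then show ?thesis using True assms by simp
next
  case False
  have "C2 * B \<le> C * B" using assms by (intro mult_right_mono) auto
  then have "d * exp (- (C * B)) \<le> d * exp (- (C2 * B))" using assms by (intro mult_left_mono) auto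
  then show ?thesis using False assms by simp
qed

text \<open>If the first exponent dominates a multiple of the second, their minimum is the second up
  to a constant, and the bound for the second alone suffices.\<close>

lemma lower_combine_dominated:
  fixes A B P d c C C2 :: real
  assumes "0 \<le> A" "0 \<le> B" "0 \<le> d" "0 < c" "c * B \<le> A" "0 \<le> C2"
    "d * exp (- (C2 * B)) \<le> P" "C2 \<le> C" "C2 / c \<le> C"
  shows "d * exp (- (C * min A B)) \<le> P"
proof (rule lower_combine[OF assms(1-3) _ assms(7) assms(9,8)])
  have "C2 * B = C2 / c * (c * B)" using assms by simp
  also have "\<dots> \<le> C2 / c * A" using assms by (intro mult_left_mono) auto
  finally have "d * exp (- (C2 / c * A)) \<le> d * exp (- (C2 * B))" using assms by (intro mult_left_mono) auto
  then show "d * exp (- (C2 / c * A)) \<le> P" using assms by linarith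
qed

lemma ln_inverse_le:
  fixes p :: real
  assumes "0 < p" "p \<le> 1"
  shows "ln (1 / p) \<le> 2 / sqrt p"
proof -
  have "ln (1 / p) \<le> sqrt (1 / p)" using assms by (intro ln_le_sqrt) simp
  also have "\<dots> = 1 / sqrt p" by (simp add: real_sqrt_divide)
  also have "\<dots> \<le> 2 / sqrt p" using assms by (intro divide_right_mono) auto
  finally show ?thesis .
qed

context dense_hypergraph
begin

text \<open>The first entry of the minimum, kept apart because the lower bound pairs it with
  \<open>ln (1 / p)\<close> and the upper bound with \<open>ln (exp 1 / p)\<close>.\<close>

definition rate :: "real \<Rightarrow> real \<Rightarrow> real" where
  "rate p t = phi (t / mu p) * (mu p)\<^sup>2 / Lam p"

lemma rate_nonneg: "0 < p \<Longrightarrow> 0 < t \<Longrightarrow> 0 \<le> rate p t"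
  unfolding rate_def using phi_pos[of "t / mu p"] mu_pos Lam_pos[of p] by (simp add: less_imp_le)

lemma rate_ge:
  assumes "0 < p" "0 < t" "Lam p \<le> b * mu p" "0 < b"
  shows "phi (t / mu p) * mu p / b \<le> rate p t"
proof -
  have \<mu>: "0 < mu p" using mu_pos assms by simp
  have "phi (t / mu p) * mu p / b = phi (t / mu p) * (mu p)\<^sup>2 / (b * mu p)"
    using \<mu> by (simp add: power2_eq_square)
  also have "\<dots> \<le> rate p t" unfolding rate_def
    using assms \<mu> Lam_pos[of p] phi_pos[of "t / mu p"] by (intro divide_left_mono) (auto simp: less_imp_le)
  finally show ?thesis .
qed

section \<open>The range where n p^(k-1) is bounded below\<close>

lemma sqrt_ratio_le:
  assumes "0 < p" "p \<le> 1"
  shows "sqrt (real n * (real n * p ^ (k - 1))) \<le> real n * p"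
proof (rule real_le_lsqrt)
  have "p ^ (k - 1) \<le> p\<^sup>2" using assms k3 by (intro power_decreasing) auto
  then have "(real n)\<^sup>2 * p ^ (k - 1) \<le> (real n)\<^sup>2 * p\<^sup>2" by (intro mult_left_mono) auto
  then show "real n * (real n * p ^ (k - 1)) \<le> (real n * p)\<^sup>2" by (simp add: power2_eq_square mult_ac)
qed (use assms in auto)

lemma mu_ge_ratio:
  assumes "0 < p" "p \<le> 1"
  shows "a * (real n * p) * (real n * p ^ (k - 1)) \<le> mu p"
proof -
  have "p ^ k = p * p ^ (k - 1)" using k3 by (simp add: power_eq_if)
  then show ?thesis using mu_ge[of p] assms by (simp add: power2_eq_square mult_ac)
qed

text \<open>The mean is at least a (n p) q with q = n p^(k-1), and n p \<ge> sqrt (n q) because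
  p^(k-1) \<le> p^2. So a lower bound \<open>g\<close> for q makes the mean at least of order sqrt
  n.\<close>

lemma mu_ge_sqrt:
  assumes p: "0 < p" "p \<le> 1" and g: "0 < g" "g \<le> real n * p ^ (k - 1)"
  shows "a * g powr (3/2) * sqrt (real n) \<le> mu p"
proof -
  let ?q = "real n * p ^ (k - 1)"
  have "sqrt (real n) * sqrt g \<le> sqrt (real n * ?q)"
    unfolding real_sqrt_mult[symmetric] using g by (intro real_sqrt_le_mono mult_left_mono) auto
  also have "\<dots> \<le> real n * p" by (rule sqrt_ratio_le[OF p])
  finally have "sqrt (real n) * sqrt g * g \<le> real n * p * ?q"
    using g p by (intro mult_mono[of "sqrt (real n) * sqrt g" "real n * p" g ?q]) auto
  then have "a * (sqrt (real n) * sqrt g * g) \<le> a * (real n * p * ?q)" using a0 by (intro mult_left_mono) auto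
  moreover have "g powr (3/2) = sqrt g * g"
  proof -
    have "g powr (3/2) = g powr (1/2 + 1)" by simp
    also have "\<dots> = g powr (1/2) * g powr 1" by (rule powr_add)
    finally show ?thesis using g by (simp add: powr_half_sqrt)
  qed
  ultimately show ?thesis using mu_ge_ratio[OF p] by (simp add: mult_ac)
qed

text \<open>For \<open>t \<le> c0 * mu p\<close> tilting gives the rate and the dense set the other
  exponent; \<open>c0\<close> is the largest ratio that \<open>tilt_lower\<close> admits. For larger
  \<open>t\<close>, phi is at least linear and the rate dominates
  \<open>sqrt t * ln (1 / p)\<close>, so the dense set suffices. The constants enter through
  equations to keep their dependence visible.\<close>

lemma lower_dense_regime:
  assumes p: "0 < p" "p \<le> 1 - \<gamma>" and \<gamma>: "0 < \<gamma>" "\<gamma> < 1" and t: "0 < t"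
    and g: "0 < g" "g \<le> real n * p ^ (k - 1)" and c1: "0 < c1" "c1 * Lam p \<le> t\<^sup>2"
    and \<theta>: "2 * (sqrt (4 * ((real k)\<^sup>2 * D\<^sup>2 / c1) / \<gamma>) + 1) / \<gamma> \<le> \<theta>"
    and dense: "dense_at (min (\<theta> * t) (mu p + t))"
    and C1: "C1 = 1 + sqrt (2 * (real k)\<^sup>2 * D\<^sup>2 * 4 ^ k / c1)" and c0: "c0 = \<gamma> / C1"
    and \<tau>: "\<tau> = sqrt (c1 * (a * g powr (3/2)))"
    and CB: "CB = D * (sqrt \<theta> + 1 / sqrt \<tau>)" and CT: "CT = D * C1\<^sup>2 / \<gamma> * (3 * (1 + 1 / g) / a)"
    and c2: "c2 = c0 / (2 + c0) / (1 + 1 / g) * (sqrt (c0 * a) / 2)"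
    and C: "CT \<le> C" "CB \<le> C" "CB / c2 \<le> C"
  shows "\<gamma> / 4 * exp (- (C * min (rate p t) (sqrt t * ln (1 / p)))) \<le> rprob V p (\<lambda>A. mu p + t \<le> Xc A)"
proof -
  define q where "q = real n * p ^ (k - 1)"
  define \<mu> where "\<mu> = mu p"
  define h where "h = 1 + 1 / g"
  have p1: "p \<le> 1" using p \<gamma> by simp
  have \<mu>: "0 < \<mu>" unfolding \<mu>_def using mu_pos p by simp
  have h: "1 < h" unfolding h_def using g by simp
  have q: "0 < q" "g \<le> q" using g unfolding q_def by auto
  have C1_gt: "1 < C1" unfolding C1 using k3 D1 c1 by simp
  have c0': "0 < c0" "c0 \<le> 1" unfolding c0 using \<gamma> C1_gt by (auto simp: divide_le_eq_1)
  have Lam_le: "Lam p \<le> (q * h) * mu p"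
  proof -
    have "1 \<le> q / g" using q g by simp
    then have "1 + q \<le> q * h" unfolding h_def by (simp add: algebra_simps)
    then have "mu p * (1 + q) \<le> mu p * (q * h)" using \<mu> unfolding \<mu>_def by (intro mult_left_mono) auto
    then show ?thesis unfolding Lam_def q_def by (simp add: mult_ac)
  qed
  have qh: "0 < q * h" using q h by simp
  have rate: "phi (t / \<mu>) * \<mu> / (q * h) \<le> rate p t"
    unfolding \<mu>_def by (rule rate_ge[OF p(1) t Lam_le qh])
  have va: "va p \<le> (real k)\<^sup>2 * D\<^sup>2 / c1 * t\<^sup>2"
  proof -
    have "va p \<le> (real k)\<^sup>2 * D\<^sup>2 * Lam p" using p p1 by (intro va_le_Lam) auto
    also have "\<dots> \<le> (real k)\<^sup>2 * D\<^sup>2 * (t\<^sup>2 / c1)"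
      using c1 by (intro mult_left_mono) (auto simp: pos_le_divide_eq mult.commute)
    finally show ?thesis by simp
  qed
  have \<tau>0: "0 < \<tau>" unfolding \<tau> using c1 a0 g by simp
  have \<tau>t: "\<tau> \<le> t"
  proof -
    have "a * g powr (3/2) * 1 \<le> a * g powr (3/2) * sqrt (real n)"
      using a0 g n3 by (intro mult_left_mono) auto
    also have "\<dots> \<le> mu p" by (rule mu_ge_sqrt[OF p(1) p1 g])
    also have "\<dots> \<le> Lam p" using p by (intro Lam_ge_mu) auto
    finally have "c1 * (a * g powr (3/2)) \<le> c1 * Lam p" using c1 by (intro mult_left_mono) auto
    then have "c1 * (a * g powr (3/2)) \<le> t\<^sup>2" using c1 by linarith
    then show ?thesis unfolding \<tau> using t by (intro real_le_lsqrt) auto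
  qed
  have B: "0 < (real k)\<^sup>2 * D\<^sup>2 / c1" using k3 D1 c1 by simp
  have lB: "\<gamma> / 4 * exp (- (CB * (sqrt t * ln (1 / p)))) \<le> rprob V p (\<lambda>A. mu p + t \<le> Xc A)"
    using dense_lower[OF p \<gamma> \<tau>0 \<tau>t B va \<theta> dense] unfolding CB by simp
  have r0: "0 \<le> rate p t" using rate_nonneg p t by simp
  have s0: "0 \<le> sqrt t * ln (1 / p)" using t p p1 by simp
  have CB0: "0 \<le> CB"
  proof -
    have "0 \<le> sqrt (4 * ((real k)\<^sup>2 * D\<^sup>2 / c1) / \<gamma>)"
      using c1 \<gamma> by (intro real_sqrt_ge_zero divide_nonneg_pos mult_nonneg_nonneg) auto
    then have "0 \<le> 2 * (sqrt (4 * ((real k)\<^sup>2 * D\<^sup>2 / c1) / \<gamma>) + 1) / \<gamma>"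
      using \<gamma> by (intro divide_nonneg_pos mult_nonneg_nonneg add_nonneg_nonneg) auto
    then have "0 \<le> \<theta>" using \<theta> by linarith
    then show ?thesis unfolding CB using D1 \<tau>0 by simp
  qed
  show ?thesis
  proof (cases "t \<le> c0 * \<mu>")
    case True
    define x where "x = t / \<mu>"
    have x: "0 < x" "x \<le> 1"
    proof -
      show "0 < x" unfolding x_def using t \<mu> by simp
      have "c0 * \<mu> \<le> 1 * \<mu>" using c0' \<mu> by (intro mult_right_mono) auto
      then have "t \<le> \<mu>" using True by linarith
      then show "x \<le> 1" unfolding x_def using \<mu> by simp
    qed
    have small: "C1 * t \<le> \<gamma> * mu p"
      using True C1_gt unfolding c0 \<mu>_def by (simp add: field_simps)
    have "1/4 * exp (- (D * C1\<^sup>2 / \<gamma> * (real n * p * x\<^sup>2))) \<le> rprob V p (\<lambda>A. mu p + t \<le> Xc A)"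
      unfolding x_def \<mu>_def by (rule tilt_lower[OF p \<gamma> t c1 C1 small])
    moreover have "\<gamma> / 4 * exp (- (CT * rate p t)) \<le> 1/4 * exp (- (D * C1\<^sup>2 / \<gamma> * (real n * p * x\<^sup>2)))"
    proof (rule mult_mono)
      \<comment> \<open>The exponent of the tilt against the rate: n p is at most mu / (a q), and
        phi x \<ge> x^2 / 3 for x \<le> 1.\<close>
      have "real n * p * x\<^sup>2 \<le> 3 * h / a * rate p t"
      proof -
        have "real n * p \<le> \<mu> / (a * q)"
          using mu_ge_ratio[OF p(1) p1] a0 q unfolding q_def[symmetric] \<mu>_def[symmetric]
          by (simp add: pos_le_divide_eq mult_ac)
        then have "real n * p * x\<^sup>2 \<le> \<mu> / (a * q) * x\<^sup>2" by (intro mult_right_mono) auto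
        also have "\<dots> = 3 * h / a * ((x\<^sup>2 / 3) * \<mu> / (q * h))" using h q a0 by (simp add: field_simps)
        also have "\<dots> \<le> 3 * h / a * (phi x * \<mu> / (q * h))"
        proof (intro mult_left_mono divide_right_mono mult_right_mono)
          have "x\<^sup>2 / 3 \<le> x\<^sup>2 / (2 + x)" using x by (intro divide_left_mono) auto
          also have "\<dots> \<le> phi x" using x by (intro phi_ge_square) auto
          finally show "x\<^sup>2 / 3 \<le> phi x" .
        qed (use \<mu> qh h a0 in auto)
        also have "\<dots> \<le> 3 * h / a * rate p t" using rate h a0 unfolding x_def by (intro mult_left_mono) auto
        finally show ?thesis .
      qed
      then have "D * C1\<^sup>2 / \<gamma> * (real n * p * x\<^sup>2) \<le> D * C1\<^sup>2 / \<gamma> * (3 * h / a * rate p t)"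
        using D1 \<gamma> by (intro mult_left_mono) auto
      then show "exp (- (CT * rate p t)) \<le> exp (- (D * C1\<^sup>2 / \<gamma> * (real n * p * x\<^sup>2)))"
        unfolding CT h_def by simp
    qed (use \<gamma> in auto)
    ultimately have lA: "\<gamma> / 4 * exp (- (CT * rate p t)) \<le> rprob V p (\<lambda>A. mu p + t \<le> Xc A)" by linarith
    show ?thesis using \<gamma> by (intro lower_combine[OF r0 s0 _ lA lB C(1,2)]) auto
  next
    case False
    have c2_pos: "0 < c2" unfolding c2 using c0' a0 g by (auto intro!: mult_pos_pos divide_pos_pos add_pos_pos)
    have "c2 * (sqrt t * ln (1 / p)) \<le> rate p t"
    proof -
      define x where "x = t / \<mu>"
      have x: "c0 < x" unfolding x_def using False \<mu> by (simp add: field_simps)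
      have x0: "0 < x" using x c0' by simp
      have "c0 / (2 + c0) \<le> x / (2 + x)" using x c0' by (simp add: field_simps)
      then have "x * (c0 / (2 + c0)) \<le> x * (x / (2 + x))" using x0 by (intro mult_left_mono) auto
      also have "\<dots> \<le> phi x" using phi_ge_square[of x] x0 by (simp add: power2_eq_square)
      finally have "x * (c0 / (2 + c0)) * \<mu> / (q * h) \<le> phi x * \<mu> / (q * h)"
        using \<mu> qh by (intro divide_right_mono mult_right_mono) auto
      also have "\<dots> \<le> rate p t" using rate unfolding x_def .
      finally have 1: "c0 / (2 + c0) / h * (t / q) \<le> rate p t"
        unfolding x_def using \<mu> by (simp add: mult_ac)
      have "sqrt (c0 * a) * q \<le> sqrt t * sqrt p"
      proof -
        \<comment> \<open>Since 2k - 2 \<ge> k + 1, q^2 is at most n^2 p^(k+1), hence at most mu p /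
          a. So sqrt t is at least of order q / sqrt p, and 1 / sqrt p beats
          \<open>ln (1 / p)\<close>.\<close>
        have "c0 * a * q\<^sup>2 \<le> t * p"
        proof -
          have "p ^ (2 * k - 2) \<le> p ^ (k + 1)" using p p1 k3 by (intro power_decreasing) auto
          moreover have "q\<^sup>2 = (real n)\<^sup>2 * p ^ (2 * k - 2)"
          proof -
            have "2 * k - 2 = (k - 1) + (k - 1)" using k3 by simp
            then show ?thesis unfolding q_def by (simp add: power_mult_distrib power_add power2_eq_square)
          qed
          ultimately have "c0 * a * q\<^sup>2 \<le> c0 * a * ((real n)\<^sup>2 * p ^ (k + 1))"
            using c0' a0 by (intro mult_left_mono) (auto intro: mult_left_mono)
          also have "\<dots> = c0 * (a * (real n)\<^sup>2 * p ^ k) * p" by simp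
          also have "\<dots> \<le> c0 * \<mu> * p" unfolding \<mu>_def using mu_ge[of p] c0' p
            by (intro mult_right_mono mult_left_mono) auto
          also have "\<dots> \<le> t * p" using False p by (intro mult_right_mono) auto
          finally show ?thesis .
        qed
        then have "sqrt (c0 * a * q\<^sup>2) \<le> sqrt (t * p)" by (rule real_sqrt_le_mono)
        then show ?thesis using q by (simp add: real_sqrt_mult)
      qed
      then have "sqrt (c0 * a) * q / sqrt p \<le> sqrt t" using p by (simp add: pos_divide_le_eq)
      moreover have "sqrt (c0 * a) * q * (ln (1 / p) / 2) \<le> sqrt (c0 * a) * q * (1 / sqrt p)"
        using ln_inverse_le[OF p(1) p1] c0' a0 q by (intro mult_left_mono) auto
      moreover have "sqrt (c0 * a) * q * (1 / sqrt p) = sqrt (c0 * a) * q / sqrt p"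
        "sqrt (c0 * a) * q * (ln (1 / p) / 2) = sqrt (c0 * a) / 2 * ln (1 / p) * q" by simp_all
      ultimately have "sqrt (c0 * a) / 2 * ln (1 / p) * q \<le> sqrt t" by linarith
      then have "sqrt (c0 * a) / 2 * ln (1 / p) \<le> sqrt t / q" using q by (simp add: pos_le_divide_eq)
      then have "sqrt t * (sqrt (c0 * a) / 2 * ln (1 / p)) \<le> sqrt t * (sqrt t / q)"
        using t by (intro mult_left_mono) auto
      also have "\<dots> = t / q" using t by simp
      finally have "c0 / (2 + c0) / h * (sqrt t * (sqrt (c0 * a) / 2 * ln (1 / p))) \<le> c0 / (2 + c0) / h * (t / q)"
        using c0' h by (intro mult_left_mono) auto
      then show ?thesis using 1 unfolding c2 h_def by (simp add: mult_ac)
    qed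
    then show ?thesis using \<gamma> by (intro lower_combine_dominated[OF r0 s0 _ c2_pos _ CB0 lB C(2,3)]) auto
  qed
qed

text \<open>With \<open>1 - p \<ge> \<gamma>\<close> and n p^(k-1) \<ge> g,
  \<open>va_ge_pairs\<close> bounds the variance below by a multiple of \<open>Lam p\<close>, so
  either square root in the condition serves.\<close>

lemma deviation_of_variance_bound:
  assumes p: "0 < p" "p \<le> 1 - \<gamma>" and \<gamma>: "0 < \<gamma>" "\<gamma> < 1" and t: "0 < t"
    and g: "0 < g" "g \<le> real n * p ^ (k - 1)"
    and c1: "c1 = min 1 (\<gamma> * real k * a / (D * (1 + 1 / g)))"
    and cond: "min (sqrt (va p)) (sqrt (Lam p)) \<le> t"
  shows "c1 * Lam p \<le> t\<^sup>2"
proof -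
  define q where "q = real n * p ^ (k - 1)"
  define h where "h = 1 + 1 / g"
  have p1: "p \<le> 1" using p \<gamma> by simp
  have q: "0 < q" "g \<le> q" using g unfolding q_def by auto
  have h: "1 < h" unfolding h_def using g by simp
  have \<mu>: "0 < mu p" using mu_pos p by simp
  have "c1 * Lam p \<le> va p \<and> c1 * Lam p \<le> Lam p"
  proof
    show "c1 * Lam p \<le> Lam p" unfolding c1 using Lam_pos[of p] p by (simp add: mult_le_cancel_right1)
    have "Lam p \<le> q * h * mu p"
    proof -
      have "1 \<le> q / g" using q g by simp
      then have "1 + q \<le> q * h" unfolding h_def by (simp add: algebra_simps)
      then have "mu p * (1 + q) \<le> mu p * (q * h)" using \<mu> by (intro mult_left_mono) auto
      then show ?thesis unfolding Lam_def q_def by (simp add: mult_ac)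
    qed
    then have "c1 * Lam p \<le> \<gamma> * real k * a / (D * h) * (q * h * mu p)"
      unfolding c1 h_def[symmetric] using \<gamma> a0 D1 h \<mu> q Lam_pos[of p] p by (intro mult_mono) auto
    also have "\<dots> = \<gamma> * (real k * a / D) * (mu p * q)" using h by simp
    also have "\<dots> \<le> va p"
    proof -
      have "a * (real n)\<^sup>2 / (D * real n) \<le> real (card E) / real (card V)"
        using E_ge V_le a0 V_pos by (intro frac_le) auto
      then have e: "a * real n / D \<le> real (card E) / real (card V)"
        using n3 by (simp add: power2_eq_square split: if_splits)
      have pw: "p ^ (2 * k - 1) = p ^ k * p ^ (k - 1)"
        unfolding power_add[symmetric] using k3 by (intro arg_cong[where f="\<lambda>i. p ^ i"]) auto
      have "\<gamma> * (real k * a / D) * (mu p * q)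
          = \<gamma> * (p ^ (2 * k - 1) * (real k * real (card E) * (a * real n / D)))"
        unfolding q_def mu_def pw by simp
      also have "\<dots> \<le> (1 - p) * (p ^ (2 * k - 1) * (real k * real (card E) * (real (card E) / real (card V))))"
        using e p p1 a0 D1 by (intro mult_mono mult_left_mono) auto
      also have "\<dots> = (1 - p) * p ^ (2 * k - 1) * (real k * (real (card E))\<^sup>2 / real (card V))"
        by (simp add: power2_eq_square)
      also have "\<dots> \<le> va p" using p p1 V_ne by (intro va_ge_pairs) auto
      finally show ?thesis .
    qed
    finally show "c1 * Lam p \<le> va p" .
  qed
  moreover have "min (va p) (Lam p) \<le> t\<^sup>2"
  proof -
    have "sqrt (va p) \<le> t \<or> sqrt (Lam p) \<le> t" using cond by auto
    then have "va p \<le> t\<^sup>2 \<or> Lam p \<le> t\<^sup>2" using t by (auto dest: sqrt_le_D)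
    then show ?thesis by auto
  qed
  ultimately show ?thesis by linarith
qed

lemma cluster_condition:
  assumes p: "0 < p" "p \<le> 1/2"
    and cond: "min (va p powr (2/3)) (mu p powr (2/3)) * ln (real n) powr (2/3) \<le> t"
  shows "(mu p / 2) powr (2/3) * ln (real n) powr (2/3) \<le> t"
proof -
  have \<mu>: "0 < mu p" using mu_pos p by simp
  have "p ^ k \<le> p ^ 1" using p k3 by (intro power_decreasing) auto
  then have "1/2 \<le> 1 - p ^ k" using p by simp
  then have "mu p * (1/2) \<le> mu p * (1 - p ^ k)" using \<mu> by (intro mult_left_mono) auto
  then have "mu p / 2 \<le> va p" using va_ge_mu[of p] p by simp
  then have "(mu p / 2) powr (2/3) \<le> min (va p powr (2/3)) (mu p powr (2/3))"
    using \<mu> by (auto intro!: powr_mono2)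
  then have "(mu p / 2) powr (2/3) * ln (real n) powr (2/3)
      \<le> min (va p powr (2/3)) (mu p powr (2/3)) * ln (real n) powr (2/3)"
    by (intro mult_right_mono) auto
  then show ?thesis using cond by linarith
qed

text \<open>The upper bound on \<open>p\<close> limits n p^(k-1) to (ln n)^(k-1), so
  \<open>Lam p\<close> exceeds the mean by at most such a power. The condition makes t^2 at least of
  order mu^(4/3), and mu^(1/3) is at least of order n^(1/6), which absorbs the logarithms.\<close>

lemma deviation_of_cluster_condition:
  assumes p: "0 < p" "p \<le> 1/2" and t: "0 < t"
    and g: "0 < g" "g \<le> real n * p ^ (k - 1)"
    and up: "p \<le> real n powr (- 1 / (real k - 1)) * ln (real n)"
    and cond: "(mu p / 2) powr (2/3) * ln (real n) powr (2/3) \<le> t"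
    and c1: "c1 = (a * g powr (3/2) / 2) powr (1/3) * (1 / (6 * (real k - 1))) ^ (k - 1) / 4"
  shows "c1 * Lam p \<le> t\<^sup>2"
proof -
  define N where "N = real n"
  define l where "l = ln N"
  define q where "q = N * p ^ (k - 1)"
  define \<eta> where "\<eta> = 1 / (6 * (real k - 1))"
  define m where "m = mu p / 2"
  have p1: "p \<le> 1" using p by simp
  have l1: "1 \<le> l" unfolding l_def N_def using n3 by (rule ln_nat_ge_1)
  have N: "3 \<le> N" unfolding N_def using n3 by simp
  have k1: "real (k - 1) = real k - 1" "2 \<le> real k - 1" using k3 by (auto simp: of_nat_diff)
  have \<eta>: "0 < \<eta>" unfolding \<eta>_def using k1 by simp
  have m: "0 < m" unfolding m_def using mu_pos p by simp
  have q: "q \<le> l ^ (k - 1)"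
  proof -
    have "p ^ (k - 1) \<le> (N powr (- 1 / (real k - 1)) * l) ^ (k - 1)"
      using up p unfolding N_def l_def by (intro power_mono) auto
    also have "\<dots> = N powr (-1) * l ^ (k - 1)"
      using N by (simp only: power_mult_distrib powr_root_power)
    finally have "q \<le> N * (N powr (-1) * l ^ (k - 1))" unfolding q_def using N by (intro mult_left_mono) auto
    also have "\<dots> = l ^ (k - 1)" using N by (simp add: powr_minus field_simps)
    finally show ?thesis .
  qed
  have Lam_le: "Lam p \<le> 4 * m * l ^ (k - 1)"
  proof -
    have "1 \<le> l ^ (k - 1)" using l1 by simp
    then have "1 + q \<le> 2 * l ^ (k - 1)" using q by simp
    then have "mu p * (1 + q) \<le> mu p * (2 * l ^ (k - 1))" using m unfolding m_def by (intro mult_left_mono) auto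
    then show ?thesis unfolding Lam_def q_def N_def m_def by simp
  qed
  have lk: "\<eta> ^ (k - 1) * l ^ (k - 1) \<le> N powr (1/6)"
  proof -
    have "\<eta> * l \<le> N powr \<eta>" using ln_le_powr_div[OF \<eta>, of N] N \<eta> unfolding l_def by (simp add: field_simps)
    then have "(\<eta> * l) ^ (k - 1) \<le> (N powr \<eta>) ^ (k - 1)" using \<eta> l1 by (intro power_mono) auto
    also have "\<dots> = (N powr ((1/6) / (real k - 1))) ^ (k - 1)" unfolding \<eta>_def by simp
    also have "\<dots> = N powr (1/6)" using N by (intro powr_root_power) auto
    finally show ?thesis by (simp add: power_mult_distrib)
  qed
  have m13: "(a * g powr (3/2) / 2) powr (1/3) * N powr (1/6) \<le> m powr (1/3)"
  proof -
    have "a * g powr (3/2) / 2 * sqrt N \<le> m" using mu_ge_sqrt[OF p(1) p1 g] unfolding N_def m_def by simp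
    then have "(a * g powr (3/2) / 2 * sqrt N) powr (1/3) \<le> m powr (1/3)"
      using a0 g N by (intro powr_mono2) auto
    moreover have "(a * g powr (3/2) / 2 * sqrt N) powr (1/3) = (a * g powr (3/2) / 2) powr (1/3) * N powr (1/6)"
      using N by (simp only: powr_mult) (simp add: powr_half_sqrt[symmetric] powr_powr)
    ultimately show ?thesis by simp
  qed
  have "c1 * Lam p \<le> c1 * (4 * m * l ^ (k - 1))"
    using Lam_le k1 unfolding c1 by (intro mult_left_mono) auto
  also have "\<dots> = m * ((a * g powr (3/2) / 2) powr (1/3) * (\<eta> ^ (k - 1) * l ^ (k - 1)))"
    unfolding c1 \<eta>_def by simp
  also have "\<dots> \<le> m * ((a * g powr (3/2) / 2) powr (1/3) * N powr (1/6))"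
    using m lk by (intro mult_left_mono) auto
  also have "\<dots> \<le> m * m powr (1/3)" using m m13 by (intro mult_left_mono) auto
  also have "\<dots> = (m powr (2/3))\<^sup>2"
  proof -
    have "m * m powr (1/3) = m powr (1 + 1/3)" using m by (subst powr_add) simp
    also have "\<dots> = (m powr (2/3)) powr 2" unfolding powr_powr by simp
    finally show ?thesis using m by simp
  qed
  also have "\<dots> \<le> t\<^sup>2"
  proof (rule power_mono)
    have "m powr (2/3) * 1 \<le> m powr (2/3) * l powr (2/3)"
      using l1 ge_one_powr_ge_zero[of l "2/3"] by (intro mult_left_mono) auto
    then show "m powr (2/3) \<le> t" using cond unfolding m_def l_def N_def by linarith
  qed auto
  finally show ?thesis .
qed


section \<open>The range where n p^(k-1) is at most 1\<close>

lemma Lam_le_twice: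
  assumes "0 < p" "real n * p ^ (k - 1) \<le> 1"
  shows "Lam p \<le> 2 * mu p"
  using mult_left_mono[of "1 + real n * p ^ (k - 1)" 2 "mu p"] assms mu_nonneg[of p]
  by (simp add: Lam_def mult.commute)

lemma rate_ge_half:
  assumes "0 < p" "0 < t" "real n * p ^ (k - 1) \<le> 1"
  shows "phi (t / mu p) * mu p / 2 \<le> rate p t"
  using rate_ge[OF assms(1,2) Lam_le_twice[OF assms(1,3)]] by simp

lemma rate_ge_linear:
  assumes "0 < p" "0 < t" "real n * p ^ (k - 1) \<le> 1" "mu p \<le> t"
  shows "t / 6 \<le> rate p t"
proof -
  have \<mu>: "0 < mu p" using mu_pos assms by simp
  have "t / 3 = t\<^sup>2 / (3 * t)" using assms by (simp add: power2_eq_square)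
  also have "\<dots> \<le> t\<^sup>2 / (2 * mu p + t)" using assms \<mu> by (intro divide_left_mono) auto
  also have "\<dots> \<le> phi (t / mu p) * mu p" by (rule phi_mu_ge[OF assms(1,2)])
  finally show ?thesis using rate_ge_half[OF assms(1-3)] by linarith
qed

text \<open>The exponent of \<open>n\<close> in n^2 p^k at the threshold p = n^(-2/(k+1/3)). Being
  positive, it makes the mean polynomially large above the threshold; being at most 1/5 for k \<ge>
  3, it keeps the mean small below.\<close>

lemma exponent_identity: "2 + real k * (- 2 / (real k + 1/3)) = 2 / (3 * real k + 1)"
proof -
  have "3 * real k + 1 \<noteq> 0" by (smt (verit) of_nat_0_le_iff)
  moreover have "- 2 / (real k + 1/3) = - 6 / (3 * real k + 1)"
    using calculation by (simp add: field_simps)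
  ultimately show ?thesis by (simp add: field_simps)
qed

text \<open>The condition gives mu ln n = O(t^(3/2)), so for t < mu the rate, at least of order t^2
  / mu, is at least of order sqrt t ln n. For t \<ge> mu the rate is at least \<open>t / 6\<close>,
  and sqrt t is at least of order ln n since mu exceeds a power of n. As ln (1/p) \<le> ln n,
  planting the dense set alone suffices.\<close>

lemma lower_moderate:
  assumes p: "0 < p" "p \<le> 1/2" and t: "0 < t" and q: "real n * p ^ (k - 1) \<le> 1"
    and lo: "real n powr (- 2 / (real k + 1/3)) \<le> p"
    and cond: "(mu p / 2) powr (2/3) * ln (real n) powr (2/3) \<le> t"
    and B: "B = 4 * (real k)\<^sup>2 * D\<^sup>2 / (a / 2) powr (1/3)"
    and \<theta>: "2 * (sqrt (4 * B / (1/2)) + 1) / (1/2) \<le> \<theta>"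
    and dense: "dense_at (min (\<theta> * t) (mu p + t))"
    and CB: "CB = D * (sqrt \<theta> + 1 / sqrt ((a / 2) powr (2/3)))"
    and c: "c = min (1/12) (sqrt a / (6 * (3 * real k + 1)))"
    and C: "CB \<le> C" "CB / c \<le> C"
  shows "1/8 * exp (- (C * min (rate p t) (sqrt t * ln (1 / p)))) \<le> rprob V p (\<lambda>A. mu p + t \<le> Xc A)"
proof -
  define N where "N = real n"
  define l where "l = ln N"
  define s where "s = 2 / (3 * real k + 1)"
  define m where "m = mu p / 2"
  have p1: "p \<le> 1" using p by simp
  have l1: "1 \<le> l" unfolding l_def N_def using n3 by (rule ln_nat_ge_1)
  have N: "3 \<le> N" unfolding N_def using n3 by simp
  have s0: "0 < s" unfolding s_def by (simp add: add_nonneg_pos)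
  have \<mu>: "0 < mu p" using mu_pos p by simp
  have m: "0 < m" unfolding m_def using \<mu> by simp
  have \<mu>N: "a * N powr s \<le> mu p"
  proof -
    have "(N powr (- 2 / (real k + 1/3))) ^ k \<le> p ^ k" using lo unfolding N_def by (intro power_mono) auto
    moreover have "(N powr (- 2 / (real k + 1/3))) ^ k = N powr (real k * (- 2 / (real k + 1/3)))"
      using N k3 by (simp add: powr_power mult.commute)
    ultimately have "N powr 2 * N powr (real k * (- 2 / (real k + 1/3))) \<le> N powr 2 * p ^ k"
      by (intro mult_left_mono) auto
    then have "N powr s \<le> N\<^sup>2 * p ^ k"
      unfolding powr_add[symmetric] exponent_identity s_def[symmetric] using N by simp
    then have "a * N powr s \<le> a * (N\<^sup>2 * p ^ k)" using a0 by (intro mult_left_mono) auto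
    then show ?thesis using mu_ge[of p] p unfolding N_def by simp
  qed
  have m_ge: "a / 2 \<le> m"
  proof -
    have "a * 1 \<le> a * N powr s" using a0 N s0 by (intro mult_left_mono ge_one_powr_ge_zero) auto
    then show ?thesis using \<mu>N unfolding m_def by simp
  qed
  have t_ge: "m powr (2/3) * l powr (2/3) \<le> t" using cond unfolding m_def l_def N_def .
  have t_ge': "m powr (2/3) \<le> t"
  proof -
    have "m powr (2/3) * 1 \<le> m powr (2/3) * l powr (2/3)"
      using l1 by (intro mult_left_mono ge_one_powr_ge_zero) auto
    then show ?thesis using t_ge by linarith
  qed
  have t32: "m * l \<le> t * sqrt t"
  proof -
    have "(m powr (2/3) * l powr (2/3)) powr (3/2) \<le> t powr (3/2)" using t_ge by (intro powr_mono2) auto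
    moreover have "(m powr (2/3) * l powr (2/3)) powr (3/2) = m * l"
      using m l1 by (simp add: powr_mult powr_powr)
    moreover have "t powr (3/2) = t * sqrt t"
    proof -
      have "t powr (3/2) = t powr (1 + 1/2)" by simp
      also have "\<dots> = t * sqrt t" using t by (subst powr_add) (simp add: powr_half_sqrt)
      finally show ?thesis .
    qed
    ultimately show ?thesis by simp
  qed
  have a13: "0 < (a / 2) powr (1/3)" using a0 by simp
  have va: "va p \<le> B * t\<^sup>2"
  proof -
    have "m * (a / 2) powr (1/3) \<le> m * m powr (1/3)" using m m_ge a0 by (intro mult_left_mono powr_mono2) auto
    also have "\<dots> = m powr (1 + 1/3)" using m by (subst powr_add) simp
    also have "\<dots> = (m powr (2/3)) powr 2" unfolding powr_powr by simp
    also have "\<dots> = (m powr (2/3))\<^sup>2" using m by simp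
    also have "\<dots> \<le> t\<^sup>2" using t_ge' by (intro power_mono) auto
    finally have mt: "m \<le> t\<^sup>2 / (a / 2) powr (1/3)" using a13 by (simp add: pos_le_divide_eq)
    have "va p \<le> (real k)\<^sup>2 * D\<^sup>2 * Lam p" using p p1 by (intro va_le_Lam) auto
    also have "\<dots> \<le> (real k)\<^sup>2 * D\<^sup>2 * (2 * mu p)"
      by (rule mult_left_mono[OF Lam_le_twice[OF p(1) q]]) simp
    also have "\<dots> = 4 * (real k)\<^sup>2 * D\<^sup>2 * m" unfolding m_def by simp
    also have "\<dots> \<le> 4 * (real k)\<^sup>2 * D\<^sup>2 * (t\<^sup>2 / (a / 2) powr (1/3))"
      using mt by (intro mult_left_mono) auto
    finally show ?thesis unfolding B by simp
  qed
  have B0: "0 < B" unfolding B using k3 D1 a0 by simp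
  have \<tau>: "0 < (a / 2) powr (2/3)" "(a / 2) powr (2/3) \<le> t"
  proof -
    show "0 < (a / 2) powr (2/3)" using a0 by simp
    have "(a / 2) powr (2/3) \<le> m powr (2/3)" using m_ge a0 by (intro powr_mono2) auto
    then show "(a / 2) powr (2/3) \<le> t" using t_ge' by linarith
  qed
  have "(1/2) / 4 * exp (- (CB * (sqrt t * ln (1 / p)))) \<le> rprob V p (\<lambda>A. mu p + t \<le> Xc A)"
    using dense_lower[OF p(1) _ _ _ \<tau> B0 va \<theta> dense] p unfolding CB by simp
  then have lB: "1/8 * exp (- (CB * (sqrt t * ln (1 / p)))) \<le> rprob V p (\<lambda>A. mu p + t \<le> Xc A)" by simp
  have r0: "0 \<le> rate p t" using rate_nonneg p t by simp
  have b0: "0 \<le> sqrt t * ln (1 / p)" using t p p1 by simp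
  have \<theta>0: "0 \<le> \<theta>"
  proof -
    have "0 \<le> 2 * (sqrt (4 * B / (1/2)) + 1) / (1/2)" using B0 by simp
    then show ?thesis using \<theta> by linarith
  qed
  have CB0: "0 \<le> CB" unfolding CB using D1 \<theta>0 by simp
  have c0: "0 < c" unfolding c using a0 by (simp add: add_nonneg_pos)
  have "c * (sqrt t * ln (1 / p)) \<le> rate p t"
  proof -
    have lnp: "ln (1 / p) \<le> l"
    proof -
      have "N powr (-1) \<le> N powr (- 2 / (real k + 1/3))"
        using N k3 by (intro powr_mono) (auto simp: field_simps)
      also have "\<dots> \<le> p" using lo unfolding N_def .
      finally have "ln (N powr (-1)) \<le> ln p" using N by (intro ln_mono) auto
      then show ?thesis using N p unfolding l_def by (simp add: ln_powr ln_div)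
    qed
    have "c * (sqrt t * ln (1 / p)) \<le> c * (sqrt t * l)" using lnp c0 t by (intro mult_left_mono) auto
    also have "\<dots> \<le> rate p t"
    proof (cases "mu p \<le> t")
      case True
      have "sqrt a * (s / 2 * l) \<le> sqrt t"
      proof -
        have "l \<le> N powr (s / 2) / (s / 2)" unfolding l_def using s0 N by (intro ln_le_powr_div) auto
        then have "s / 2 * l \<le> N powr (s / 2)" using s0 by (simp add: field_simps)
        then have "sqrt a * (s / 2 * l) \<le> sqrt a * N powr (s / 2)" using a0 by (intro mult_left_mono) auto
        also have "\<dots> = sqrt (a * N powr s)"
          using N by (simp add: real_sqrt_mult powr_half_sqrt[symmetric] powr_powr)
        also have "\<dots> \<le> sqrt t" using \<mu>N True by (intro real_sqrt_le_mono) linarith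
        finally show ?thesis .
      qed
      then have "sqrt t * (sqrt a * (s / 2 * l)) \<le> sqrt t * sqrt t" using t by (intro mult_left_mono) auto
      then have 1: "sqrt t * (sqrt a * (s / 2 * l)) / 6 \<le> t / 6" using t by (simp add: mult_ac)
      have "c \<le> sqrt a / (6 * (3 * real k + 1))" unfolding c by (rule min.cobounded2)
      then have "c * (sqrt t * l) \<le> sqrt a / (6 * (3 * real k + 1)) * (sqrt t * l)"
        using t l1 by (intro mult_right_mono) auto
      also have "\<dots> = sqrt t * (sqrt a * (s / 2 * l)) / 6"
      proof -
        have "x / (6 * d) * (y * l) = y * (x * (2 / d / 2 * l)) / 6" for x y d :: real
          by (simp add: mult_ac)
        then show ?thesis unfolding s_def .
      qed
      also have "\<dots> \<le> t / 6" by (rule 1)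
      also have "\<dots> \<le> rate p t" by (rule rate_ge_linear[OF p(1) t q True])
      finally show ?thesis .
    next
      case False
      have "c \<le> 1/12" unfolding c by (rule min.cobounded1)
      then have "c * (sqrt t * l) \<le> 1/12 * (sqrt t * l)" using t l1 by (intro mult_right_mono) auto
      also have "\<dots> = sqrt t * (m * l) / (12 * m)" using m by simp
      also have "\<dots> \<le> sqrt t * (t * sqrt t) / (12 * m)"
        using t32 m t by (intro divide_right_mono mult_left_mono) auto
      also have "\<dots> = t\<^sup>2 / (3 * mu p) / 2" unfolding m_def using t by (simp add: power2_eq_square)
      also have "\<dots> \<le> t\<^sup>2 / (2 * mu p + t) / 2"
        using False \<mu> t by (intro divide_right_mono divide_left_mono) auto
      also have "\<dots> \<le> phi (t / mu p) * mu p / 2"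
        by (intro divide_right_mono phi_mu_ge[OF p(1) t]) simp
      also have "\<dots> \<le> rate p t" by (rule rate_ge_half[OF p(1) t q])
      finally show ?thesis .
    qed
    finally show ?thesis .
  qed
  then show ?thesis by (intro lower_combine_dominated[OF r0 b0 _ c0 _ CB0 lB C]) auto
qed

text \<open>The threshold says n^2 p^(k+1/3) \<le> 1. Since 2 (k - 1) \<ge> k + 1, this bounds both
  the square of n p^(k-1) and n^2 p^(k+1).\<close>

lemma sparse_bounds:
  assumes p: "0 < p" "p \<le> 1" and hi: "p \<le> real n powr (- 2 / (real k + 1/3))"
  shows "real n * p ^ (k - 1) \<le> 1" "mu p * p \<le> D ^ 3" "mu p \<le> D ^ 3 * real n powr (1/5)"
proof -
  define N where "N = real n"
  have N: "3 \<le> N" unfolding N_def using n3 by simp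
  have k13: "0 < real k + 1/3" by (simp add: add_nonneg_pos)
  have "p powr (real k + 1/3) \<le> (N powr (- 2 / (real k + 1/3))) powr (real k + 1/3)"
    using hi p unfolding N_def by (intro powr_mono2) auto
  also have "\<dots> = N powr (-2)" proof -
    have "- 2 / (real k + 1/3) * (real k + 1/3) = - 2" proof -
      have "- 2 / x * x = - 2" if "0 < x" for x :: real using that by simp
      then show ?thesis using k13 .
    qed
    then show ?thesis by (simp only: powr_powr)
  qed
  finally have "N powr 2 * p powr (real k + 1/3) \<le> N powr 2 * N powr (-2)" by (intro mult_left_mono) auto
  then have key: "N\<^sup>2 * p powr (real k + 1/3) \<le> 1" unfolding powr_add[symmetric] using N by simp
  have pw: "N\<^sup>2 * p ^ i \<le> 1" if "k + 1 \<le> i" for i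
  proof -
    have "p ^ i = p powr real i" using p by (simp add: powr_realpow)
    also have "\<dots> \<le> p powr (real k + 1/3)" using p that by (intro powr_mono') auto
    finally have "N\<^sup>2 * p ^ i \<le> N\<^sup>2 * p powr (real k + 1/3)" by (intro mult_left_mono) auto
    then show ?thesis using key by linarith
  qed
  show "real n * p ^ (k - 1) \<le> 1"
  proof -
    have "(N * p ^ (k - 1))\<^sup>2 = N\<^sup>2 * p ^ (2 * (k - 1))"
      by (simp add: power_mult_distrib power_mult[symmetric] mult.commute)
    also have "\<dots> \<le> 1\<^sup>2" using pw[of "2 * (k - 1)"] k3 by simp
    finally have "N * p ^ (k - 1) \<le> 1" by (rule power2_le_imp_le) simp
    then show ?thesis unfolding N_def .
  qed
  show "mu p * p \<le> D ^ 3"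
  proof -
    have "mu p * p \<le> D ^ 3 * N\<^sup>2 * p ^ k * p" using mu_le[of p] p unfolding N_def by (intro mult_right_mono) auto
    also have "\<dots> = D ^ 3 * (N\<^sup>2 * p ^ (k + 1))" by simp
    also have "\<dots> \<le> D ^ 3 * 1" using pw[of "k + 1"] D1 by (intro mult_left_mono) auto
    finally show ?thesis by simp
  qed
  show "mu p \<le> D ^ 3 * real n powr (1/5)"
  proof -
    have "p ^ k \<le> (N powr (- 2 / (real k + 1/3))) ^ k" using hi p unfolding N_def by (intro power_mono) auto
    also have "\<dots> = N powr (real k * (- 2 / (real k + 1/3)))" using N k3 by (simp add: powr_power mult.commute)
    finally have "N powr 2 * p ^ k \<le> N powr 2 * N powr (real k * (- 2 / (real k + 1/3)))"
      by (intro mult_left_mono) auto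
    then have "N\<^sup>2 * p ^ k \<le> N powr (2 / (3 * real k + 1))"
      unfolding powr_add[symmetric] exponent_identity using N by simp
    also have "\<dots> \<le> N powr (1/5)" using N k3 by (intro powr_mono) (auto simp: field_simps)
    finally have "D ^ 3 * (N\<^sup>2 * p ^ k) \<le> D ^ 3 * N powr (1/5)" using D1 by (intro mult_left_mono) auto
    then show ?thesis using mu_le[of p] p unfolding N_def by simp
  qed
qed

text \<open>For p \<le> n^(-4/k) the mean is O(n^(-2)), so ln (t / mu) is at least of order k ln
  (1/p) and the rate at least of order t ln (1/p), which is at least of order sqrt t ln (1/p) for
  \<open>t \<ge> 1/2\<close>.\<close>

lemma very_sparse_dominated:
  assumes p: "0 < p" "p \<le> 1" and q: "real n * p ^ (k - 1) \<le> 1"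
    and D3: "2 * D ^ 3 \<le> real n" and hi: "p \<le> real n powr (- 4 / real k)"
  shows "mu p \<le> 1/2" "1/2 \<le> t \<Longrightarrow> 1/16 * (sqrt t * ln (1 / p)) \<le> rate p t"
proof -
  define N where "N = real n"
  define l where "l = ln N"
  define L where "L = ln (1 / p)"
  have N: "3 \<le> N" unfolding N_def using n3 by simp
  have l1: "1 \<le> l" unfolding l_def N_def using n3 by (rule ln_nat_ge_1)
  have \<mu>: "0 < mu p" using mu_pos p by simp
  have k0: "0 < real k" using k3 by simp
  have L: "4 * l \<le> real k * L"
  proof -
    have "ln p \<le> ln (N powr (- 4 / real k))" using hi p unfolding N_def by (intro ln_mono) auto
    also have "\<dots> = - 4 / real k * l" using N unfolding l_def by (simp add: ln_powr)
    finally have "real k * ln p \<le> real k * (- 4 / real k * l)" using k0 by (intro mult_left_mono) auto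
    also have "\<dots> = - 4 * l" using k0 by simp
    finally show ?thesis unfolding L_def using p by (simp add: ln_div)
  qed
  have D0: "0 < D ^ 3" using D1 by simp
  have "ln (mu p) \<le> ln (D ^ 3 * N\<^sup>2 * p ^ k)" using mu_le[of p] p \<mu> unfolding N_def by (intro ln_mono) auto
  also have "\<dots> = ln (D ^ 3) + 2 * l - real k * L"
    using D0 N p unfolding l_def L_def by (simp add: ln_mult ln_realpow ln_div)
  finally have "ln (2 * mu p) \<le> ln (2 * D ^ 3) + 2 * l - real k * L"
    using \<mu> D0 by (simp add: ln_mult)
  also have "ln (2 * D ^ 3) \<le> l" unfolding l_def N_def using D3 D0 by (intro ln_mono) auto
  finally have ln2: "ln (2 * mu p) \<le> 3 * l - real k * L" by simp
  then have "ln (2 * mu p) \<le> 0" using L l1 by linarith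
  then show half: "mu p \<le> 1/2" using \<mu> by simp
  assume t: "1/2 \<le> t"
  have L0: "0 \<le> L" unfolding L_def using p by simp
  have "1/4 * (real k * L) \<le> - ln (2 * mu p)" using ln2 L by linarith
  also have "\<dots> = ln (1/2 / mu p)" using \<mu> by (simp add: ln_div ln_mult)
  also have "\<dots> \<le> ln (1 + t / mu p)"
  proof -
    have "1/2 / mu p \<le> t / mu p" using t \<mu> by (intro divide_right_mono) auto
    then show ?thesis using \<mu> t by (intro ln_mono) auto
  qed
  finally have "1/4 * (3 * L) \<le> ln (1 + t / mu p)"
    using k3 L0 mult_right_mono[of 3 "real k" L] by simp
  then have "t * (1/4 * (3 * L)) \<le> t * ln (1 + t / mu p)" using t by (intro mult_left_mono) auto
  also have "\<dots> \<le> 2 * (phi (t / mu p) * mu p)"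
    using mult_right_mono[OF phi_ge_ln[of "t / mu p"], of "mu p"] \<mu> t by simp
  also have "\<dots> \<le> 4 * rate p t" using rate_ge_half[OF p(1) _ q, of t] t by (simp add: mult_ac)
  finally have 1: "t * (3 * L) / 16 \<le> rate p t" by simp
  have "sqrt t \<le> 3 * t"
  proof -
    have "t * 1 \<le> t * (9 * t)" using t by (intro mult_left_mono) auto
    then show ?thesis using t by (intro real_le_lsqrt) (auto simp: power2_eq_square)
  qed
  then have "sqrt t * L \<le> 3 * t * L" using L0 by (intro mult_right_mono) auto
  then show "1/16 * (sqrt t * ln (1 / p)) \<le> rate p t" using 1 unfolding L_def by simp
qed

text \<open>Planting disjoint edges needs t p bounded and t at most a small power of n. It serves
  for t up to max(mu, ln(1/p)^2); beyond that the rate is at least t / 6 and dominates sqrt t ln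
  (1/p) up to a constant. For tiny p the dense set suffices. If t is below the order of the standard
  deviation, the tail at sqrt mu is bounded below by a constant, which is the origin of
  \<open>exp (- CP)\<close> in front.\<close>

lemma lower_sparse:
  assumes p: "0 < p" "p \<le> 1/16" and t: "0 < t" "1 \<le> mu p + t"
    and hi: "p \<le> real n powr (- 2 / (real k + 1/3))"
    and D3: "2 * D ^ 3 \<le> real n"
    and \<theta>: "2 * (sqrt (4 * (4 * (real k)\<^sup>2 * D\<^sup>2) / (1/2)) + 1) / (1/2) \<le> \<theta>"
    and dense: "dense_at (min (\<theta> * t) (mu p + t))"
    and K: "K = 4 * real k * D" and M: "M = 2 * K + 4"
    and big: "6 * real k ^ 3 * D ^ 3 * (M * max (D ^ 3) 400) ^ 3 \<le> a * real n powr (2/5)"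
    and G: "G = real k * D\<^sup>2 + (real k)\<^sup>2 * D * (M * (4 * D ^ 3))"
    and L: "K + M + 8 * G * M \<le> real L"
    and CB: "CB = D * (sqrt \<theta> + 1 / sqrt (1/2))" and CP: "CP = 4 * M * real L"
    and C: "16 * CB \<le> C" "CP \<le> C"
  shows "exp (- CP) / 8 * exp (- (C * min (rate p t) (sqrt t * ln (1 / p)))) \<le> rprob V p (\<lambda>A. mu p + t \<le> Xc A)"
proof -
  define N where "N = real n"
  define l where "l = ln N"
  define lp where "lp = ln (1 / p)"
  let ?P = "\<lambda>t. rprob V p (\<lambda>A. mu p + t \<le> Xc A)"
  have p1: "p \<le> 1" using p by simp
  have N: "3 \<le> N" unfolding N_def using n3 by simp
  have l1: "1 \<le> l" unfolding l_def N_def using n3 by (rule ln_nat_ge_1)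
  have \<mu>: "0 < mu p" using mu_pos p by simp
  note sb = sparse_bounds[OF p(1) p1 hi]
  have k0: "0 < real k" using k3 by simp
  have M0: "0 < M" unfolding M K using D1 by (simp add: add_nonneg_pos)
  have CP0: "0 \<le> CP" unfolding CP using M0 by simp
  have lp1: "1 \<le> lp"
  proof -
    have "exp 1 \<le> (3::real)" using exp_le by simp
    also have "\<dots> \<le> 1 / p" using p by (simp add: pos_le_divide_eq)
    finally have "ln (exp 1) \<le> ln (1 / p)" by (intro ln_mono) auto
    then show ?thesis unfolding lp_def by simp
  qed
  have r0: "0 \<le> rate p t" using rate_nonneg p t by simp
  have b0: "0 \<le> sqrt t * ln (1 / p)" using t p p1 by simp
  have e8: "exp (- CP) / 8 \<le> 1/8" using CP0 by simp
  have \<theta>0: "0 \<le> \<theta>"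
  proof -
    have "0 \<le> 2 * (sqrt (4 * (4 * (real k)\<^sup>2 * D\<^sup>2) / (1/2)) + 1) / (1/2)" by simp
    then show ?thesis using \<theta> by linarith
  qed
  have CB0: "0 \<le> CB" unfolding CB using D1 \<theta>0 by simp
  have CBC: "CB \<le> C" using C CB0 by linarith
  have clusterB: "exp (- CP) / 8 * exp (- (CB * (sqrt t * ln (1 / p)))) \<le> ?P t"
    if "1/2 \<le> t" "mu p \<le> 2 * t\<^sup>2"
  proof -
    have "va p \<le> (real k)\<^sup>2 * D\<^sup>2 * Lam p" using p p1 by (intro va_le_Lam) auto
    also have "\<dots> \<le> (real k)\<^sup>2 * D\<^sup>2 * (2 * mu p)"
      by (rule mult_left_mono[OF Lam_le_twice[OF p(1) sb(1)]]) simp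
    also have "\<dots> \<le> (real k)\<^sup>2 * D\<^sup>2 * (2 * (2 * t\<^sup>2))" using that by (intro mult_left_mono) auto
    finally have va: "va p \<le> 4 * (real k)\<^sup>2 * D\<^sup>2 * t\<^sup>2" by simp
    have "0 < 4 * (real k)\<^sup>2 * D\<^sup>2" using k3 D1 by simp
    from dense_lower[OF p(1) _ _ _ _ that(1) this va \<theta> dense] p
    have "1/8 * exp (- (CB * (sqrt t * ln (1 / p)))) \<le> ?P t" unfolding CB by simp
    moreover have "exp (- CP) / 8 * exp (- (CB * (sqrt t * ln (1 / p)))) \<le> 1/8 * exp (- (CB * (sqrt t * ln (1 / p))))"
      using e8 by (intro mult_right_mono) auto
    ultimately show ?thesis by linarith
  qed
  show ?thesis
  proof (cases "p \<le> real n powr (- 4 / real k)")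
    case True
    note vs = very_sparse_dominated[OF p(1) p1 sb(1) D3 True]
    have th: "1/2 \<le> t" using vs(1) t by linarith
    have "1/2 * (1/2) \<le> t * t" using th by (intro mult_mono) auto
    then have "mu p \<le> 2 * t\<^sup>2" using vs(1) by (simp add: power2_eq_square)
    from clusterB[OF th this] show ?thesis
      using vs(2)[OF th] CB0 CBC C
      by (intro lower_combine_dominated[OF r0 b0, where c="1/16" and ?C2.0=CB]) auto
  next
    case False
    have lp_l: "lp \<le> 2 * l"
    proof -
      have "ln (N powr (- 4 / real k)) \<le> ln p" using False N unfolding N_def by (intro ln_mono) auto
      then have "lp \<le> 4 / real k * l" using N p unfolding lp_def l_def by (simp add: ln_powr ln_div)
      also have "\<dots> \<le> 2 * l" using l1 k3 by (intro mult_right_mono) (auto simp: field_simps)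
      finally show ?thesis .
    qed
    have plant: "1/4 * exp (- (CP * rate p u)) \<le> ?P u"
      if u: "1/2 \<le> u" "mu p \<le> u\<^sup>2" "u \<le> max (mu p) (lp\<^sup>2)" for u
    proof -
      have lp_p: "lp\<^sup>2 * p \<le> 4"
      proof -
        have "lp\<^sup>2 \<le> (2 / sqrt p)\<^sup>2"
          using ln_inverse_le[OF p(1) p1] lp1 unfolding lp_def by (intro power_mono) auto
        also have "\<dots> = 4 / p" using p by (simp add: power_divide)
        finally show ?thesis using p by (simp add: pos_le_divide_eq)
      qed
      have D31: "1 \<le> D ^ 3" using D1 by simp
      \<comment> \<open>The value of \<open>H\<close>: \<open>u\<close> is at most the larger of
        \<open>mu p\<close> and the square of \<open>lp\<close>, whose products with
        \<open>p\<close> are at most \<open>D ^ 3\<close> and 4.\<close>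
      have "u * p \<le> 4 * D ^ 3"
      proof (cases "mu p \<le> lp\<^sup>2")
        case True
        then have "u * p \<le> lp\<^sup>2 * p" using u p by (intro mult_right_mono) auto
        then show ?thesis using lp_p D31 by linarith
      next
        case False
        then have "u * p \<le> mu p * p" using u p by (intro mult_right_mono) auto
        then show ?thesis using sb(2) D31 by linarith
      qed
      moreover have "6 * real k ^ 3 * D ^ 3 * (M * u) ^ 3 \<le> a * real n"
      proof -
        \<comment> \<open>\<open>lp\<close> is at most 2 ln n and ln n \<le> 10 N^(1/10), hence the
          constant 400. Both bounds for \<open>u\<close> are O(N^(1/5)), so its cube is O(N^(3/5)),
          and \<open>big\<close> supplies the missing N^(2/5).\<close>
        have "lp\<^sup>2 \<le> 400 * N powr (1/5)"
        proof -
          have "l \<le> N powr (1/10) / (1/10)" unfolding l_def using N by (intro ln_le_powr_div) auto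
          then have "lp \<le> 20 * N powr (1/10)" using lp_l by simp
          then have "lp\<^sup>2 \<le> (20 * N powr (1/10))\<^sup>2" using lp1 by (intro power_mono) auto
          also have "\<dots> = 400 * N powr (1/5)" using N by (simp add: power_mult_distrib powr_power)
          finally show ?thesis .
        qed
        also have "\<dots> \<le> max (D ^ 3) 400 * N powr (1/5)" by (intro mult_right_mono) auto
        finally have 1: "lp\<^sup>2 \<le> max (D ^ 3) 400 * N powr (1/5)" .
        have "D ^ 3 * N powr (1/5) \<le> max (D ^ 3) 400 * N powr (1/5)" by (intro mult_right_mono) auto
        then have "u \<le> max (D ^ 3) 400 * N powr (1/5)" using u(3) 1 sb(3) unfolding N_def by linarith
        then have "M * u \<le> M * max (D ^ 3) 400 * N powr (1/5)" using M0 by simp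
        then have "(M * u) ^ 3 \<le> (M * max (D ^ 3) 400 * N powr (1/5)) ^ 3" using M0 u by (intro power_mono) auto
        also have "\<dots> = (M * max (D ^ 3) 400) ^ 3 * N powr (3/5)"
          using N by (simp add: power_mult_distrib powr_power)
        finally have "6 * real k ^ 3 * D ^ 3 * (M * u) ^ 3
            \<le> 6 * real k ^ 3 * D ^ 3 * ((M * max (D ^ 3) 400) ^ 3 * N powr (3/5))"
          using D1 by (intro mult_left_mono) auto
        also have "\<dots> = (6 * real k ^ 3 * D ^ 3 * (M * max (D ^ 3) 400) ^ 3) * N powr (3/5)" by simp
        also have "\<dots> \<le> (a * N powr (2/5)) * N powr (3/5)" using big unfolding N_def by (intro mult_right_mono) auto
        also have "\<dots> = a * (N powr (2/5) * N powr (3/5))" by simp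
        also have "\<dots> = a * real n" unfolding powr_add[symmetric] using N by (simp add: N_def)
        finally show ?thesis .
      qed
      ultimately show ?thesis
        using planting_lower[OF p sb(1) u(1,2) _ K M G _ L] unfolding CP rate_def by simp
    qed
    show ?thesis
    proof (cases "1/2 \<le> t \<and> mu p \<le> t\<^sup>2")
      case True
      then have th: "1/2 \<le> t" "mu p \<le> t\<^sup>2" by auto
      have lB: "exp (- CP) / 8 * exp (- (CB * (sqrt t * ln (1 / p)))) \<le> ?P t"
        using th zero_le_power2[of t] by (intro clusterB) linarith+
      show ?thesis
      proof (cases "t \<le> max (mu p) (lp\<^sup>2)")
        case True
        have "exp (- CP) / 8 * exp (- (CP * rate p t)) \<le> 1/4 * exp (- (CP * rate p t))"
        proof (rule mult_right_mono)
          show "exp (- CP) / 8 \<le> 1/4" using e8 by linarith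
        qed simp
        then have lA: "exp (- CP) / 8 * exp (- (CP * rate p t)) \<le> ?P t" using plant[OF th True] by linarith
        show ?thesis by (rule lower_combine[OF r0 b0 _ lA lB C(2) CBC]) simp
      next
        case False
        then have f: "mu p \<le> t" "lp\<^sup>2 \<le> t" by auto
        have "lp \<le> sqrt t" using f(2) by (rule real_le_rsqrt)
        then have "sqrt t * lp \<le> sqrt t * sqrt t" using t by (intro mult_left_mono) auto
        also have "\<dots> = t" using t by simp
        finally have "1/16 * (sqrt t * ln (1 / p)) \<le> t / 6" using t unfolding lp_def by simp
        also have "\<dots> \<le> rate p t" by (rule rate_ge_linear[OF p(1) t(1) sb(1) f(1)])
        finally have dom: "1/16 * (sqrt t * ln (1 / p)) \<le> rate p t" .
        show ?thesis using dom lB CB0 CBC C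
          by (intro lower_combine_dominated[OF r0 b0, where c="1/16" and ?C2.0=CB]) auto
      qed
    next
      case False
      \<comment> \<open>Here the event at \<open>t\<close> contains the event at sqrt mu, since sqrt
        mu \<ge> t; the rate at sqrt mu is at most 1 because phi x \<le> x^2.\<close>
      define u where "u = sqrt (mu p)"
      have uu: "u\<^sup>2 = mu p" unfolding u_def using \<mu> by simp
      have u0: "0 < u" unfolding u_def using \<mu> by simp
      have \<mu>14: "1/4 \<le> mu p \<and> t \<le> u"
      proof (cases "t < 1/2")
        case True
        then have "1/2 \<le> mu p" using t by linarith
        moreover have "t \<le> u" unfolding u_def
        proof (rule real_le_rsqrt)
          have "t * t \<le> 1/2 * (1/2)" using True t by (intro mult_mono) auto
          then show "t\<^sup>2 \<le> mu p" using \<open>1/2 \<le> mu p\<close> by (simp add: power2_eq_square)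
        qed
        ultimately show ?thesis by simp
      next
        case F: False
        then have lt: "t\<^sup>2 < mu p" using False by auto
        have "1/2 * (1/2) \<le> t * t" using F by (intro mult_mono) auto
        then have "1/4 \<le> mu p" using lt by (simp add: power2_eq_square)
        moreover have "t \<le> u" unfolding u_def using lt by (intro real_le_rsqrt) auto
        ultimately show ?thesis by simp
      qed
      have u12: "1/2 \<le> u" unfolding u_def using \<mu>14 by (intro real_le_rsqrt) (auto simp: power2_eq_square)
      have u_max: "u \<le> max (mu p) (lp\<^sup>2)"
      proof (cases "1 \<le> mu p")
        case True
        then have "u \<le> mu p" unfolding u_def using real_sqrt_le_iff[of "mu p" "(mu p)\<^sup>2"]
          by (simp add: power2_eq_square mult_le_cancel_left1)
        then show ?thesis by simp
      next
        case False
        then have "u \<le> 1" unfolding u_def by simp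
        also have "1 \<le> lp\<^sup>2" using lp1 by simp
        finally show ?thesis by simp
      qed
      have rate1: "rate p u \<le> 1"
      proof -
        have "phi (u / mu p) * (mu p)\<^sup>2 \<le> (u / mu p)\<^sup>2 * (mu p)\<^sup>2"
          using u0 \<mu> by (intro mult_right_mono phi_le_square) auto
        also have "\<dots> = mu p" using \<mu> uu by (simp add: power_divide)
        also have "\<dots> \<le> Lam p" using p by (intro Lam_ge_mu) auto
        finally show ?thesis unfolding rate_def using Lam_pos[OF p(1)] by (simp add: divide_le_eq_1_pos)
      qed
      have "exp (- CP) / 8 * exp (- (C * min (rate p t) (sqrt t * ln (1 / p)))) \<le> exp (- CP) / 8 * 1"
      proof (rule mult_left_mono)
        have "0 \<le> C * min (rate p t) (sqrt t * ln (1 / p))" using r0 b0 CP0 C by (intro mult_nonneg_nonneg) auto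
        then show "exp (- (C * min (rate p t) (sqrt t * ln (1 / p)))) \<le> 1" by simp
      qed simp
      also have "\<dots> \<le> 1/4 * exp (- CP)" by simp
      also have "\<dots> \<le> 1/4 * exp (- (CP * rate p u))"
        using mult_left_mono[OF rate1 CP0] by simp
      also have "\<dots> \<le> ?P u" using uu by (intro plant u12 u_max) simp
      also have "\<dots> \<le> ?P t" using p p1 \<mu>14 by (intro rprob_mono) auto
      finally show ?thesis .
    qed
  qed
qed

end

section \<open>The main theorem\<close>

text \<open>The constants of \<open>lower_dense_regime\<close> gathered into one, so that the
  exponent can be fixed before the hypergraph. It is used with the lower bounds
  \<open>\<gamma> ^ (k - 1)\<close> and 1 for n p^(k-1).\<close>

definition dense_regime_const :: "nat \<Rightarrow> real \<Rightarrow> real \<Rightarrow> real \<Rightarrow> real \<Rightarrow> real \<Rightarrow> real \<Rightarrow> real" where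
  "dense_regime_const k a D \<gamma> g c1 \<theta> =
    (let C1 = 1 + sqrt (2 * (real k)\<^sup>2 * D\<^sup>2 * 4 ^ k / c1);
         c0 = \<gamma> / C1;
         \<tau> = sqrt (c1 * (a * g powr (3/2)));
         CB = D * (sqrt \<theta> + 1 / sqrt \<tau>);
         CT = D * C1\<^sup>2 / \<gamma> * (3 * (1 + 1 / g) / a);
         c2 = c0 / (2 + c0) / (1 + 1 / g) * (sqrt (c0 * a) / 2)
     in max CT (max CB (CB / c2)))"

lemma (in dense_hypergraph) lower_dense_regime_const:
  assumes "0 < p" "p \<le> 1 - \<gamma>" "0 < \<gamma>" "\<gamma> < 1" "0 < t" "0 < g" "g \<le> real n * p ^ (k - 1)"
    "0 < c1" "c1 * Lam p \<le> t\<^sup>2"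
    "2 * (sqrt (4 * ((real k)\<^sup>2 * D\<^sup>2 / c1) / \<gamma>) + 1) / \<gamma> \<le> \<theta>"
    "dense_at (min (\<theta> * t) (mu p + t))"
    "dense_regime_const k a D \<gamma> g c1 \<theta> \<le> C"
  shows "\<gamma> / 4 * exp (- (C * min (rate p t) (sqrt t * ln (1 / p)))) \<le> rprob V p (\<lambda>A. mu p + t \<le> Xc A)"
  using assms(12) unfolding dense_regime_const_def Let_def
  by (intro lower_dense_regime[OF assms(1-11) refl refl refl refl refl refl]) simp_all

text \<open>The demands on \<open>n\<close> do not mention \<gamma>, so the threshold can be fixed
  before it. \<open>X\<close> and \<open>Y\<close> stand for the constants of the very sparse case
  and of the planting of disjoint edges.\<close>

lemma ex_large_n:
  fixes a X Y :: real
  assumes "3 \<le> k" "0 < a"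
  shows "\<exists>n0::nat. 0 < n0 \<and> (\<forall>n\<ge>n0. 3 \<le> n \<and> real n powr (- 1 / (real k - 1)) * ln (real n) \<le> 1/2
    \<and> real n powr (- 2 / (real k + 1/3)) \<le> 1/16 \<and> X \<le> real n \<and> Y \<le> a * real n powr (2/5))"
proof -
  have k1: "0 < 1 / (real k - 1)" using assms by simp
  have k2: "0 < 2 / (real k + 1/3)" by (simp add: add_nonneg_pos)
  have neg: "((\<lambda>n. real n powr (- s)) \<longlongrightarrow> 0) sequentially" if "0 < s" for s
    by (rule tendsto_neg_powr[OF _ filterlim_real_sequentially]) (use that in simp)
  have "((\<lambda>n. ln (real n) / real n powr (1 / (real k - 1))) \<longlongrightarrow> 0) sequentially"
    by (rule lim_ln_over_power[OF k1])
  then have "\<forall>\<^sub>F n in sequentially. ln (real n) / real n powr (1 / (real k - 1)) < 1/2"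
    by (rule order_tendstoD) simp
  then have 1: "\<forall>\<^sub>F n in sequentially. real n powr (- 1 / (real k - 1)) * ln (real n) \<le> 1/2"
    by eventually_elim (simp add: powr_minus field_simps)
  have "\<forall>\<^sub>F n in sequentially. real n powr (- (2 / (real k + 1/3))) < 1/16"
    using neg[OF k2] by (rule order_tendstoD) simp
  then have 2: "\<forall>\<^sub>F n in sequentially. real n powr (- 2 / (real k + 1/3)) \<le> 1/16"
    by eventually_elim simp
  have "\<forall>\<^sub>F n in sequentially. real n powr (- (2/5)) < a / (\<bar>Y\<bar> + 1)"
    using neg[of "2/5"] by (rule order_tendstoD) (use assms in simp_all)
  then have 3: "\<forall>\<^sub>F n in sequentially. Y \<le> a * real n powr (2/5)"
    using eventually_ge_at_top[of 1]
  proof eventually_elim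
    case (elim n)
    then have "\<bar>Y\<bar> + 1 < a * real n powr (2/5)"
      by (simp add: powr_minus field_simps)
    then show ?case by linarith
  qed
  have 4: "\<forall>\<^sub>F n in sequentially. X \<le> real n"
    using filterlim_real_sequentially unfolding filterlim_at_top by blast
  have "\<forall>\<^sub>F n in sequentially. 3 \<le> n \<and> real n powr (- 1 / (real k - 1)) * ln (real n) \<le> 1/2
    \<and> real n powr (- 2 / (real k + 1/3)) \<le> 1/16 \<and> X \<le> real n \<and> Y \<le> a * real n powr (2/5)"
    using 1 2 3 4 eventually_ge_at_top[of 3] by eventually_elim simp
  then obtain n1 where "\<forall>n\<ge>n1. 3 \<le> n \<and> real n powr (- 1 / (real k - 1)) * ln (real n) \<le> 1/2
    \<and> real n powr (- 2 / (real k + 1/3)) \<le> 1/16 \<and> X \<le> real n \<and> Y \<le> a * real n powr (2/5)"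
    unfolding eventually_sequentially by blast
  then show ?thesis by (intro exI[of _ "Suc n1"]) auto
qed

section \<open>Translation from the random induced hypergraph\<close>

lemma dense_hypergraph_of_assms:
  assumes "3 \<le> k" "0 < a" "1 \<le> D" "3 \<le> n" "uniform_hypergraph k H"
    "real (num_verts H) \<le> D * real n" "a * (real n)\<^sup>2 \<le> real (num_edges H)" "real (max_codegree 2 H) \<le> D"
  shows "dense_hypergraph (verts H) (edges H) k D n a"
proof
  show fin: "finite (verts H)" using assms unfolding uniform_hypergraph_def by simp
  show e: "f \<subseteq> verts H \<and> card f = k" if "f \<in> edges H" for f
    using that assms unfolding uniform_hypergraph_def by simp
  show "real (card {f \<in> edges H. u \<in> f \<and> v \<in> f}) \<le> D" if "u \<noteq> v" for u v
  proof (cases "u \<in> verts H \<and> v \<in> verts H")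
    case True
    let ?S = "{S. S \<subseteq> verts H \<and> card S = 2}"
    have "finite ?S" using fin by (auto intro: finite_subset[of _ "Pow (verts H)"])
    moreover have "{u, v} \<in> ?S" using True that by simp
    ultimately have "card {f \<in> edges H. {u, v} \<subseteq> f} \<le> max_codegree 2 H"
      unfolding max_codegree_def by (intro Max_ge finite_imageI imageI)
    then show ?thesis using assms(8) by simp
  next
    \<comment> \<open>\<open>max_codegree\<close> speaks only of pairs of vertices; for any other
      pair no edge contains both points.\<close>
    case False
    then have "{f \<in> edges H. u \<in> f \<and> v \<in> f} = {}" using e by auto
    then show ?thesis using assms(3) by (simp only: card.empty)
  qed
qed (use assms in \<open>auto simp: num_verts_def num_edges_def\<close>)

text \<open>An arbitrary function \<open>g\<close> of the edge count serves the mean, the variance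
  and the tail at once.\<close>

lemma expectation_random_induced:
  assumes "finite (verts H)" "0 \<le> p" "p \<le> 1"
  shows "measure_pmf.expectation (random_induced H p) (\<lambda>G. g (real (num_edges G)))
    = rexp (verts H) p (\<lambda>A. g (real (card {f \<in> edges H. f \<subseteq> A})))"
  using expectation_random_verts[OF assms, of "\<lambda>A. g (real (card {f \<in> edges H. f \<subseteq> A}))"]
  by (simp add: random_induced_def num_edges_def induced_def)

lemma prob_random_induced:
  assumes "finite (verts H)" "0 \<le> p" "p \<le> 1"
  shows "measure_pmf.prob (random_induced H p) {G. x \<le> real (num_edges G)}
    = rprob (verts H) p (\<lambda>A. x \<le> real (card {f \<in> edges H. f \<subseteq> A}))"
proof -
  have "measure_pmf.prob (random_induced H p) {G. x \<le> real (num_edges G)}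
      = measure_pmf.expectation (random_induced H p) (indicator {G. x \<le> real (num_edges G)})"
    by simp
  also have "\<dots> = measure_pmf.expectation (random_induced H p) (\<lambda>G. of_bool (x \<le> real (num_edges G)))"
    by (intro Bochner_Integration.integral_cong) (auto simp: indicator_def)
  also have "\<dots> = rprob (verts H) p (\<lambda>A. x \<le> real (card {f \<in> edges H. f \<subseteq> A}))"
    unfolding rprob_def by (rule expectation_random_induced[OF assms])
  finally show ?thesis .
qed

theorem theorem1p6:
  fixes k :: nat and a D :: real
  assumes "k \<ge> 3" and "a > 0" and "D \<ge> 1"
  shows "\<exists>n0::nat. n0 > 0 \<and> (\<forall>\<gamma>::real. 0 < \<gamma> \<and> \<gamma> < 1 \<longrightarrow>
    (\<exists>c C d l :: real. c > 0 \<and> C > 0 \<and> d > 0 \<and> l \<ge> 1 \<and>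
      (\<forall>(H :: 'a hypergraph) (n :: nat) (p :: real) (t :: real).
        n \<ge> n0 \<longrightarrow>
        uniform_hypergraph k H \<longrightarrow>
        real (num_verts H) \<le> D * real n \<longrightarrow>
        real (num_edges H) \<ge> a * (real n)\<^sup>2 \<longrightarrow>
        real (max_codegree 2 H) \<le> D \<longrightarrow>
        0 < p \<longrightarrow> p \<le> 1 \<longrightarrow> t > 0 \<longrightarrow>
        (let Hp = random_induced H p;
             X = (\<lambda>G. real (num_edges G));
             \<mu> = measure_pmf.expectation Hp X;
             VarX = measure_pmf.variance Hp X;
             \<Lambda> = \<mu> * (1 + real n * p ^ (k - 1));
             tail = measure_pmf.prob Hp {G. X G \<ge> \<mu> + t}
         in
          ((p \<notin> {real n powr (- 1 / (real k - 1) - \<gamma>) <..<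
                   \<gamma> * real n powr (- 1 / (real k - 1)) * ln (real n) powr (1 / (real k - 1))}
            \<or> t \<ge> \<gamma> * min (VarX powr (2/3)) (\<mu> powr (2/3)) * ln (real n) powr (4/3)
            \<or> t \<ge> \<mu> * p powr ((real k - 2) / 3 - \<gamma>))
           \<longrightarrow> tail \<le> (1 + 1 / real n) *
                 exp (- c * min (phi (t / \<mu>) * \<mu>\<^sup>2 / \<Lambda>) (sqrt t * ln (exp 1 / p))))
          \<and>
          ((p \<le> real n powr (- 2 / (real k + 1/3))
            \<or> (t \<ge> min (VarX powr (2/3)) (\<mu> powr (2/3)) * ln (real n) powr (2/3)
                \<and> p \<le> real n powr (- 1 / (real k - 1)) * ln (real n))
            \<or> (t \<ge> min (sqrt VarX) (sqrt \<Lambda>)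
                \<and> \<gamma> * real n powr (- 1 / (real k - 1)) \<le> p \<and> p \<le> 1 - \<gamma>))
           \<longrightarrow> small_dense_set H D (min (l * t) (\<mu> + t)) \<longrightarrow> \<mu> + t \<ge> 1
           \<longrightarrow> tail \<ge> d *
                 exp (- C * min (phi (t / \<mu>) * \<mu>\<^sup>2 / \<Lambda>) (sqrt t * ln (1 / p))))))))"
proof -
  \<comment> \<open>These constants depend on \<open>k\<close> and \<open>D\<close> only. They come
    before \<open>n0\<close>, which must not depend on \<gamma>, because the planting of disjoint
    edges asks \<open>n\<close> to be large in terms of \<open>M\<close>.\<close>
  define K where "K = 4 * real k * D"
  define M where "M = 2 * K + 4"
  define G where "G = real k * D\<^sup>2 + (real k)\<^sup>2 * D * (M * (4 * D ^ 3))"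
  define L where "L = nat \<lceil>K + M + 8 * G * M\<rceil>"
  define CP where "CP = 4 * M * real L"
  have L: "K + M + 8 * G * M \<le> real L" unfolding L_def by linarith
  have M0: "0 < M" unfolding M_def K_def using assms by (simp add: add_nonneg_pos)
  have CP0: "0 \<le> CP" unfolding CP_def using M0 by simp
  obtain n0 :: nat where n0: "0 < n0"
    "\<And>n. n0 \<le> n \<Longrightarrow> 3 \<le> n \<and> real n powr (- 1 / (real k - 1)) * ln (real n) \<le> 1/2
      \<and> real n powr (- 2 / (real k + 1/3)) \<le> 1/16 \<and> 2 * D ^ 3 \<le> real n
      \<and> 6 * real k ^ 3 * D ^ 3 * (M * max (D ^ 3) 400) ^ 3 \<le> a * real n powr (2/5)"
    using ex_large_n[OF assms(1,2), of "2 * D ^ 3" "6 * real k ^ 3 * D ^ 3 * (M * max (D ^ 3) 400) ^ 3"]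
    by blast
  show ?thesis
  proof (intro exI[of _ n0] conjI n0(1) allI impI)
    fix \<gamma> :: real
    assume "0 < \<gamma> \<and> \<gamma> < 1"
    then have \<gamma>: "0 < \<gamma>" "\<gamma> < 1" by auto
    have k1: "2 \<le> real k - 1" using assms(1) by simp
    define \<eta> where "\<eta> = \<gamma> / (4 * (real k - 1))"
    have \<eta>: "0 < \<eta>" unfolding \<eta>_def using \<gamma> k1 by simp
    \<comment> \<open>One entry for each upper bound on \<open>\<delta>\<close> in
      \<open>dichotomy_of_conditions\<close>.\<close>
    define \<delta> where "\<delta> = Min {1/6, \<gamma>, \<gamma> ^ (k - 1), sqrt a / (9 * 256), \<gamma> powr (3/2) / 27, \<eta>, sqrt a * \<eta>\<^sup>2 / 9}"
    have \<delta>0: "0 < \<delta>" unfolding \<delta>_def using \<gamma> \<eta> assms(2) by (subst Min_gr_iff) auto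
    have "\<delta> \<le> 1/6" "\<delta> \<le> \<gamma>" "\<delta> \<le> \<gamma> ^ (k - 1)" "\<delta> \<le> sqrt a / (9 * 256)" "\<delta> \<le> \<gamma> powr (3/2) / 27" "\<delta> \<le> \<eta>"
      "\<delta> \<le> sqrt a * \<eta>\<^sup>2 / 9"
      unfolding \<delta>_def by (rule Min_le; simp)+
    then have \<delta>: "\<delta> \<le> 1/6" "\<delta> \<le> \<gamma>" "\<delta> \<le> \<gamma> ^ (k - 1)" "9 * 256 * \<delta> \<le> sqrt a" "27 * \<delta> \<le> \<gamma> powr (3/2)" "\<delta> \<le> \<eta>"
      "9 * \<delta> \<le> sqrt a * \<eta>\<^sup>2"
      by simp_all
    define Ku where "Ku = max (exp 1 ^ 3 * D\<^sup>2) ((10 + 2 * ln D) / \<delta>)"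
    have Ku: "0 < Ku" unfolding Ku_def using assms(3) by (intro less_max_iff_disj[THEN iffD2] disjI1) auto
    define c where "c = upper_const k a D Ku"
    have c: "0 < c" unfolding c_def by (rule upper_const_pos[OF assms(1,3) Ku])
    define g where "g = \<gamma> ^ (k - 1)"
    have g: "0 < g" unfolding g_def using \<gamma> by simp
    \<comment> \<open>\<open>c3\<close> belongs to condition (iii), where the lower bound on
      \<open>p\<close> gives n p^(k-1) \<ge> g; \<open>c2\<close> belongs to condition (ii) with n
      p^(k-1) \<ge> 1, hence the base 1 in its definition.\<close>
    define c3 where "c3 = min 1 (\<gamma> * real k * a / (D * (1 + 1 / g)))"
    have c3: "0 < c3" unfolding c3_def using \<gamma> assms g by (auto intro!: divide_pos_pos mult_pos_pos add_pos_pos)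
    define c2 where "c2 = (a * 1 powr (3/2) / 2) powr (1/3) * (1 / (6 * (real k - 1))) ^ (k - 1) / 4"
    have c2: "0 < c2" unfolding c2_def using assms(2) k1 by simp
    define B where "B = 4 * (real k)\<^sup>2 * D\<^sup>2 / (a / 2) powr (1/3)"
    \<comment> \<open>A single \<lambda> must serve all regimes, since the dense set is given for
      one value only; each entry after the 1 is the threshold required in one of them.\<close>
    define th where "th = Max {1, 2 * (sqrt (4 * ((real k)\<^sup>2 * D\<^sup>2 / c3) / \<gamma>) + 1) / \<gamma>,
      2 * (sqrt (4 * ((real k)\<^sup>2 * D\<^sup>2 / c2) / (1/2)) + 1) / (1/2),
      2 * (sqrt (4 * B / (1/2)) + 1) / (1/2),
      2 * (sqrt (4 * (4 * (real k)\<^sup>2 * D\<^sup>2) / (1/2)) + 1) / (1/2)}"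
    have th: "1 \<le> th" "2 * (sqrt (4 * ((real k)\<^sup>2 * D\<^sup>2 / c3) / \<gamma>) + 1) / \<gamma> \<le> th"
      "2 * (sqrt (4 * ((real k)\<^sup>2 * D\<^sup>2 / c2) / (1/2)) + 1) / (1/2) \<le> th"
      "2 * (sqrt (4 * B / (1/2)) + 1) / (1/2) \<le> th"
      "2 * (sqrt (4 * (4 * (real k)\<^sup>2 * D\<^sup>2) / (1/2)) + 1) / (1/2) \<le> th"
      unfolding th_def by (rule Max_ge; simp)+
    define CBm where "CBm = D * (sqrt th + 1 / sqrt ((a / 2) powr (2/3)))"
    define cm where "cm = min (1/12) (sqrt a / (6 * (3 * real k + 1)))"
    define CBs where "CBs = D * (sqrt th + 1 / sqrt (1/2))"
    define C where "C = Max {1, dense_regime_const k a D \<gamma> g c3 th, dense_regime_const k a D (1/2) 1 c2 th,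
      CBm, CBm / cm, 16 * CBs, CP}"
    have C: "1 \<le> C" "dense_regime_const k a D \<gamma> g c3 th \<le> C" "dense_regime_const k a D (1/2) 1 c2 th \<le> C"
      "CBm \<le> C" "CBm / cm \<le> C" "16 * CBs \<le> C" "CP \<le> C"
      unfolding C_def by (rule Max_ge; simp)+
    \<comment> \<open>The first entry comes from condition (iii), the second from the sparse range;
      the factor 1/8 available under (ii) lies above the second.\<close>
    define d where "d = min (\<gamma> / 4) (exp (- CP) / 8)"
    have d: "0 < d" "d \<le> \<gamma> / 4" "d \<le> exp (- CP) / 8" "d \<le> 1/8"
    proof -
      show "0 < d" "d \<le> \<gamma> / 4" "d \<le> exp (- CP) / 8" unfolding d_def using \<gamma> by auto
      moreover have "exp (- CP) \<le> 1" using CP0 by simp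
      ultimately show "d \<le> 1/8" by linarith
    qed
    show "\<exists>c C d l :: real. c > 0 \<and> C > 0 \<and> d > 0 \<and> l \<ge> 1 \<and>
      (\<forall>(H :: 'a hypergraph) (n :: nat) (p :: real) (t :: real).
        n \<ge> n0 \<longrightarrow>
        uniform_hypergraph k H \<longrightarrow>
        real (num_verts H) \<le> D * real n \<longrightarrow>
        real (num_edges H) \<ge> a * (real n)\<^sup>2 \<longrightarrow>
        real (max_codegree 2 H) \<le> D \<longrightarrow>
        0 < p \<longrightarrow> p \<le> 1 \<longrightarrow> t > 0 \<longrightarrow>
        (let Hp = random_induced H p;
             X = (\<lambda>G. real (num_edges G));
             \<mu> = measure_pmf.expectation Hp X;
             VarX = measure_pmf.variance Hp X;
             \<Lambda> = \<mu> * (1 + real n * p ^ (k - 1));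
             tail = measure_pmf.prob Hp {G. X G \<ge> \<mu> + t}
         in
          ((p \<notin> {real n powr (- 1 / (real k - 1) - \<gamma>) <..<
                   \<gamma> * real n powr (- 1 / (real k - 1)) * ln (real n) powr (1 / (real k - 1))}
            \<or> t \<ge> \<gamma> * min (VarX powr (2/3)) (\<mu> powr (2/3)) * ln (real n) powr (4/3)
            \<or> t \<ge> \<mu> * p powr ((real k - 2) / 3 - \<gamma>))
           \<longrightarrow> tail \<le> (1 + 1 / real n) *
                 exp (- c * min (phi (t / \<mu>) * \<mu>\<^sup>2 / \<Lambda>) (sqrt t * ln (exp 1 / p))))
          \<and>
          ((p \<le> real n powr (- 2 / (real k + 1/3))
            \<or> (t \<ge> min (VarX powr (2/3)) (\<mu> powr (2/3)) * ln (real n) powr (2/3)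
                \<and> p \<le> real n powr (- 1 / (real k - 1)) * ln (real n))
            \<or> (t \<ge> min (sqrt VarX) (sqrt \<Lambda>)
                \<and> \<gamma> * real n powr (- 1 / (real k - 1)) \<le> p \<and> p \<le> 1 - \<gamma>))
           \<longrightarrow> small_dense_set H D (min (l * t) (\<mu> + t)) \<longrightarrow> \<mu> + t \<ge> 1
           \<longrightarrow> tail \<ge> d *
                 exp (- C * min (phi (t / \<mu>) * \<mu>\<^sup>2 / \<Lambda>) (sqrt t * ln (1 / p))))))"
    proof (rule exI[of _ c], rule exI[of _ C], rule exI[of _ d], rule exI[of _ th],
        intro conjI allI impI)
      show "0 < c" by (rule c)
      show "0 < C" using C(1) by linarith
      show "0 < d" by (rule d(1))
      show "1 \<le> th" by (rule th(1))
      fix H :: "'a hypergraph" and n :: nat and p t :: real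
      assume n: "n0 \<le> n" and H: "uniform_hypergraph k H" "real (num_verts H) \<le> D * real n"
        "a * (real n)\<^sup>2 \<le> real (num_edges H)" "real (max_codegree 2 H) \<le> D"
        and p: "0 < p" "p \<le> 1" and t: "0 < t"
      note big = n0(2)[OF n]
      interpret h: dense_hypergraph "verts H" "edges H" k D n a
        using big assms H by (intro dense_hypergraph_of_assms) auto
      have p0: "0 \<le> p" using p by simp
      let ?Hp = "random_induced H p"
      let ?X = "\<lambda>G. real (num_edges G)"
      have mu: "measure_pmf.expectation ?Hp ?X = h.mu p"
        using expectation_random_induced[OF h.finV p0 p(2), of "\<lambda>x. x"] h.rexp_Xc[of p]
        unfolding h.Xc_def by simp
      have va: "measure_pmf.expectation ?Hp (\<lambda>G. (?X G - h.mu p)\<^sup>2) = h.va p"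
        using expectation_random_induced[OF h.finV p0 p(2), of "\<lambda>x. (x - h.mu p)\<^sup>2"]
        unfolding h.va_def h.Xc_def by simp
      have tail: "measure_pmf.prob ?Hp {G. h.mu p + t \<le> ?X G} = rprob (verts H) p (\<lambda>A. h.mu p + t \<le> h.Xc A)"
        unfolding h.Xc_def by (rule prob_random_induced[OF h.finV p0 p(2)])
      let ?P = "rprob (verts H) p (\<lambda>A. h.mu p + t \<le> h.Xc A)"
      have rate: "phi (t / h.mu p) * (h.mu p)\<^sup>2 / (h.mu p * (1 + real n * p ^ (k - 1))) = h.rate p t"
        unfolding h.rate_def h.Lam_def ..
      have dense: "small_dense_set H D x = h.dense_at x" for x
        unfolding small_dense_set_def h.dense_at_def h.Xc_def num_edges_def induced_def by simp
      have upper: "?P \<le> (1 + 1 / real n) * exp (- c * min (h.rate p t) (sqrt t * ln (exp 1 / p)))"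
        if "p \<notin> {real n powr (- 1 / (real k - 1) - \<gamma>) <..<
                   \<gamma> * real n powr (- 1 / (real k - 1)) * ln (real n) powr (1 / (real k - 1))}
            \<or> \<gamma> * min (h.va p powr (2/3)) (h.mu p powr (2/3)) * ln (real n) powr (4/3) \<le> t
            \<or> h.mu p * p powr ((real k - 2) / 3 - \<gamma>) \<le> t"
        using h.upper_of_dichotomy[OF p t \<delta>0 h.dichotomy_of_conditions[OF p t \<gamma> \<delta>0 \<delta> \<eta>_def that]]
        unfolding c_def Ku_def h.upper_exp_def h.rate_def .
      have lower: "d * exp (- C * min (h.rate p t) (sqrt t * ln (1 / p))) \<le> ?P"
        if cond: "p \<le> real n powr (- 2 / (real k + 1/3))
            \<or> (min (h.va p powr (2/3)) (h.mu p powr (2/3)) * ln (real n) powr (2/3) \<le> t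
                \<and> p \<le> real n powr (- 1 / (real k - 1)) * ln (real n))
            \<or> (min (sqrt (h.va p)) (sqrt (h.Lam p)) \<le> t
                \<and> \<gamma> * real n powr (- 1 / (real k - 1)) \<le> p \<and> p \<le> 1 - \<gamma>)"
          and ds: "h.dense_at (min (th * t) (h.mu p + t))" and one: "1 \<le> h.mu p + t"
      proof -
        let ?e = "exp (- (C * min (h.rate p t) (sqrt t * ln (1 / p))))"
        have weaken: "d * ?e \<le> ?P" if "d \<le> d'" "d' * ?e \<le> ?P" for d'
        proof -
          have "d * ?e \<le> d' * ?e" by (rule mult_right_mono[OF that(1)]) simp
          then show ?thesis using that(2) by linarith
        qed
        have sparse: "d * ?e \<le> ?P" if hi: "p \<le> real n powr (- 2 / (real k + 1/3))"
        proof -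
          have "p \<le> 1/16" using hi big by linarith
          then show ?thesis using big
            by (intro weaken[OF d(3)] h.lower_sparse[OF p(1) _ t one hi _ th(5) ds K_def M_def _ G_def L CBs_def CP_def C(6,7)]) auto
        qed
        have "d * ?e \<le> ?P"
        \<comment> \<open>Below the threshold of (i) the sparse bound applies whichever condition
          holds, so (ii) and (iii) are treated only above it.\<close>
        proof (cases "p \<le> real n powr (- 2 / (real k + 1/3))")
          case True
          then show ?thesis by (rule sparse)
        next
          case False
          with cond consider
            (ii) "min (h.va p powr (2/3)) (h.mu p powr (2/3)) * ln (real n) powr (2/3) \<le> t"
              "p \<le> real n powr (- 1 / (real k - 1)) * ln (real n)"
            | (iii) "min (sqrt (h.va p)) (sqrt (h.Lam p)) \<le> t"
              "\<gamma> * real n powr (- 1 / (real k - 1)) \<le> p" "p \<le> 1 - \<gamma>"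
            by blast
          then show ?thesis
          proof cases
            case ii
            have p2: "p \<le> 1/2" using ii(2) big by linarith
            note cl = h.cluster_condition[OF p(1) p2 ii(1)]
            show ?thesis
            \<comment> \<open>Condition (ii) crosses the point n p^(k-1) = 1: above it tilting may
              be needed besides the dense set, below it the dense set is enough.\<close>
            proof (cases "1 \<le> real n * p ^ (k - 1)")
              case True
              have "c2 * h.Lam p \<le> t\<^sup>2"
                by (rule h.deviation_of_cluster_condition[OF p(1) p2 t _ True ii(2) cl c2_def]) simp
              then have "(1/2) / 4 * ?e \<le> ?P"
                using p2 by (intro h.lower_dense_regime_const[OF p(1) _ _ _ t _ True c2 _ th(3) ds C(3)]) auto
              then show ?thesis by (intro weaken[OF d(4)]) simp
            next
              case f: False
              show ?thesis using False f
                by (intro weaken[OF d(4)] h.lower_moderate[OF p(1) p2 t _ _ cl B_def th(4) ds CBm_def cm_def C(4,5)]) auto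
            qed
          next
            case iii
            have q: "g \<le> real n * p ^ (k - 1)"
            proof -
              have "(\<gamma> * real n powr (- 1 / (real k - 1))) ^ (k - 1) \<le> p ^ (k - 1)"
                using iii(2) \<gamma> by (intro power_mono) auto
              moreover have "(\<gamma> * real n powr (- 1 / (real k - 1))) ^ (k - 1) = g * real n powr (-1)"
                unfolding g_def using big by (simp only: power_mult_distrib) (subst h.powr_root_power, auto)
              ultimately have "real n * (g * real n powr (-1)) \<le> real n * p ^ (k - 1)"
                by (intro mult_left_mono) auto
              then show ?thesis using big by (simp add: powr_minus field_simps)
            qed
            have "c3 * h.Lam p \<le> t\<^sup>2"
              by (rule h.deviation_of_variance_bound[OF p(1) iii(3) \<gamma> t g q c3_def iii(1)])
            then show ?thesis
              by (intro weaken[OF d(2)] h.lower_dense_regime_const[OF p(1) iii(3) \<gamma> t g q c3 _ th(2) ds C(2)])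
          qed
        qed
        then show ?thesis by simp
      qed
      show "let Hp = random_induced H p;
             X = (\<lambda>G. real (num_edges G));
             \<mu> = measure_pmf.expectation Hp X;
             VarX = measure_pmf.variance Hp X;
             \<Lambda> = \<mu> * (1 + real n * p ^ (k - 1));
             tail = measure_pmf.prob Hp {G. X G \<ge> \<mu> + t}
         in
          ((p \<notin> {real n powr (- 1 / (real k - 1) - \<gamma>) <..<
                   \<gamma> * real n powr (- 1 / (real k - 1)) * ln (real n) powr (1 / (real k - 1))}
            \<or> t \<ge> \<gamma> * min (VarX powr (2/3)) (\<mu> powr (2/3)) * ln (real n) powr (4/3)
            \<or> t \<ge> \<mu> * p powr ((real k - 2) / 3 - \<gamma>))
           \<longrightarrow> tail \<le> (1 + 1 / real n) *
                 exp (- c * min (phi (t / \<mu>) * \<mu>\<^sup>2 / \<Lambda>) (sqrt t * ln (exp 1 / p))))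
          \<and>
          ((p \<le> real n powr (- 2 / (real k + 1/3))
            \<or> (t \<ge> min (VarX powr (2/3)) (\<mu> powr (2/3)) * ln (real n) powr (2/3)
                \<and> p \<le> real n powr (- 1 / (real k - 1)) * ln (real n))
            \<or> (t \<ge> min (sqrt VarX) (sqrt \<Lambda>)
                \<and> \<gamma> * real n powr (- 1 / (real k - 1)) \<le> p \<and> p \<le> 1 - \<gamma>))
           \<longrightarrow> small_dense_set H D (min (th * t) (\<mu> + t)) \<longrightarrow> \<mu> + t \<ge> 1
           \<longrightarrow> tail \<ge> d *
                 exp (- C * min (phi (t / \<mu>) * \<mu>\<^sup>2 / \<Lambda>) (sqrt t * ln (1 / p))))"
        unfolding Let_def mu va tail rate dense
        using upper lower unfolding h.Lam_def by blast
    qed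
  qed
qed

end
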